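(* Let $G$ be a discrete countable group and let $\mu$ be an admissible probability measure on $G$. Let $(X,d)$ be a separable complete $\mathrm{CAT}(0)$ space and let $G\curvearrowright (X,d)$ be an action by isometries such that $G$ contains two independent contracting elements. Let $o\in X$ be a basepoint. Define $l_X(\mu)\in[0,\infty]$ by $$l_X(\mu):=\liminf_{n\to\infty}\frac1n\int_\Omega d(Z_n(\omega)o,o)\,d\mathbb P(\omega).$$ Then $l_X(\mu)>0$. If moreover $\mu$ has finite first moment, then almost surely $$\frac1n d(o,Z_n o)\underset{n\to\infty}{\longrightarrow} l_X(\mu)>0.$$
   Context: $\mu$ is admissible if its support generates $G$ as a semigroup. $\mu$ has finite first moment if $\int_G d(go,o)\,d\mu(g)<\infty$. Let $\Omega=G^{\mathbb N}$, $\mathbb P=\mu^{\otimes\mathbb N}$; for $\omega=(\omega_i)\in\Omega$ the random walk generated by $\mu$ is $Z_n(\omega)=\omega_1\omega_2\cdots\omega_n$, $Z_0=\mathrm{id}$. "Almost surely" refers to $\mathbb P$. An isometry $g$ of $X$ is axial if its displacement function $x\mapsto d(gx,x)$ attains a positive minimum; equivalently $g$ translates nontrivially along some geodesic line (an axis). A geodesic $\gamma$ is $C$-contracting ($C>0$) if for every metric ball $B$ disjoint from $\gamma$, the nearest-point projection $\pi_\gamma(B)$ has diameter at most $C$. An axial isometry is contracting if one of its axes is $C$-contracting for some $C>0$. Two axial isometries $g_1,g_2$ are independent if the map $(m,n)\in\mathbb Z\times\mathbb Z\mapsto d(g_1^m o,g_2^n o)\in[0,\infty)$ is proper; for contracting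 isometries this amounts to their pairs of fixed points in the visual boundary $\partial_\infty X$ being disjoint. *)

theory Defs
  imports "HOL-Algebra.Group_Action" "HOL-Probability.Probability"
begin

definition geodesic_segment :: "'x::metric_space set \<Rightarrow> 'x \<Rightarrow> 'x \<Rightarrow> bool" where
  "geodesic_segment S x y \<longleftrightarrow>
     (\<exists>c. (\<forall>s\<in>{0..dist x y}. \<forall>t\<in>{0..dist x y}. dist (c s) (c t) = \<bar>s - t\<bar>)
        \<and> c 0 = x \<and> c (dist x y) = y \<and> S = c ` {0..dist x y})"

(* Two distinct sides of a triangle share a vertex, and all labellings of the vertices are
   quantified over, so it suffices to compare p on a side [x,y] with q on a side [x,z];
   for two points on the same side the inequality is an equality. *)
definition CAT0 :: "'x::metric_space itself \<Rightarrow> bool" where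
  "CAT0 (_ :: 'x itself) \<longleftrightarrow>
     (\<forall>x y :: 'x. \<exists>S. geodesic_segment S x y)
   \<and> (\<forall>(x::'x) y z S T U (x'::real^2) y' z'.
        geodesic_segment S x y \<and> geodesic_segment T x z \<and> geodesic_segment U y z
        \<and> dist x' y' = dist x y \<and> dist x' z' = dist x z \<and> dist y' z' = dist y z
        \<longrightarrow> (\<forall>p\<in>S. \<forall>q\<in>T. \<forall>p'\<in>closed_segment x' y'. \<forall>q'\<in>closed_segment x' z'.
              dist x' p' = dist x p \<and> dist x' q' = dist x q \<longrightarrow> dist p q \<le> dist p' q'))"

definition geodesic_line :: "(real \<Rightarrow> 'x::metric_space) \<Rightarrow> bool" where
  "geodesic_line \<gamma> \<longleftrightarrow> (\<forall>s t. dist (\<gamma> s) (\<gamma> t) = \<bar>s - t\<bar>)"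

definition nearest_points :: "'x::metric_space set \<Rightarrow> 'x set \<Rightarrow> 'x set" where
  "nearest_points S B = {p \<in> S. \<exists>b\<in>B. \<forall>q\<in>S. dist b p \<le> dist b q}"

(* diameter is a real supremum, which is unspecified on unbounded sets; hence the guard. *)
definition contracting_line :: "real \<Rightarrow> (real \<Rightarrow> 'x::metric_space) \<Rightarrow> bool" where
  "contracting_line C \<gamma> \<longleftrightarrow>
     (\<forall>x r. ball x r \<inter> range \<gamma> = {} \<longrightarrow>
        bounded (nearest_points (range \<gamma>) (ball x r))
        \<and> diameter (nearest_points (range \<gamma>) (ball x r)) \<le> C)"

definition axial :: "('x::metric_space \<Rightarrow> 'x) \<Rightarrow> bool" where
  "axial f \<longleftrightarrow> (\<exists>x. dist (f x) x > 0 \<and> (\<forall>y. dist (f x) x \<le> dist (f y) y))"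

definition axis_of :: "(real \<Rightarrow> 'x::metric_space) \<Rightarrow> ('x \<Rightarrow> 'x) \<Rightarrow> bool" where
  "axis_of \<gamma> f \<longleftrightarrow> geodesic_line \<gamma> \<and> (\<exists>\<tau>. \<tau> \<noteq> 0 \<and> (\<forall>t. f (\<gamma> t) = \<gamma> (t + \<tau>)))"

definition contracting :: "('x::metric_space \<Rightarrow> 'x) \<Rightarrow> bool" where
  "contracting f \<longleftrightarrow> axial f \<and> (\<exists>\<gamma> C. axis_of \<gamma> f \<and> C > 0 \<and> contracting_line C \<gamma>)"

definition isometric_action ::
    "('g, 'b) monoid_scheme \<Rightarrow> ('g \<Rightarrow> 'x::metric_space \<Rightarrow> 'x) \<Rightarrow> bool" where
  "isometric_action G \<phi> \<longleftrightarrow>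
     group_action G UNIV \<phi> \<and> (\<forall>g\<in>carrier G. \<forall>x y. dist (\<phi> g x) (\<phi> g y) = dist x y)"

definition independent_elements ::
    "('g, 'b) monoid_scheme \<Rightarrow> ('g \<Rightarrow> 'x::metric_space \<Rightarrow> 'x) \<Rightarrow> 'x \<Rightarrow> 'g \<Rightarrow> 'g \<Rightarrow> bool" where
  "independent_elements G \<phi> x0 g h \<longleftrightarrow>
     proper_map (discrete_topology (UNIV :: (int \<times> int) set)) (top_of_set {0::real..})
       (\<lambda>(m, n). dist (\<phi> (g [^]\<^bsub>G\<^esub> m) x0) (\<phi> (h [^]\<^bsub>G\<^esub> n) x0))"

inductive_set semigroup_generated :: "('g, 'b) monoid_scheme \<Rightarrow> 'g set \<Rightarrow> 'g set"
  for G and S where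
  incl: "s \<in> S \<Longrightarrow> s \<in> semigroup_generated G S"
| mult: "a \<in> semigroup_generated G S \<Longrightarrow> b \<in> semigroup_generated G S \<Longrightarrow>
    a \<otimes>\<^bsub>G\<^esub> b \<in> semigroup_generated G S"

definition admissible :: "('g, 'b) monoid_scheme \<Rightarrow> 'g measure \<Rightarrow> bool" where
  "admissible G \<mu> \<longleftrightarrow> semigroup_generated G {g \<in> carrier G. emeasure \<mu> {g} > 0} = carrier G"

definition finite_first_moment ::
    "('g \<Rightarrow> 'x::metric_space \<Rightarrow> 'x) \<Rightarrow> 'x \<Rightarrow> 'g measure \<Rightarrow> bool" where
  "finite_first_moment \<phi> x0 \<mu> \<longleftrightarrow> (\<integral>\<^sup>+ g. ennreal (dist (\<phi> g x0) x0) \<partial>\<mu>) < \<infinity>"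

definition walk_space :: "'g measure \<Rightarrow> (nat \<Rightarrow> 'g) measure" where
  "walk_space \<mu> = PiM UNIV (\<lambda>_. \<mu>)"

(* The increments are indexed from 0: walk G n \<omega> = \<omega> 0 \<otimes> ... \<otimes> \<omega> (n - 1). *)
primrec walk :: "('g, 'b) monoid_scheme \<Rightarrow> nat \<Rightarrow> (nat \<Rightarrow> 'g) \<Rightarrow> 'g" where
  "walk G 0 \<omega> = \<one>\<^bsub>G\<^esub>"
| "walk G (Suc n) \<omega> = walk G n \<omega> \<otimes>\<^bsub>G\<^esub> \<omega> n"

definition drift :: "('g, 'b) monoid_scheme \<Rightarrow> ('g \<Rightarrow> 'x::metric_space \<Rightarrow> 'x) \<Rightarrow> 'x \<Rightarrow>
    'g measure \<Rightarrow> ennreal" where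
  "drift G \<phi> x0 \<mu> =
     liminf (\<lambda>n. (\<integral>\<^sup>+ \<omega>. ennreal (dist (\<phi> (walk G n \<omega>) x0) x0) \<partial>walk_space \<mu>) / of_nat n)"

end

theory Submission
  imports Defs
begin

text \<open>
  Positivity of the drift is shown by pivoting, in the spirit of Gouezel. A power \<open>\<mu>\<^sup>*\<^sup>L\<close> dominates a
  multiple of the law of \<open>a b\<close>, with \<open>a\<close> and \<open>b\<close> independent and uniform in a finite Schottky set \<open>S\<close>, so the
  walk is a product \<open>g s\<^sub>1 w\<^sub>1 \<dots> s\<^sub>n w\<^sub>n\<close> with independent \<open>s\<^sub>i = a\<^sub>i b\<^sub>i\<close> and arbitrary other factors. Reading
  such a product from the left, one keeps a stack of pivots, that is, of letters \<open>a\<^sub>i\<close> whose contracting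
  axes are crossed one after the other by any geodesic from the base point to the current position, for
  \<^emph>\<open>every\<close> choice of these letters among all but one element of \<open>S\<close>. A new letter is pushed with large
  probability; otherwise pivots are popped, each with small probability since at most one value of
  its letter is bad. Hence \<open>\<integral> (1/4) powr d(o, Z\<^sub>n o)\<close> decays exponentially, which needs no moment
  assumption. Geometrically only the following is used: if the projections of \<open>x\<close> and \<open>y\<close> to a
  contracting line are far apart, then the geodesic from \<open>x\<close> to \<open>y\<close> follows the line in between.

  For the almost sure convergence, upper and lower limits are constant by the zero-one law, and a
  covering argument compares these constants with the integrals of \<open>d(o, Z\<^sub>n o) / n\<close>.
\<close>

section \<open>Pivoting along Schottky letters\<close>

text \<open>The obstacle is that later factors can destroy the progress made by earlier ones, so the
  letter of a pivot stays averaged, never fixed, as long as it is a pivot. A block carries two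
  Schottky letters because a pivot must be screened from both sides: whether \<open>a\<close> may be
  used depends only on the past, whether \<open>b\<close> may be used depends only on the arbitrary
  word behind it, and the passage from \<open>a\<close> to \<open>b\<close> is harmless for every
  pair. Each condition therefore excludes at most one letter. Every pivot is worth a distance of at
  least 1, which the function \<open>(1/4) powr d\<close> turns into a factor 1/4; the constant 64
  is the size for which one block gains a factor 1/2 after all losses. The estimate holds for all
  words between the blocks and involves only finite averages. The random walk enters through a lower
  bound for finitely many hitting probabilities, so its law never has to be decomposed. The
  translation length \<open>T\<close> is chosen last and only has to dominate the constants
  \<open>K\<close>, \<open>D\<close> and \<open>R\<close>, none of which depends on it.\<close>

locale isometric_group_action = group G for G (structure) +
  fixes \<phi> :: "'a \<Rightarrow> 'x::metric_space \<Rightarrow> 'x"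
  assumes act: "isometric_action G \<phi>"
begin

lemma act_mult: "g \<in> carrier G \<Longrightarrow> h \<in> carrier G \<Longrightarrow> \<phi> (g \<otimes> h) x = \<phi> g (\<phi> h x)"
  using act group_action.composition_rule[of G UNIV \<phi> x g h]
  unfolding isometric_action_def by auto

lemma act_one [simp]: "\<phi> \<one> x = x"
proof -
  have "(\<lambda>x\<in>UNIV. x) = \<phi> \<one>"
    using act group_action.id_eq_one[of G UNIV \<phi>] unfolding isometric_action_def by blast
  then show ?thesis by (metis UNIV_I restrict_apply)
qed

lemma act_dist [simp]: "g \<in> carrier G \<Longrightarrow> dist (\<phi> g x) (\<phi> g y) = dist x y"
  using act unfolding isometric_action_def by blast

lemma act_inv_cancel [simp]:
  assumes "g \<in> carrier G" shows "\<phi> (inv g) (\<phi> g x) = x" "\<phi> g (\<phi> (inv g) x) = x"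
  using act_mult[of "inv g" g x] act_mult[of g "inv g" x] assms by auto

lemma act_dist_inv: "g \<in> carrier G \<Longrightarrow> dist (\<phi> (inv g) x) y = dist x (\<phi> g y)"
  by (metis act_inv_cancel(2) act_dist inv_closed)

end

text \<open>Here \<open>p a x\<close> stands for the coordinate of a nearest point to
  \<open>x\<close> on the axis of \<open>a\<close>, and \<open>q a x\<close> for the distance of
  \<open>x\<close> to that axis; \<open>K\<close> is the coarse error. The condition
  \<open>link_proj\<close> is one-sided because \<open>inv a\<close> moves \<open>x0\<close> far in
  the negative direction along the axis of \<open>a\<close> itself.\<close>

locale schottky_set = isometric_group_action G \<phi>
  for G (structure) and \<phi> :: "'a \<Rightarrow> 'x::metric_space \<Rightarrow> 'x" +
  fixes x0 :: 'x and S :: "'a set" and p q :: "'a \<Rightarrow> 'x \<Rightarrow> real" and K D R T :: real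
  assumes S_carrier: "S \<subseteq> carrier G"
    and card_S: "card S = 64"
    and q_nonneg: "a \<in> S \<Longrightarrow> 0 \<le> q a x"
    and D_nonneg: "0 \<le> D" and K_nonneg: "0 \<le> K" and R_nonneg: "0 \<le> R"
    and proj_dist: "a \<in> S \<Longrightarrow> K < \<bar>p a x - p a y\<bar> \<Longrightarrow> q a x + \<bar>p a x - p a y\<bar> + q a y - K \<le> dist x y"
    and base_dist: "a \<in> S \<Longrightarrow> dist x x0 \<le> q a x + \<bar>p a x\<bar> + D"
    and few_far: "card {a \<in> S. R < \<bar>p a x\<bar>} \<le> 1"
    and base_proj: "a \<in> S \<Longrightarrow> \<bar>p a x0\<bar> \<le> R"
    and link_proj: "a \<in> S \<Longrightarrow> b \<in> S \<Longrightarrow> p b (\<phi> (inv a) x0) \<le> R"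
    and translate_proj: "a \<in> S \<Longrightarrow> p a x + T - K \<le> p a (\<phi> a x)"
    and T_large: "4 * R + 5 * K + 2 * D + 1 < T"
begin

lemma finite_S: "finite S"
  using card_S card.infinite by fastforce

lemma S_closed: "a \<in> S \<Longrightarrow> a \<in> carrier G"
  using S_carrier by blast

text \<open>After translation by \<open>inv u\<close> the path runs from \<open>z\<close> to
  \<open>w\<close>. On the axis of \<open>a\<close> the coordinate is at most R + K at
  \<open>z\<close> and at least T - K - R at \<open>w\<close>, so \<open>dist z w\<close> exceeds
  \<open>dist z x0\<close> by at least T - 3R - 4K - D. If screening failed for \<open>b\<close>,
  its axis would allow an excess of at most R + K + D. The bound \<open>T_large\<close> covers both
  claims.\<close>

lemma link:
  assumes u: "u \<in> carrier G" and a: "a \<in> S" and y: "y \<in> carrier G"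
    and behind: "p a (\<phi> (inv u) x0) \<le> R + K"
    and ahead: "- R \<le> p a (\<phi> y x0)"
  shows "dist x0 (\<phi> u x0) + 1 \<le> dist x0 (\<phi> (u \<otimes> a \<otimes> y) x0)"
    and "b \<in> S \<Longrightarrow> p b (\<phi> (inv (a \<otimes> y)) x0) \<le> R \<Longrightarrow> p b (\<phi> (inv (u \<otimes> a \<otimes> y)) x0) \<le> R + K"
proof -
  note ac = S_closed[OF a]
  define z where "z = \<phi> (inv u) x0"
  define w where "w = \<phi> (a \<otimes> y) x0"
  define \<alpha> where "\<alpha> = p a z"
  define A where "A = q a z"
  have w: "w = \<phi> a (\<phi> y x0)" unfolding w_def using ac y by (simp add: act_mult)
  have pw: "p a w \<ge> T - K - R"
    using translate_proj[OF a, of "\<phi> y x0"] ahead unfolding w by linarith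
  have al: "\<alpha> \<le> R + K" using behind unfolding \<alpha>_def z_def .
  have gap: "p a w - p a z \<ge> T - 2 * R - 2 * K" using pw al unfolding \<alpha>_def by linarith
  have "K < \<bar>p a z - p a w\<bar>"
    using gap T_large R_nonneg K_nonneg D_nonneg by linarith
  from proj_dist[OF a this] q_nonneg[OF a, of w]
  have zw: "A + (T - K - R - \<alpha>) - K \<le> dist z w"
    using pw unfolding A_def \<alpha>_def by linarith
  have z0: "dist z x0 \<le> A + \<bar>\<alpha>\<bar> + D"
    using base_dist[OF a, of z] unfolding A_def \<alpha>_def .
  have du: "dist x0 (\<phi> u x0) = dist z x0"
    unfolding z_def using u by (simp add: act_dist_inv)
  have duay: "dist x0 (\<phi> (u \<otimes> a \<otimes> y) x0) = dist z w"
    unfolding z_def w_def using u ac y by (simp add: act_dist_inv act_mult m_assoc)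
  show "dist x0 (\<phi> u x0) + 1 \<le> dist x0 (\<phi> (u \<otimes> a \<otimes> y) x0)"
    unfolding du duay using zw z0 al T_large R_nonneg K_nonneg D_nonneg by linarith
  assume b: "b \<in> S" and pb: "p b (\<phi> (inv (a \<otimes> y)) x0) \<le> R"
  note bc = S_closed[OF b]
  define g where "g = inv (a \<otimes> y)"
  have gc: "g \<in> carrier G" unfolding g_def using ac y by simp
  define \<beta> where "\<beta> = p b (\<phi> g z)"
  define B where "B = q b (\<phi> g z)"
  have eq: "\<phi> (inv (u \<otimes> a \<otimes> y)) x0 = \<phi> g z"
    unfolding g_def z_def using u ac y by (simp add: inv_mult_group m_assoc flip: act_mult)
  show "p b (\<phi> (inv (u \<otimes> a \<otimes> y)) x0) \<le> R + K"
    unfolding eq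
  proof (rule ccontr)
    assume "\<not> p b (\<phi> g z) \<le> R + K"
    then have \<beta>: "\<beta> > R + K" unfolding \<beta>_def by simp
    have pb': "p b (\<phi> g x0) \<le> R" using pb unfolding g_def .
    have "K < \<bar>p b (\<phi> g z) - p b (\<phi> g x0)\<bar>" using \<beta> pb' unfolding \<beta>_def by linarith
    from proj_dist[OF b this] q_nonneg[OF b, of "\<phi> g x0"]
    have 1: "B + (\<beta> - R) - K \<le> dist z x0"
      using gc pb' unfolding B_def \<beta>_def by simp
    have "dist z w = dist (\<phi> g z) x0"
      unfolding w_def g_def using ac y by (simp add: act_dist_inv)
    also have "\<dots> \<le> B + \<bar>\<beta>\<bar> + D" using base_dist[OF b, of "\<phi> g z"] unfolding B_def \<beta>_def .
    finally show False
      using 1 z0 zw \<beta> al T_large R_nonneg K_nonneg D_nonneg by linarith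
  qed
qed

text \<open>The mean of \<open>f\<close> over \<open>z a\<^sub>1 b\<^sub>1 w\<^sub>1 a\<^sub>2
  b\<^sub>2 w\<^sub>2 ...\<close> for independent uniform letters and fixed words. The divisor is
  the number of pairs from \<open>S\<close>.\<close>

primrec interleaved_avg :: "'a list \<Rightarrow> ('a \<Rightarrow> real) \<Rightarrow> 'a \<Rightarrow> real" where
  "interleaved_avg [] f z = f z"
| "interleaved_avg (w # ws) f z =
     (\<Sum>a\<in>S. \<Sum>b\<in>S. interleaved_avg ws f (z \<otimes> a \<otimes> b \<otimes> w)) / 64\<^sup>2"

text \<open>A stack \<open>[(x\<^sub>j, A\<^sub>j), \<dots>, (x\<^sub>1, A\<^sub>1)]\<close> stands for the random element
  \<open>x\<^sub>1 a\<^sub>1 \<dots> x\<^sub>j a\<^sub>j\<close> whose pivotal letters \<open>a\<^sub>i\<close> are independent and uniform in \<open>A\<^sub>i\<close>.\<close>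

primrec stack_avg :: "('a \<times> 'a set) list \<Rightarrow> ('a \<Rightarrow> real) \<Rightarrow> real" where
  "stack_avg [] f = f \<one>"
| "stack_avg (fr # st) f =
     stack_avg st (\<lambda>v. (\<Sum>a\<in>snd fr. f (v \<otimes> fst fr \<otimes> a)) / real (card (snd fr)))"

primrec stack_values :: "('a \<times> 'a set) list \<Rightarrow> 'a set" where
  "stack_values [] = {\<one>}"
| "stack_values (fr # st) = (\<lambda>(v, a). v \<otimes> fst fr \<otimes> a) ` (stack_values st \<times> snd fr)"

text \<open>The requirements are imposed for every choice of the letters below, so a letter can be
  averaged without reference to the others. The height of the stack is a lower bound for the
  distance to the base point, and the bound 63 records that a frame has lost at most one of the 64
  letters.\<close>

primrec valid_stack :: "('a \<times> 'a set) list \<Rightarrow> bool" where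
  "valid_stack [] \<longleftrightarrow> True"
| "valid_stack (fr # st) \<longleftrightarrow> valid_stack st \<and> fst fr \<in> carrier G \<and> snd fr \<subseteq> S \<and> 63 \<le> card (snd fr)
     \<and> (\<forall>v\<in>stack_values st. length st \<le> dist x0 (\<phi> (v \<otimes> fst fr) x0)
          \<and> (\<forall>a\<in>snd fr. p a (\<phi> (inv (v \<otimes> fst fr)) x0) \<le> R + K))"

text \<open>The element \<open>t\<close> locates, relative to the current position, a point of the past that does not
  depend on the pivotal letters and screens them off.\<close>

definition anchored :: "nat \<Rightarrow> 'a \<Rightarrow> 'a \<Rightarrow> bool" where
  "anchored n t z \<longleftrightarrow> n \<le> dist x0 (\<phi> z x0)
     \<and> (\<forall>a\<in>S. p a (\<phi> t x0) \<le> R \<longrightarrow> p a (\<phi> (inv z) x0) \<le> R + K)"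

lemma stack_values_closed: "valid_stack st \<Longrightarrow> v \<in> stack_values st \<Longrightarrow> v \<in> carrier G"
  by (induction st arbitrary: v) (auto dest: S_closed)

lemma stack_avg_mono:
  "(\<And>v. v \<in> stack_values st \<Longrightarrow> f v \<le> g v) \<Longrightarrow> stack_avg st f \<le> stack_avg st g"
proof (induction st arbitrary: f g)
  case (Cons fr st)
  show ?case
    unfolding stack_avg.simps
    by (intro Cons.IH divide_right_mono sum_mono Cons.prems) auto
qed auto

lemma stack_avg_cong:
  "(\<And>v. v \<in> stack_values st \<Longrightarrow> f v = g v) \<Longrightarrow> stack_avg st f = stack_avg st g"
  by (intro antisym stack_avg_mono) auto

lemma stack_avg_mult: "stack_avg st (\<lambda>v. c * f v) = c * stack_avg st f"
  by (induction st arbitrary: f) (auto simp: mult.assoc simp flip: sum_distrib_left times_divide_eq_right)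

lemma stack_avg_sum: "stack_avg st (\<lambda>v. \<Sum>i\<in>I. f i v) = (\<Sum>i\<in>I. stack_avg st (f i))"
proof (induction st arbitrary: f)
  case (Cons fr st)
  have "stack_avg (fr # st) (\<lambda>v. \<Sum>i\<in>I. f i v) =
      stack_avg st (\<lambda>v. \<Sum>i\<in>I. (\<Sum>a\<in>snd fr. f i (v \<otimes> fst fr \<otimes> a)) / real (card (snd fr)))"
    by (simp add: sum_divide_distrib sum.swap[of _ I])
  then show ?case by (simp add: Cons.IH)
qed simp

lemma stack_avg_divide: "stack_avg st (\<lambda>v. f v / c) = stack_avg st f / c"
  using stack_avg_mult[of st "1 / c" f] by simp

lemma card_bad: "card {a \<in> S. \<not> - R \<le> p a x} \<le> 1" "card {a \<in> S. \<not> p a x \<le> R} \<le> 1"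
  by (rule order.trans[OF card_mono few_far[of x]]; use finite_S R_nonneg in auto)+

text \<open>After an arbitrary word \<open>y\<close> the top frame is opened. All but at most one of
  its letters lead to an anchored position; for the remaining one the popping continues. The factor
  8 is 4 for the opened frame times 2 for the geometric series of further pops: (m + 8) / m is at
  most 2.\<close>

lemma pop_bound:
  fixes F :: "'a \<Rightarrow> real"
  assumes F: "\<And>st t x. valid_stack st \<Longrightarrow> x \<in> carrier G \<Longrightarrow> t \<in> carrier G \<Longrightarrow>
      (\<And>v. v \<in> stack_values st \<Longrightarrow> anchored (length st) t (v \<otimes> x)) \<Longrightarrow>
      stack_avg st (\<lambda>v. F (v \<otimes> x)) \<le> c * (1/4) ^ length st"
    and c: "0 \<le> c"
  shows "valid_stack st \<Longrightarrow> y \<in> carrier G \<Longrightarrow>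
      stack_avg st (\<lambda>v. F (v \<otimes> y)) \<le> 8 * c * (1/4) ^ length st"
proof (induction st arbitrary: y)
  case Nil
  have "F y \<le> c"
    using F[of "[]" y "inv y"] Nil R_nonneg K_nonneg by (auto simp: anchored_def)
  then show ?case using c Nil by simp
next
  case (Cons fr st)
  obtain x A where fr: "fr = (x, A)" by force
  have st: "valid_stack st" and x: "x \<in> carrier G" and AS: "A \<subseteq> S" and cA: "63 \<le> card A"
    and vx: "\<And>v. v \<in> stack_values st \<Longrightarrow> length st \<le> dist x0 (\<phi> (v \<otimes> x) x0)"
    and va: "\<And>v a. v \<in> stack_values st \<Longrightarrow> a \<in> A \<Longrightarrow> p a (\<phi> (inv (v \<otimes> x)) x0) \<le> R + K"
    using Cons.prems(1) by (auto simp: fr)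
  define m where "m = real (card A)"
  define C where "C = c * (1/4) ^ length st"
  have m: "63 \<le> m" using cA unfolding m_def by simp
  have C: "0 \<le> C" using c unfolding C_def by simp
  have finA: "finite A" using AS finite_S finite_subset by blast
  have Ac: "a \<in> carrier G" if "a \<in> A" for a using that AS S_closed by blast
  define J where "J a = stack_avg st (\<lambda>v. F (v \<otimes> (x \<otimes> a \<otimes> y)))" for a
  \<comment> \<open>Even a good letter leaves the stack: its value enters the new anchor
    \<open>inv (a \<otimes> y)\<close>, which thereby stays independent of the letters still on the
    stack.\<close>
  have good: "J a \<le> C" if a: "a \<in> A" and g: "- R \<le> p a (\<phi> y x0)" for a
    unfolding J_def C_def
  proof (rule F[OF st, where t = "inv (a \<otimes> y)"])
    fix v assume v: "v \<in> stack_values st"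
    note vc = stack_values_closed[OF st v]
    have e: "v \<otimes> (x \<otimes> a \<otimes> y) = v \<otimes> x \<otimes> a \<otimes> y"
      using vc x Ac[OF a] Cons.prems(2) by (simp add: m_assoc)
    have vxc: "v \<otimes> x \<in> carrier G" using vc x by simp
    have aS: "a \<in> S" using a AS by blast
    note l = link[OF vxc aS Cons.prems(2) va[OF v a] g]
    show "anchored (length st) (inv (a \<otimes> y)) (v \<otimes> (x \<otimes> a \<otimes> y))"
      unfolding anchored_def e using l vx[OF v] by auto
  qed (use x Ac[OF a] Cons.prems(2) in auto)
  have bad: "J a \<le> 8 * C" if a: "a \<in> A" for a
    using Cons.IH[OF st, of "x \<otimes> a \<otimes> y"] x Ac[OF a] Cons.prems(2)
    unfolding J_def C_def by (simp add: mult.assoc)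
  have "stack_avg (fr # st) (\<lambda>v. F (v \<otimes> y)) =
      stack_avg st (\<lambda>v. (\<Sum>a\<in>A. F (v \<otimes> (x \<otimes> a \<otimes> y))) / m)"
    unfolding stack_avg.simps fr fst_conv snd_conv m_def
    by (intro stack_avg_cong arg_cong2[where f = "(/)"] sum.cong refl arg_cong[where f = F])
      (use stack_values_closed[OF st] x Ac Cons.prems(2) in \<open>auto simp: m_assoc\<close>)
  also have "\<dots> = (\<Sum>a\<in>A. J a) / m"
    unfolding stack_avg_divide stack_avg_sum J_def ..
  also have "(\<Sum>a\<in>A. J a) \<le> (\<Sum>a\<in>A. C + (if \<not> - R \<le> p a (\<phi> y x0) then 8 * C else 0))"
  proof (rule sum_mono)
    fix a assume "a \<in> A"
    then show "J a \<le> C + (if \<not> - R \<le> p a (\<phi> y x0) then 8 * C else 0)"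
      using good[of a] bad[of a] C by auto
  qed
  also have "\<dots> = m * C + real (card {a \<in> A. \<not> - R \<le> p a (\<phi> y x0)}) * (8 * C)"
    by (simp add: sum.distrib m_def finA flip: sum.inter_filter)
  also have "\<dots> \<le> m * C + 1 * (8 * C)"
  proof (intro add_left_mono mult_right_mono)
    have "card {a \<in> A. \<not> - R \<le> p a (\<phi> y x0)} \<le> card {a \<in> S. \<not> - R \<le> p a (\<phi> y x0)}"
      using AS finite_S by (intro card_mono) auto
    then show "real (card {a \<in> A. \<not> - R \<le> p a (\<phi> y x0)}) \<le> 1"
      using card_bad(1)[of "\<phi> y x0"] by linarith
  qed (use C in auto)
  also have "(m * C + 1 * (8 * C)) / m \<le> 2 * C"
  proof -
    have "8 * C \<le> m * C" using m C by (intro mult_right_mono) auto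
    then show ?thesis using m by (simp add: divide_le_eq mult.commute)
  qed
  finally have "stack_avg (fr # st) (\<lambda>v. F (v \<otimes> y)) \<le> 2 * C" using m by (simp add: divide_right_mono)
  then show ?case unfolding C_def by simp
qed

text \<open>Each block first pushes a frame for \<open>a\<close>, whose admissible letters are read
  off from \<open>t\<close> alone, and then asks whether \<open>b\<close> survives the word
  \<open>w\<close>. If it does, the stack has grown by one; in the exceptional cases
  \<open>pop_bound\<close> limits the damage to a factor 8.\<close>

lemma interleaved_avg_stack:
  defines "f \<equiv> \<lambda>z. (1/4) powr dist x0 (\<phi> z x0)"
  shows "set ws \<subseteq> carrier G \<Longrightarrow> valid_stack st \<Longrightarrow> x \<in> carrier G \<Longrightarrow> t \<in> carrier G \<Longrightarrow>
      (\<And>v. v \<in> stack_values st \<Longrightarrow> anchored (length st) t (v \<otimes> x)) \<Longrightarrow>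
      stack_avg st (\<lambda>v. interleaved_avg ws f (v \<otimes> x)) \<le> (1/2) ^ length ws * (1/4) ^ length st"
proof (induction ws arbitrary: st x t)
  case Nil
  have "stack_avg st (\<lambda>v. f (v \<otimes> x)) \<le> stack_avg st (\<lambda>v. (1/4) ^ length st * 1)"
  proof (rule stack_avg_mono)
    fix v assume "v \<in> stack_values st"
    from Nil.prems(5)[OF this] have "real (length st) \<le> dist x0 (\<phi> (v \<otimes> x) x0)"
      unfolding anchored_def by simp
    then have "f (v \<otimes> x) \<le> (1/4) powr real (length st)"
      unfolding f_def by (intro powr_mono') auto
    then show "f (v \<otimes> x) \<le> (1/4) ^ length st * 1" by (simp add: powr_realpow)
  qed
  also have "\<dots> = (1/4) ^ length st * stack_avg st (\<lambda>v. 1)" by (rule stack_avg_mult)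
  also have "stack_avg st (\<lambda>v. 1) \<le> 1"
  proof (induction st)
    case (Cons fr st)
    have "stack_avg (fr # st) (\<lambda>v. 1) \<le> stack_avg st (\<lambda>v. 1)"
      unfolding stack_avg.simps by (rule stack_avg_mono) simp
    then show ?case using Cons.IH by (rule order.trans)
  qed simp
  finally show ?case by (simp add: mult_left_mono)
next
  case (Cons w ws)
  define F where "F = interleaved_avg ws f"
  define c :: real where "c = (1/2) ^ length ws"
  have c: "0 \<le> c" unfolding c_def by simp
  have wc: "w \<in> carrier G" and wsc: "set ws \<subseteq> carrier G" using Cons.prems by auto
  have F: "stack_avg st (\<lambda>v. F (v \<otimes> x)) \<le> c * (1/4) ^ length st"
    if "valid_stack st" "x \<in> carrier G" "t \<in> carrier G"
      "\<And>v. v \<in> stack_values st \<Longrightarrow> anchored (length st) t (v \<otimes> x)" for st x t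
    unfolding F_def c_def by (rule Cons.IH[OF wsc that])
  define C where "C = c * (1/4) ^ length st"
  have C: "0 \<le> C" using c unfolding C_def by simp
  define J where "J a b = stack_avg st (\<lambda>v. F (v \<otimes> (x \<otimes> a \<otimes> b \<otimes> w)))" for a b
  \<comment> \<open>Since \<open>t\<close> does not involve the letters on the stack, neither does
    \<open>A\<close>; this makes \<open>(x, A)\<close> a legitimate frame.\<close>
  define A where "A = {a \<in> S. p a (\<phi> t x0) \<le> R}"
  have AS: "A \<subseteq> S" unfolding A_def by auto
  have cS: "card A + card (S - A) = 64"
    using card_S AS finite_S by (metis card_Diff_subset card_mono finite_subset le_add_diff_inverse)
  have "S - A = {a \<in> S. \<not> p a (\<phi> t x0) \<le> R}" unfolding A_def by auto
  then have cA': "card (S - A) \<le> 1" using card_bad(2) by simp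
  then have cA: "63 \<le> card A" using cS by simp
  have vst: "valid_stack ((x, A) # st)"
    using Cons.prems cA AS unfolding A_def anchored_def by auto
  have bad: "J a b \<le> 8 * C" if a: "a \<in> S" and b: "b \<in> S" for a b
  proof -
    have "x \<otimes> a \<otimes> b \<otimes> w \<in> carrier G" using Cons.prems(3) S_closed[OF a] S_closed[OF b] wc by simp
    then have "J a b \<le> 8 * c * (1/4) ^ length st"
      unfolding J_def by (intro pop_bound[OF _ c Cons.prems(2)] F)
    then show ?thesis unfolding C_def by (simp add: mult.assoc)
  qed
  have good: "(\<Sum>a\<in>A. J a b) \<le> 16 * C" if b: "b \<in> S" and g: "- R \<le> p b (\<phi> w x0)" for b
  proof -
    note bc = S_closed[OF b]
    have "stack_avg ((x, A) # st) (\<lambda>v. F (v \<otimes> (b \<otimes> w))) \<le> c * (1/4) ^ length ((x, A) # st)"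
    proof (rule F[OF vst, where t = "inv (b \<otimes> w)"])
      fix v' assume "v' \<in> stack_values ((x, A) # st)"
      then obtain v a where v: "v \<in> stack_values st" and a: "a \<in> A" and v': "v' = v \<otimes> x \<otimes> a"
        by auto
      have aS: "a \<in> S" using a AS by blast
      note ac = S_closed[OF aS]
      note vc = stack_values_closed[OF Cons.prems(2) v]
      have vxc: "v \<otimes> x \<in> carrier G" using vc Cons.prems(3) by simp
      have pa: "p a (\<phi> (inv (v \<otimes> x)) x0) \<le> R + K"
        and len: "length st \<le> dist x0 (\<phi> (v \<otimes> x) x0)"
        using Cons.prems(5)[OF v] a unfolding anchored_def A_def by auto
      have pa0: "- R \<le> p a (\<phi> \<one> x0)" using base_proj[OF aS] by auto
      have v'c: "v' \<in> carrier G" unfolding v' using vxc ac by simp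
      have e1: "v \<otimes> x \<otimes> a \<otimes> \<one> = v'" "a \<otimes> \<one> = a" unfolding v' using vxc ac by auto
      \<comment> \<open>The linking inequality is used twice: across \<open>a\<close> with the
        trivial word, which yields the new unit of distance and the position behind
        \<open>b\<close>, and then across \<open>b\<close> with the word \<open>w\<close>.\<close>
      note l1 = link[OF vxc aS one_closed pa pa0, unfolded e1]
      have pb: "p b (\<phi> (inv v') x0) \<le> R + K"
        by (rule l1(2)[OF b link_proj[OF aS b]])
      note l2 = link[OF v'c b wc pb g]
      have e2: "v' \<otimes> (b \<otimes> w) = v' \<otimes> b \<otimes> w" using v'c bc wc by (simp add: m_assoc)
      show "anchored (length ((x, A) # st)) (inv (b \<otimes> w)) (v' \<otimes> (b \<otimes> w))"
        unfolding anchored_def e2 using l1(1) l2 len by auto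
    qed (use bc wc in auto)
    also have "stack_avg ((x, A) # st) (\<lambda>v. F (v \<otimes> (b \<otimes> w))) =
        stack_avg st (\<lambda>v. (\<Sum>a\<in>A. F (v \<otimes> (x \<otimes> a \<otimes> b \<otimes> w))) / real (card A))"
      unfolding stack_avg.simps fst_conv snd_conv
      by (intro stack_avg_cong arg_cong2[where f = "(/)"] sum.cong refl arg_cong[where f = F])
        (use stack_values_closed[OF Cons.prems(2)] Cons.prems(3) S_closed AS bc wc in
          \<open>auto simp: m_assoc subset_iff\<close>)
    also have "\<dots> = (\<Sum>a\<in>A. J a b) / real (card A)"
      unfolding stack_avg_divide stack_avg_sum J_def ..
    finally have "(\<Sum>a\<in>A. J a b) \<le> real (card A) * (C / 4)"
      using cA by (simp add: divide_le_eq C_def field_simps)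
    also have "\<dots> \<le> 64 * (C / 4)" using cS C by (intro mult_right_mono) auto
    finally show ?thesis by simp
  qed
  have row: "(\<Sum>a\<in>S. J a b) \<le> 24 * C + (if \<not> - R \<le> p b (\<phi> w x0) then 512 * C else 0)"
    if b: "b \<in> S" for b
  proof (cases "- R \<le> p b (\<phi> w x0)")
    case True
    have "(\<Sum>a\<in>S. J a b) = (\<Sum>a\<in>A. J a b) + (\<Sum>a\<in>S - A. J a b)"
      using AS finite_S by (metis add.commute sum.subset_diff)
    also have "(\<Sum>a\<in>S - A. J a b) \<le> real (card (S - A)) * (8 * C)"
      by (rule sum_bounded_above) (use bad b in auto)
    also have "\<dots> \<le> 1 * (8 * C)" using cA' C by (intro mult_right_mono) auto
    finally show ?thesis using good[OF b True] True by simp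
  next
    case False
    have "(\<Sum>a\<in>S. J a b) \<le> real (card S) * (8 * C)"
      by (rule sum_bounded_above) (use bad b in auto)
    then show ?thesis using False card_S C by simp
  qed
  have "stack_avg st (\<lambda>v. interleaved_avg (w # ws) f (v \<otimes> x)) =
      stack_avg st (\<lambda>v. (\<Sum>b\<in>S. \<Sum>a\<in>S. F (v \<otimes> (x \<otimes> a \<otimes> b \<otimes> w))) / 64\<^sup>2)"
    unfolding interleaved_avg.simps F_def[symmetric]
    by (intro stack_avg_cong arg_cong2[where f = "(/)"] refl, subst sum.swap,
        intro sum.cong refl arg_cong[where f = F])
      (use stack_values_closed[OF Cons.prems(2)] Cons.prems(3) S_closed wc in \<open>auto simp: m_assoc\<close>)
  also have "\<dots> = (\<Sum>b\<in>S. \<Sum>a\<in>S. J a b) / 64\<^sup>2"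
    unfolding stack_avg_divide stack_avg_sum J_def ..
  also have "(\<Sum>b\<in>S. \<Sum>a\<in>S. J a b) \<le>
      (\<Sum>b\<in>S. 24 * C + (if \<not> - R \<le> p b (\<phi> w x0) then 512 * C else 0))"
    by (intro sum_mono row)
  also have "\<dots> = 64 * (24 * C) + real (card {b \<in> S. \<not> - R \<le> p b (\<phi> w x0)}) * (512 * C)"
    by (simp add: sum.distrib card_S finite_S flip: sum.inter_filter)
  also have "\<dots> \<le> 64 * (24 * C) + 1 * (512 * C)"
    using card_bad(1)[of "\<phi> w x0"] C by (intro add_left_mono mult_right_mono) auto
  \<comment> \<open>The gain is 64 * 64 * C / 4, the excluded values of \<open>a\<close> cost 64 * 8
    * C, and the excluded value of \<open>b\<close> costs 64 * 8 * C. The total 2048 * C is half of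
    64 * 64 * C.\<close>
  also have "\<dots> / 64\<^sup>2 = C / 2" by simp
  finally have "stack_avg st (\<lambda>v. interleaved_avg (w # ws) f (v \<otimes> x)) \<le> C / 2"
    by (simp add: divide_right_mono)
  then show ?case unfolding C_def c_def by simp
qed

theorem interleaved_avg_decay:
  assumes "set ws \<subseteq> carrier G" "g \<in> carrier G"
  shows "interleaved_avg ws (\<lambda>z. (1/4) powr dist x0 (\<phi> z x0)) g \<le> (1/2) ^ length ws"
  using interleaved_avg_stack[OF assms(1), of "[]" g "inv g"] assms(2) R_nonneg K_nonneg
  by (auto simp: anchored_def)

end

section \<open>Contracting geodesic lines\<close>

text \<open>Any nearest parameter serves; the choice made here need not commute with isometries, so
  equivariance will hold only up to a coarse error.\<close>

definition line_coord :: "(real \<Rightarrow> 'x::metric_space) \<Rightarrow> 'x \<Rightarrow> real" where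
  "line_coord \<gamma> x = (SOME t. \<forall>s. dist x (\<gamma> t) \<le> dist x (\<gamma> s))"

definition line_dist :: "(real \<Rightarrow> 'x::metric_space) \<Rightarrow> 'x \<Rightarrow> real" where
  "line_dist \<gamma> x = dist x (\<gamma> (line_coord \<gamma> x))"

lemma line_dist_nonneg: "0 \<le> line_dist \<gamma> x"
  by (simp add: line_dist_def)

lemma geodesic_line_continuous: "geodesic_line \<gamma> \<Longrightarrow> continuous_on A \<gamma>"
  unfolding geodesic_line_def continuous_on_iff by (metis dist_real_def)

lemma nearest_point_exists:
  assumes "geodesic_line \<gamma>" shows "\<exists>t. \<forall>s. dist x (\<gamma> t) \<le> dist x (\<gamma> s)"
proof -
  define B where "B = 2 * dist x (\<gamma> 0)"
  have "compact {-B..B}" "{-B..B} \<noteq> {}" unfolding B_def by auto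
  moreover have "continuous_on {-B..B} (\<lambda>t. dist x (\<gamma> t))"
    using geodesic_line_continuous[OF assms] by (intro continuous_intros)
  ultimately obtain t where t: "t \<in> {-B..B}" "\<And>s. s \<in> {-B..B} \<Longrightarrow> dist x (\<gamma> t) \<le> dist x (\<gamma> s)"
    using continuous_attains_inf by metis
  have "dist x (\<gamma> t) \<le> dist x (\<gamma> s)" for s
  proof (cases "s \<in> {-B..B}")
    case False
    have "dist (\<gamma> 0) (\<gamma> s) = \<bar>s\<bar>" using assms unfolding geodesic_line_def by simp
    then have "dist x (\<gamma> 0) \<le> dist x (\<gamma> s)"
      using False dist_triangle[of "\<gamma> 0" "\<gamma> s" x] unfolding B_def by (auto simp: dist_commute)
    moreover have "dist x (\<gamma> t) \<le> dist x (\<gamma> 0)" using t(2)[of 0] unfolding B_def by simp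
    ultimately show ?thesis by linarith
  qed (use t in auto)
  then show ?thesis by blast
qed

lemma line_dist_le: "geodesic_line \<gamma> \<Longrightarrow> line_dist \<gamma> x \<le> dist x (\<gamma> s)"
  unfolding line_dist_def line_coord_def
  using someI_ex[OF nearest_point_exists[of \<gamma> x]] by blast

lemma line_dist_lipschitz: "geodesic_line \<gamma> \<Longrightarrow> line_dist \<gamma> x \<le> dist x y + line_dist \<gamma> y"
  by (rule order.trans[OF line_dist_le[of \<gamma> x "line_coord \<gamma> y"]])
    (auto simp: line_dist_def dist_triangle)

lemma line_dist_continuous:
  assumes "geodesic_line \<gamma>" shows "continuous_on A (line_dist \<gamma>)"
proof -
  have "\<bar>line_dist \<gamma> x - line_dist \<gamma> y\<bar> \<le> dist x y" for x y
    using line_dist_lipschitz[OF assms, of x y] line_dist_lipschitz[OF assms, of y x]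
    by (auto simp: dist_commute)
  then show ?thesis unfolding continuous_on_iff dist_real_def
    by (metis dist_commute order.strict_trans1)
qed

lemma dist_le_via_line:
  assumes "geodesic_line \<gamma>"
  shows "dist x y \<le> line_dist \<gamma> x + \<bar>line_coord \<gamma> x - line_coord \<gamma> y\<bar> + line_dist \<gamma> y"
proof -
  have "dist (\<gamma> (line_coord \<gamma> x)) (\<gamma> (line_coord \<gamma> y)) = \<bar>line_coord \<gamma> x - line_coord \<gamma> y\<bar>"
    using assms unfolding geodesic_line_def by simp
  then show ?thesis unfolding line_dist_def
    using dist_triangle[of x y "\<gamma> (line_coord \<gamma> x)"]
      dist_triangle2[of "\<gamma> (line_coord \<gamma> x)" y "\<gamma> (line_coord \<gamma> y)"] by linarith
qed

lemma line_coord_diff_le: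
  assumes "geodesic_line \<gamma>"
  shows "\<bar>line_coord \<gamma> x - line_coord \<gamma> y\<bar> \<le> line_dist \<gamma> x + dist x y + line_dist \<gamma> y"
proof -
  have "dist (\<gamma> (line_coord \<gamma> x)) (\<gamma> (line_coord \<gamma> y)) = \<bar>line_coord \<gamma> x - line_coord \<gamma> y\<bar>"
    using assms unfolding geodesic_line_def by simp
  then show ?thesis unfolding line_dist_def
    using dist_triangle3[of "\<gamma> (line_coord \<gamma> x)" "\<gamma> (line_coord \<gamma> y)" x]
      dist_triangle[of x "\<gamma> (line_coord \<gamma> y)" y] by linarith
qed

text \<open>The open ball around \<open>x\<close> of radius \<open>line_dist \<gamma> x\<close>
  misses the line, and both chosen nearest points lie in its projection.\<close>

lemma contracting_coord_close:
  assumes \<gamma>: "geodesic_line \<gamma>" and C: "contracting_line C \<gamma>" and d: "dist x y < line_dist \<gamma> x"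
  shows "\<bar>line_coord \<gamma> x - line_coord \<gamma> y\<bar> \<le> C"
proof -
  let ?B = "ball x (line_dist \<gamma> x)"
  have "?B \<inter> range \<gamma> = {}"
    using leD[OF line_dist_le[OF \<gamma>, of x]] by auto
  then have b: "bounded (nearest_points (range \<gamma>) ?B)" "diameter (nearest_points (range \<gamma>) ?B) \<le> C"
    using C unfolding contracting_line_def by blast+
  have n: "\<gamma> (line_coord \<gamma> z) \<in> nearest_points (range \<gamma>) ?B" if "z \<in> ?B" for z
    unfolding nearest_points_def using that line_dist_le[OF \<gamma>, of z, unfolded line_dist_def]
    by (auto intro!: bexI[of _ z])
  have "dist (\<gamma> (line_coord \<gamma> x)) (\<gamma> (line_coord \<gamma> y)) \<le> diameter (nearest_points (range \<gamma>) ?B)"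
  proof (rule diameter_bounded_bound[OF b(1) n n])
    show "x \<in> ?B" "y \<in> ?B" using d zero_le_dist[of x y] by (auto simp del: zero_le_dist)
  qed
  then show ?thesis using b(2) \<gamma> unfolding geodesic_line_def by simp
qed

text \<open>While the path is farther than 2C from the line, a step of length 2C moves the
  projection by at most C. Far from the line the projection thus advances at no more than half
  speed. The interval is half-open so that the path may end on the boundary of the
  neighbourhood.\<close>

lemma excursion_coord_le:
  assumes \<gamma>: "geodesic_line \<gamma>" and C: "contracting_line C \<gamma>" "0 < C"
    and c: "\<And>u v. u \<in> {s..t} \<Longrightarrow> v \<in> {s..t} \<Longrightarrow> dist (c u) (c v) = \<bar>u - v\<bar>"
    and far: "\<And>u. u \<in> {s..<t} \<Longrightarrow> 2 * C < line_dist \<gamma> (c u)" and st: "s \<le> t"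
  shows "\<bar>line_coord \<gamma> (c s) - line_coord \<gamma> (c t)\<bar> \<le> (t - s) / 2 + C"
proof -
  have step: "\<bar>line_coord \<gamma> (c u) - line_coord \<gamma> (c t)\<bar> \<le> C * real n"
    if "s \<le> u" "u \<le> t" "t - u \<le> 2 * C * real n" for n u
    using that
  proof (induction n arbitrary: u)
    case (Suc n)
    define v where "v = min t (u + 2 * C)"
    show ?case
    proof (cases "u = t")
      case False
      then have u: "u \<in> {s..<t}" using Suc.prems by auto
      have v: "v \<in> {s..t}" "u \<le> v" "v - u \<le> 2 * C"
        unfolding v_def using Suc.prems C by auto
      have "dist (c u) (c v) < line_dist \<gamma> (c u)"
        using far[OF u] c[of u v] u v by auto
      then have "\<bar>line_coord \<gamma> (c u) - line_coord \<gamma> (c v)\<bar> \<le> C"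
        by (rule contracting_coord_close[OF \<gamma> C(1)])
      moreover have "\<bar>line_coord \<gamma> (c v) - line_coord \<gamma> (c t)\<bar> \<le> C * real n"
      proof (rule Suc.IH)
        show "t - v \<le> 2 * C * real n"
          unfolding v_def using Suc.prems C by (auto simp: min_def algebra_simps)
      qed (use v in auto)
      ultimately show ?thesis by (simp add: algebra_simps)
    qed (use C in simp)
  qed auto
  define n where "n = nat \<lceil>(t - s) / (2 * C)\<rceil>"
  have n: "(t - s) / (2 * C) \<le> real n" "real n \<le> (t - s) / (2 * C) + 1"
    unfolding n_def using st C by (auto simp: of_nat_nat)
  have "t - s \<le> 2 * C * real n" using n(1) C by (simp add: field_simps)
  from step[OF _ st this] have "\<bar>line_coord \<gamma> (c s) - line_coord \<gamma> (c t)\<bar> \<le> C * real n" by simp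
  also have "\<dots> \<le> C * ((t - s) / (2 * C) + 1)" using n(2) C by (intro mult_left_mono) auto
  also have "\<dots> = (t - s) / 2 + C" using C by (simp add: field_simps)
  finally show ?thesis .
qed

text \<open>Let P be the displacement of the projection. The first d - C units of the path move it
  by at most C, the rest proceeds at half speed, and t is at most d + P + 2C. Hence P is at most C +
  (P + 3C) / 2 + C, that is, at most 7C.\<close>

lemma first_entry_coord:
  assumes \<gamma>: "geodesic_line \<gamma>" and C: "contracting_line C \<gamma>" "0 < C"
    and c: "\<And>u v. u \<in> {0..t} \<Longrightarrow> v \<in> {0..t} \<Longrightarrow> dist (c u) (c v) = \<bar>u - v\<bar>"
    and far: "\<And>u. u \<in> {0..<t} \<Longrightarrow> 2 * C < line_dist \<gamma> (c u)" and t: "0 \<le> t"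
    and near: "line_dist \<gamma> (c t) \<le> 2 * C"
  shows "\<bar>line_coord \<gamma> (c 0) - line_coord \<gamma> (c t)\<bar> \<le> 7 * C"
proof -
  define d where "d = line_dist \<gamma> (c 0)"
  have d: "0 \<le> d" unfolding d_def by (rule line_dist_nonneg)
  show ?thesis
  proof (cases "t < d")
    case True
    then have "dist (c 0) (c t) < line_dist \<gamma> (c 0)" using c[of 0 t] t unfolding d_def by auto
    from contracting_coord_close[OF \<gamma> C(1) this] show ?thesis using C by linarith
  next
    case False
    define s where "s = max 0 (d - C)"
    have s: "0 \<le> s" "s \<le> t" unfolding s_def using False C t by auto
    have 1: "\<bar>line_coord \<gamma> (c 0) - line_coord \<gamma> (c s)\<bar> \<le> C"
    proof (cases "s = 0")
      case False
      then have "dist (c 0) (c s) < line_dist \<gamma> (c 0)"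
        using c[of 0 s] s C unfolding s_def d_def by auto
      then show ?thesis by (rule contracting_coord_close[OF \<gamma> C(1)])
    qed (use C in simp)
    have 2: "\<bar>line_coord \<gamma> (c s) - line_coord \<gamma> (c t)\<bar> \<le> (t - s) / 2 + C"
      by (rule excursion_coord_le[OF \<gamma> C]) (use s c far in auto)
    have 3: "t \<le> d + \<bar>line_coord \<gamma> (c 0) - line_coord \<gamma> (c t)\<bar> + 2 * C"
      using dist_le_via_line[OF \<gamma>, of "c 0" "c t"] c[of 0 t] t near unfolding d_def by auto
    have "d - C \<le> s" unfolding s_def by simp
    then show ?thesis using 1 2 3 by (simp add: field_simps) (smt (verit))
  qed
qed

text \<open>The geodesic is cut at its first and last visit to the 2C-neighbourhood of the line. The
  constant 22 collects 7 + 7 for the projections of the outer pieces, 2 + 2 for their lengths, and 4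
  for comparing the middle piece with the line.\<close>

lemma contracting_dist_ge:
  assumes \<gamma>: "geodesic_line \<gamma>" and C: "contracting_line C \<gamma>" "0 < C"
    and geo: "\<exists>c. (\<forall>s\<in>{0..dist x y}. \<forall>t\<in>{0..dist x y}. dist (c s) (c t) = \<bar>s - t\<bar>)
        \<and> c 0 = x \<and> c (dist x y) = y"
    and gap: "22 * C < \<bar>line_coord \<gamma> x - line_coord \<gamma> y\<bar>"
  shows "line_dist \<gamma> x + \<bar>line_coord \<gamma> x - line_coord \<gamma> y\<bar> + line_dist \<gamma> y - 22 * C \<le> dist x y"
proof -
  define L where "L = dist x y"
  obtain c where c: "\<And>s t. s \<in> {0..L} \<Longrightarrow> t \<in> {0..L} \<Longrightarrow> dist (c s) (c t) = \<bar>s - t\<bar>"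
    and c0: "c 0 = x" and cL: "c L = y"
    using geo unfolding L_def by blast
  have L: "0 \<le> L" unfolding L_def by simp
  define P where "P = \<bar>line_coord \<gamma> x - line_coord \<gamma> y\<bar>"
  define d1 where "d1 = line_dist \<gamma> x"
  define d2 where "d2 = line_dist \<gamma> y"
  have gP: "22 * C < P" using gap unfolding P_def .
  have LP: "L \<le> d1 + P + d2"
    unfolding L_def d1_def d2_def P_def by (rule dist_le_via_line[OF \<gamma>])
  define W where "W = {t \<in> {0..L}. line_dist \<gamma> (c t) \<le> 2 * C}"
  have cc: "continuous_on {0..L} c"
    unfolding continuous_on_iff using c by (metis dist_real_def)
  have "continuous_on {0..L} (\<lambda>t. line_dist \<gamma> (c t))"
    using continuous_on_compose[OF cc line_dist_continuous[OF \<gamma>]] by (simp add: o_def)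
  then have "closed W"
    unfolding W_def by (intro continuous_closed_preimage_constant continuous_on_closed_Collect_le)
      (auto intro: continuous_intros)
  moreover have "bounded W" by (rule bounded_subset[of "{0..L}"]) (auto simp: W_def)
  ultimately have cW: "compact W" using compact_eq_bounded_closed by blast
  \<comment> \<open>A geodesic that never comes near projects at half speed apart from its ends,
    while its length is at most \<open>d1 + P + d2\<close>. This forces P to be at most 8C, against
    the assumed gap.\<close>
  have "W \<noteq> {}"
  proof
    assume "W = {}"
    then have far: "2 * C < line_dist \<gamma> (c u)" if "u \<in> {0..L}" for u
      using that unfolding W_def by auto
    have d: "2 * C < d1" "2 * C < d2"
      using far[of 0] far[of L] L unfolding d1_def d2_def c0 cL by auto
    show False
    proof (cases "L < d1")
      case True
      have "P \<le> C" unfolding P_def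
        by (rule contracting_coord_close[OF \<gamma> C(1)]) (use True L_def d1_def in auto)
      then show False using gP C by linarith
    next
      case dL: False
      define s where "s = d1 - C"
      have s: "0 \<le> s" "s \<le> L" unfolding s_def using d C dL by auto
      have 1: "\<bar>line_coord \<gamma> x - line_coord \<gamma> (c s)\<bar> \<le> C"
        by (rule contracting_coord_close[OF \<gamma> C(1)])
          (use c[of 0 s] s L C in \<open>auto simp: c0 s_def d1_def\<close>)
      define s2 where "s2 = max s (L - d2 + C)"
      have s2: "s \<le> s2" "s2 \<le> L" unfolding s2_def using s d C by auto
      have "dist y (c s2) < line_dist \<gamma> y"
        using c[of L s2] s s2 L C unfolding cL s2_def d2_def by auto
      then have 2: "\<bar>line_coord \<gamma> y - line_coord \<gamma> (c s2)\<bar> \<le> C"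
        by (rule contracting_coord_close[OF \<gamma> C(1)])
      have 3: "\<bar>line_coord \<gamma> (c s) - line_coord \<gamma> (c s2)\<bar> \<le> (s2 - s) / 2 + C"
        by (rule excursion_coord_le[OF \<gamma> C]) (use s s2 c far in auto)
      have 4: "s2 - s \<le> P + 2 * C" unfolding s2_def s_def using LP gP C by auto
      have "P \<le> C + ((s2 - s) / 2 + C) + C" using 1 2 3 unfolding P_def by linarith
      moreover have "(s2 - s) / 2 \<le> P / 2 + C" using 4 by simp
      ultimately show False using gP C(2) by simp
    qed
  qed
  obtain t1 where t1: "t1 \<in> W" "\<And>t. t \<in> W \<Longrightarrow> t1 \<le> t"
    using compact_attains_inf[OF cW \<open>W \<noteq> {}\<close>] by blast
  obtain t2 where t2: "t2 \<in> W" "\<And>t. t \<in> W \<Longrightarrow> t \<le> t2"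
    using compact_attains_sup[OF cW \<open>W \<noteq> {}\<close>] by blast
  have r: "t1 \<in> {0..L}" "t2 \<in> {0..L}" "t1 \<le> t2" using t1 t2 unfolding W_def by auto
  have n1: "line_dist \<gamma> (c t1) \<le> 2 * C" and n2: "line_dist \<gamma> (c t2) \<le> 2 * C"
    using t1 t2 unfolding W_def by auto
  have far1: "2 * C < line_dist \<gamma> (c u)" if "u \<in> {0..<t1}" for u
    using t1(2)[of u] that r unfolding W_def by force
  have far2: "2 * C < line_dist \<gamma> (c u)" if "u \<in> {t2<..L}" for u
    using t2(2)[of u] that r unfolding W_def by force
  have p1: "\<bar>line_coord \<gamma> x - line_coord \<gamma> (c t1)\<bar> \<le> 7 * C"
    unfolding c0[symmetric] by (rule first_entry_coord[OF \<gamma> C]) (use r c far1 n1 in auto)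
  have "\<bar>line_coord \<gamma> (c (L - 0)) - line_coord \<gamma> (c (L - (L - t2)))\<bar> \<le> 7 * C"
    by (rule first_entry_coord[OF \<gamma> C, where c = "\<lambda>u. c (L - u)"]) (use r c far2 n2 in auto)
  then have p2: "\<bar>line_coord \<gamma> y - line_coord \<gamma> (c t2)\<bar> \<le> 7 * C" by (simp add: cL)
  have "d1 \<le> t1 + 2 * C"
    using line_dist_lipschitz[OF \<gamma>, of x "c t1"] c[of 0 t1] r L n1 unfolding d1_def c0 by auto
  moreover have "d2 \<le> (L - t2) + 2 * C"
    using line_dist_lipschitz[OF \<gamma>, of y "c t2"] c[of L t2] r L n2 unfolding d2_def cL by auto
  moreover have "\<bar>line_coord \<gamma> (c t1) - line_coord \<gamma> (c t2)\<bar> \<le> (t2 - t1) + 4 * C"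
    using line_coord_diff_le[OF \<gamma>, of "c t1" "c t2"] c[of t1 t2] r n1 n2 by auto
  ultimately show ?thesis
    using p1 p2 unfolding d1_def[symmetric] d2_def[symmetric] L_def[symmetric] P_def by linarith
qed

text \<open>From here on contraction is used only in this form: a path between points with distant
  projections is, up to \<open>K\<close>, as long as the detour through the line.\<close>

definition coarse_axis :: "real \<Rightarrow> (real \<Rightarrow> 'x::metric_space) \<Rightarrow> bool" where
  "coarse_axis K \<gamma> \<longleftrightarrow> geodesic_line \<gamma> \<and> 0 \<le> K \<and>
     (\<forall>x y. K < \<bar>line_coord \<gamma> x - line_coord \<gamma> y\<bar> \<longrightarrow>
        line_dist \<gamma> x + \<bar>line_coord \<gamma> x - line_coord \<gamma> y\<bar> + line_dist \<gamma> y - K \<le> dist x y)"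

lemma coarse_axisD:
  assumes "coarse_axis K \<gamma>"
  shows "geodesic_line \<gamma>" "0 \<le> K"
    "K < \<bar>line_coord \<gamma> x - line_coord \<gamma> y\<bar> \<Longrightarrow>
        line_dist \<gamma> x + \<bar>line_coord \<gamma> x - line_coord \<gamma> y\<bar> + line_dist \<gamma> y - K \<le> dist x y"
  using assms unfolding coarse_axis_def by auto

lemma contracting_coarse_axis:
  fixes \<gamma> :: "real \<Rightarrow> 'x::metric_space"
  assumes "geodesic_line \<gamma>" "contracting_line C \<gamma>" "0 < C"
    and "\<And>x y :: 'x. \<exists>T. geodesic_segment T x y"
  shows "coarse_axis (22 * C) \<gamma>"
  unfolding coarse_axis_def
proof (intro conjI allI impI)
  fix x y assume "22 * C < \<bar>line_coord \<gamma> x - line_coord \<gamma> y\<bar>"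
  then show "line_dist \<gamma> x + \<bar>line_coord \<gamma> x - line_coord \<gamma> y\<bar> + line_dist \<gamma> y - 22 * C \<le> dist x y"
    using assms(4)[of x y] unfolding geodesic_segment_def
    by (intro contracting_dist_ge[OF assms(1-3)]) blast+
qed (use assms in auto)

lemma line_coord_on_line [simp]:
  assumes "geodesic_line \<gamma>" shows "line_coord \<gamma> (\<gamma> t) = t"
proof -
  have "line_dist \<gamma> (\<gamma> t) \<le> 0" using line_dist_le[OF assms, of "\<gamma> t" t] by simp
  then show ?thesis using assms unfolding line_dist_def geodesic_line_def by simp
qed

lemma line_dist_on_line [simp]: "geodesic_line \<gamma> \<Longrightarrow> line_dist \<gamma> (\<gamma> t) = 0"
  by (simp add: line_dist_def)

lemma coarse_axis_lipschitz:
  assumes "coarse_axis K \<gamma>"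
  shows "\<bar>line_coord \<gamma> x - line_coord \<gamma> y\<bar> \<le> dist x y + K"
  using coarse_axisD(3)[OF assms, of x y] line_dist_nonneg[of \<gamma> x] line_dist_nonneg[of \<gamma> y]
    zero_le_dist[of x y] by linarith

lemma coarse_axis_near:
  assumes "coarse_axis K \<gamma>" "dist x (\<gamma> t) \<le> r"
  shows "\<bar>line_coord \<gamma> x - t\<bar> \<le> r + K"
  using coarse_axis_lipschitz[OF assms(1), of x "\<gamma> t"] coarse_axisD(1)[OF assms(1)] assms(2) by simp

text \<open>The image of a nearest point is again nearest to \<open>f x\<close>. Were its parameter
  more than \<open>K\<close> away from the chosen one, the coarse axis inequality would put it
  strictly farther from \<open>f x\<close> than the line is.\<close>

lemma coarse_axis_translate:
  assumes \<gamma>: "coarse_axis K \<gamma>" and f: "\<And>x y. dist (f x) (f y) = dist x y"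
    and t: "\<And>t. f (\<gamma> t) = \<gamma> (t + \<tau>)"
  shows "\<bar>line_coord \<gamma> (f x) - (line_coord \<gamma> x + \<tau>)\<bar> \<le> K"
proof (rule ccontr)
  assume *: "\<not> ?thesis"
  define s where "s = line_coord \<gamma> x + \<tau>"
  note g = coarse_axisD(1)[OF \<gamma>]
  have "dist (f x) (\<gamma> s) = line_dist \<gamma> x" unfolding s_def t[symmetric] f line_dist_def ..
  moreover have "line_dist \<gamma> x \<le> line_dist \<gamma> (f x)"
  proof -
    have "line_dist \<gamma> (f x) = dist (f x) (f (\<gamma> (line_coord \<gamma> (f x) - \<tau>)))"
      unfolding t line_dist_def by simp
    then show ?thesis unfolding f using line_dist_le[OF g] by simp
  qed
  ultimately show False
    using * coarse_axisD(3)[OF \<gamma>, of "f x" "\<gamma> s"] g by (auto simp: s_def)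
qed

lemma coarse_axis_ivt:
  fixes f :: "nat \<Rightarrow> real"
  assumes "f 0 < s" "s \<le> f k" "\<And>j. f (Suc j) - f j \<le> w"
  obtains j where "j \<le> k" "s \<le> f j" "f j \<le> s + w"
proof -
  define j where "j = (LEAST j. s \<le> f j)"
  have j: "s \<le> f j" unfolding j_def by (rule LeastI[of _ k]) (use assms in auto)
  have le: "j \<le> k" unfolding j_def by (rule Least_le) (use assms in auto)
  have "j \<noteq> 0" using j assms(1) by (metis not_le)
  then obtain i where i: "j = Suc i" by (cases j) auto
  have "f i < s" using not_less_Least[of i "\<lambda>j. s \<le> f j"] i unfolding j_def[symmetric] by auto
  then show ?thesis using that[of j] j le assms(3)[of i] i by auto
qed

section \<open>Axes of independent elements and the projections of their translates\<close>

context isometric_group_action begin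

lemma act_nat_pow_line:
  assumes g: "g \<in> carrier G" and t: "\<And>t. \<phi> g (\<gamma> t) = \<gamma> (t + \<tau>::real)"
  shows "\<phi> (g [^] (n::nat)) (\<gamma> t) = \<gamma> (t + n * \<tau>)"
proof (induction n arbitrary: t)
  case (Suc n)
  have "\<phi> (g [^] Suc n) (\<gamma> t) = \<phi> (g [^] n) (\<phi> g (\<gamma> t))"
    using g by (simp add: act_mult)
  also have "\<dots> = \<gamma> (t + Suc n * \<tau>)" by (simp add: t Suc.IH algebra_simps)
  finally show ?case .
qed simp

lemma act_int_pow_line:
  assumes g: "g \<in> carrier G" and t: "\<And>t. \<phi> g (\<gamma> t) = \<gamma> (t + \<tau>::real)"
  shows "\<phi> (g [^] (i::int)) (\<gamma> t) = \<gamma> (t + of_int i * \<tau>)"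
proof (cases "i < 0")
  case True
  define n where "n = nat (- i)"
  have i: "g [^] i = inv (g [^] n)" unfolding n_def by (subst int_pow_def2) (simp only: True if_True)
  have e: "of_int i * \<tau> = - (real n * \<tau>)" unfolding n_def using True by simp
  have "\<phi> (g [^] n) (\<gamma> (t + of_int i * \<tau>)) = \<gamma> t"
    unfolding act_nat_pow_line[of g \<gamma> \<tau>, OF g t] e by simp
  then show ?thesis unfolding i using g by (metis act_inv_cancel(1) nat_pow_closed)
next
  case False
  then have i: "g [^] i = g [^] nat i" by (subst int_pow_def2) (simp only: if_False)
  show ?thesis unfolding i act_nat_pow_line[of g \<gamma> \<tau>, OF g t] using False by simp
qed

lemma independent_orbits_finite:
  assumes "independent_elements G \<phi> x0 g h"
  shows "finite {(m, n). dist (\<phi> (g [^] (m::int)) x0) (\<phi> (h [^] (n::int)) x0) \<le> r}"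
proof -
  let ?f = "\<lambda>(m, n). dist (\<phi> (g [^] (m::int)) x0) (\<phi> (h [^] (n::int)) x0)"
  have "compactin (top_of_set {0::real..}) {0..r}"
    by (simp add: compactin_subtopology)
  then have "compactin (discrete_topology (UNIV :: (int \<times> int) set))
      {x \<in> topspace (discrete_topology UNIV). ?f x \<in> {0..r}}"
    using assms unfolding independent_elements_def by (intro compactin_proper_map_preimage)
  then have "finite {x. ?f x \<in> {0..r}}" by (simp add: compactin_discrete_topology)
  moreover have "{(m, n). ?f (m, n) \<le> r} \<subseteq> {x. ?f x \<in> {0..r}}" by auto
  ultimately show ?thesis by (auto intro: finite_subset)
qed

text \<open>If the orbit of \<open>h\<close> along \<open>\<eta>\<close> had large coordinates on
  \<open>\<gamma>\<close>, some intermediate orbit point would lie K-close to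
  \<open>\<gamma>\<close> at a large coordinate. It would then be within \<open>r\<close> of a high
  power of \<open>g\<close> applied to \<open>x0\<close>, which properness permits only for finitely
  many exponents.\<close>

lemma independent_axis_coord_bounded:
  assumes g: "g \<in> carrier G" and h: "h \<in> carrier G"
    and \<gamma>: "coarse_axis K \<gamma>" and \<tau>: "0 < \<tau>" and g\<gamma>: "\<And>t. \<phi> g (\<gamma> t) = \<gamma> (t + \<tau>)"
    and \<eta>: "geodesic_line \<eta>" and \<sigma>: "0 < \<sigma>" and h\<eta>: "\<And>t. \<phi> h (\<eta> t) = \<eta> (t + \<sigma>)"
    and fin: "\<And>r. finite {(m, n). dist (\<phi> (g [^] (m::int)) x0) (\<phi> (h [^] (n::int)) x0) \<le> r}"
  shows "\<exists>B. \<forall>t. \<bar>line_coord \<gamma> (\<eta> t)\<bar> \<le> B"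
proof -
  note \<gamma>g = coarse_axisD(1)[OF \<gamma>]
  note K = coarse_axisD(2)[OF \<gamma>]
  define x where "x n = \<eta> (of_int n * \<sigma>)" for n :: int
  have dx: "dist (x m) (x n) = of_int \<bar>m - n\<bar> * \<sigma>" for m n
    using \<eta> \<sigma> unfolding x_def geodesic_line_def
    by (simp add: abs_mult flip: left_diff_distrib)
  have hx: "\<phi> (h [^] n) (\<eta> 0) = x n" for n :: int
    unfolding act_int_pow_line[of h \<eta> \<sigma>, OF h h\<eta>] x_def by simp
  have g\<gamma>m: "\<phi> (g [^] m) (\<gamma> 0) = \<gamma> (of_int m * \<tau>)" for m :: int
    unfolding act_int_pow_line[of g \<gamma> \<tau>, OF g g\<gamma>] by simp
  define r where "r = dist x0 (\<gamma> 0) + \<tau> + K + dist (\<eta> 0) x0"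
  define Z where "Z = {(m, n). dist (\<phi> (g [^] (m::int)) x0) (\<phi> (h [^] (n::int)) x0) \<le> r}"
  have "finite ((\<lambda>x. \<bar>fst x\<bar>) ` Z)" using fin unfolding Z_def by blast
  from bdd_above_finite[OF this] obtain M where M: "\<And>z. z \<in> Z \<Longrightarrow> \<bar>fst z\<bar> \<le> M"
    by (auto simp: bdd_above_def)
  \<comment> \<open>The first term exceeds the coordinate of every orbit point that comes K-close to
    \<open>\<gamma>\<close>; the others place the starting point more than \<open>K\<close> below
    level \<open>s\<close>. In \<open>B\<close>, the summand \<sigma> + 2K leaves a gap larger than
    \<open>K\<close> above the point found at level \<open>s\<close>.\<close>
  define s where "s = of_int (\<bar>M\<bar> + 2) * \<tau> + \<bar>line_coord \<gamma> (x 0)\<bar> + K + 1"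
  define B where "B = s + \<sigma> + 2 * K"
  have s: "0 \<le> s" unfolding s_def using \<tau> K by (intro add_nonneg_nonneg) auto
  have near: "\<bar>line_coord \<gamma> v\<bar> < s" if v: "v = x n" and d: "line_dist \<gamma> v \<le> K" for v n
  proof -
    define c where "c = line_coord \<gamma> v"
    define m where "m = \<lfloor>c / \<tau>\<rfloor>"
    have "of_int m \<le> c / \<tau>" "c / \<tau> \<le> of_int m + 1" unfolding m_def by linarith+
    then have m: "of_int m * \<tau> \<le> c" "c \<le> of_int m * \<tau> + \<tau>"
      using \<tau> by (simp_all add: field_simps)
    have cr: "g [^] m \<in> carrier G" "h [^] n \<in> carrier G" using g h by auto
    have "dist (\<phi> (g [^] m) x0) (\<phi> (h [^] n) x0) \<le>
        dist (\<phi> (g [^] m) x0) (\<phi> (g [^] m) (\<gamma> 0)) + dist (\<gamma> (of_int m * \<tau>)) (\<gamma> c)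
        + dist (\<gamma> c) v + dist (\<phi> (h [^] n) (\<eta> 0)) (\<phi> (h [^] n) x0)"
      unfolding g\<gamma>m hx v by metric
    also have "\<dots> = dist x0 (\<gamma> 0) + \<bar>of_int m * \<tau> - c\<bar> + line_dist \<gamma> v + dist (\<eta> 0) x0"
      using cr \<gamma>g unfolding geodesic_line_def line_dist_def c_def by (simp add: dist_commute)
    also have "\<dots> \<le> r" unfolding r_def using m d by auto
    finally have "(m, n) \<in> Z" unfolding Z_def by simp
    from M[OF this] have "\<bar>m\<bar> \<le> M" by simp
    then have "\<bar>of_int m\<bar> \<le> real_of_int \<bar>M\<bar>" by linarith
    then have "\<bar>of_int m * \<tau>\<bar> \<le> of_int \<bar>M\<bar> * \<tau>" using \<tau> by (simp add: abs_mult)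
    then have "\<bar>c\<bar> \<le> of_int \<bar>M\<bar> * \<tau> + \<tau>" using m by linarith
    also have "\<dots> < s" unfolding s_def using \<tau> K by (simp add: algebra_simps)
    finally show ?thesis unfolding c_def .
  qed
  \<comment> \<open>The sign \<epsilon> selects the end of \<open>\<gamma>\<close> and \<delta> the
    direction along the orbit of \<open>h\<close>.\<close>
  have bound: "\<epsilon> * line_coord \<gamma> (x (\<delta> * int k)) \<le> B"
    if \<epsilon>: "\<bar>\<epsilon>\<bar> = (1::real)" and \<delta>: "\<bar>\<delta>\<bar> = 1" for \<epsilon> \<delta> k
  proof (rule ccontr)
    assume *: "\<not> ?thesis"
    define f where "f j = \<epsilon> * line_coord \<gamma> (x (\<delta> * int j))" for j
    have ab: "\<bar>f i - f j\<bar> = \<bar>line_coord \<gamma> (x (\<delta> * int i)) - line_coord \<gamma> (x (\<delta> * int j))\<bar>" for i j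
      unfolding f_def using \<epsilon> by (simp add: abs_mult flip: right_diff_distrib)
    have dd: "dist (x (\<delta> * int i)) (x (\<delta> * int j)) = \<bar>real i - real j\<bar> * \<sigma>" for i j
    proof -
      have "\<bar>\<delta> * int i - \<delta> * int j\<bar> = \<bar>int i - int j\<bar>"
        using \<delta> by (simp add: abs_mult flip: right_diff_distrib)
      then show ?thesis unfolding dx by simp
    qed
    have f0: "f 0 \<le> \<bar>line_coord \<gamma> (x 0)\<bar>" "- \<bar>line_coord \<gamma> (x 0)\<bar> \<le> f 0"
      unfolding f_def using \<epsilon> by (auto simp: abs_if split: if_splits)
    have fk: "B < f k" using * unfolding f_def by simp
    have Mt: "0 \<le> of_int (\<bar>M\<bar> + 2) * \<tau>" using \<tau> by simp
    obtain j where j: "j \<le> k" "s \<le> f j" "f j \<le> s + (\<sigma> + K)"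
    proof (rule coarse_axis_ivt[of f s k "\<sigma> + K"])
      show "f 0 < s" unfolding s_def using f0 Mt K by linarith
      show "s \<le> f k" using fk \<sigma> K unfolding B_def by linarith
      show "f (Suc j) - f j \<le> \<sigma> + K" for j
        using ab[of "Suc j" j] dd[of "Suc j" j]
          coarse_axis_lipschitz[OF \<gamma>, of "x (\<delta> * int (Suc j))" "x (\<delta> * int j)"] by auto
    qed
    define v where "v = x (\<delta> * int j)"
    have ge: "line_dist \<gamma> (x (\<delta> * int i)) + (f j - f i) + line_dist \<gamma> (x (\<delta> * int j)) - K
        \<le> \<bar>real i - real j\<bar> * \<sigma>" if "K < f j - f i" for i j
      using coarse_axisD(3)[OF \<gamma>, of "x (\<delta> * int i)" "x (\<delta> * int j)"] that K
      unfolding ab[symmetric] dd by linarith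
    have "K < f j - f 0" using j(2) f0 Mt unfolding s_def by linarith
    then have 1: "line_dist \<gamma> (x 0) + (f j - f 0) + line_dist \<gamma> v - K \<le> real j * \<sigma>"
      using ge[of j 0] unfolding v_def by simp
    have "K < f k - f j" using fk j(3) unfolding B_def by linarith
    then have 2: "line_dist \<gamma> v + (f k - f j) + line_dist \<gamma> (x (\<delta> * int k)) - K \<le> (real k - real j) * \<sigma>"
      using ge[of k j] j(1) unfolding v_def by simp
    have "0 \<le> f k - f 0" using \<open>K < f j - f 0\<close> \<open>K < f k - f j\<close> K by linarith
    then have 3: "real k * \<sigma> \<le> line_dist \<gamma> (x 0) + (f k - f 0) + line_dist \<gamma> (x (\<delta> * int k))"
      using dist_le_via_line[OF \<gamma>g, of "x (\<delta> * int 0)" "x (\<delta> * int k)"]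
      unfolding ab[symmetric] dd by simp
    \<comment> \<open>The point \<open>v\<close> lies between the two ends on a geodesic, so the
      lengths add up exactly. Adding 1 and 2 and comparing with 3 leaves twice the distance of
      \<open>v\<close> to the line against the two coarse errors.\<close>
    have "line_dist \<gamma> v \<le> K" using 1 2 3 by (simp add: left_diff_distrib)
    from near[OF v_def this] have "\<bar>line_coord \<gamma> v\<bar> < s" .
    moreover have "\<bar>f j\<bar> = \<bar>line_coord \<gamma> v\<bar>" unfolding f_def v_def using \<epsilon> by (simp add: abs_mult)
    ultimately show False using j(2) by linarith
  qed
  have xb: "\<bar>line_coord \<gamma> (x n)\<bar> \<le> B" for n
  proof -
    have "\<exists>\<delta> k. n = \<delta> * int k \<and> \<bar>\<delta>\<bar> = 1"
      by (cases n) (metis abs_1 mult_1, metis abs_1 abs_minus_cancel mult_minus1)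
    then obtain \<delta> k where n: "n = \<delta> * int k" "\<bar>\<delta>\<bar> = 1" by blast
    show ?thesis using bound[of 1 \<delta> k] bound[of "- 1" \<delta> k] n by auto
  qed
  have "\<bar>line_coord \<gamma> (\<eta> t)\<bar> \<le> B + \<sigma> + K" for t
  proof -
    define n where "n = \<lfloor>t / \<sigma>\<rfloor>"
    have "of_int n \<le> t / \<sigma>" "t / \<sigma> \<le> of_int n + 1" unfolding n_def by linarith+
    then have "of_int n * \<sigma> \<le> t" "t \<le> of_int n * \<sigma> + \<sigma>"
      using \<sigma> by (simp_all add: field_simps)
    then have "dist (\<eta> t) (x n) \<le> \<sigma>" using \<eta> unfolding x_def geodesic_line_def by auto
    then show ?thesis using coarse_axis_lipschitz[OF \<gamma>, of "\<eta> t" "x n"] xb[of n] by linarith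
  qed
  then show ?thesis by blast
qed

end

text \<open>Any path from \<open>f (\<gamma> t)\<close> to \<open>\<gamma>\<close> must run along
  \<open>\<eta>\<close>, because the coordinates on \<open>\<eta>\<close> are far apart. Its length
  is therefore a common part plus the distance from the endpoint to \<open>\<eta>\<close>, up to
  bounded errors. The nearest point is no worse than \<open>\<gamma> 0\<close>, so it is close to
  \<open>\<eta>\<close> and has bounded parameter. The bound involves neither \<open>t\<close> nor
  \<open>s\<close>.\<close>

lemma translated_line_coord_bounded:
  assumes \<eta>: "coarse_axis K \<eta>" and \<gamma>: "geodesic_line \<gamma>"
    and B: "\<And>t. \<bar>line_coord \<eta> (\<gamma> t)\<bar> \<le> B"
    and f: "\<And>x y. dist (f x) (f y) = dist x y" and fs: "\<And>t. f (\<eta> t) = \<eta> (t + s)"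
    and s: "2 * B + 2 * K < \<bar>s\<bar>"
  shows "\<bar>line_coord \<gamma> (f (\<gamma> t))\<bar> \<le> K + 2 * dist (\<gamma> 0) (\<eta> 0) + 3 * B"
proof -
  note \<eta>g = coarse_axisD(1)[OF \<eta>]
  define y where "y = f (\<gamma> t)"
  define c where "c = line_coord \<gamma> y"
  have py: "\<bar>line_coord \<eta> y - (line_coord \<eta> (\<gamma> t) + s)\<bar> \<le> K"
    unfolding y_def by (rule coarse_axis_translate[of K \<eta> f s "\<gamma> t", OF \<eta> f fs])
  have "K < \<bar>line_coord \<eta> y - line_coord \<eta> (\<gamma> c)\<bar>"
    using py B[of t] B[of c] s by linarith
  from coarse_axisD(3)[OF \<eta> this]
  have 1: "line_dist \<eta> y + \<bar>line_coord \<eta> y - line_coord \<eta> (\<gamma> c)\<bar> + line_dist \<eta> (\<gamma> c) - K \<le> dist y (\<gamma> c)" .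
  have 2: "dist y (\<gamma> c) \<le> dist y (\<gamma> 0)"
    using line_dist_le[OF \<gamma>, of y 0] unfolding line_dist_def c_def .
  have 3: "dist y (\<gamma> 0) \<le> line_dist \<eta> y + \<bar>line_coord \<eta> y - line_coord \<eta> (\<gamma> 0)\<bar> + line_dist \<eta> (\<gamma> 0)"
    by (rule dist_le_via_line[OF \<eta>g])
  have 4: "line_dist \<eta> (\<gamma> 0) \<le> dist (\<gamma> 0) (\<eta> 0)" by (rule line_dist_le[OF \<eta>g])
  have 5: "\<bar>c\<bar> \<le> line_dist \<eta> (\<gamma> c) + B + dist (\<gamma> 0) (\<eta> 0)"
  proof -
    have "\<bar>c\<bar> = dist (\<gamma> c) (\<gamma> 0)" using \<gamma> unfolding geodesic_line_def by simp
    also have "\<dots> \<le> line_dist \<eta> (\<gamma> c) + dist (\<eta> (line_coord \<eta> (\<gamma> c))) (\<eta> 0) + dist (\<gamma> 0) (\<eta> 0)"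
      unfolding line_dist_def by metric
    also have "dist (\<eta> (line_coord \<eta> (\<gamma> c))) (\<eta> 0) \<le> B"
      using B[of c] \<eta>g unfolding geodesic_line_def by simp
    finally show ?thesis by simp
  qed
  have 6: "\<bar>line_coord \<eta> y - line_coord \<eta> (\<gamma> 0)\<bar>
      \<le> \<bar>line_coord \<eta> y - line_coord \<eta> (\<gamma> c)\<bar> + 2 * B"
    using B[of c] B[of 0] by linarith
  have arith: "e \<le> K + 2 * d0 + 3 * B"
    if "ly + u + lc - K \<le> dc" "dc \<le> d" "d \<le> ly + w + l0" "l0 \<le> d0"
      "e \<le> lc + B + d0" "w \<le> u + 2 * B" for ly u lc dc d w l0 d0 e :: real
    using that by linarith
  have "\<bar>c\<bar> \<le> K + 2 * dist (\<gamma> 0) (\<eta> 0) + 3 * B" by (rule arith[OF 1 2 3 4 5 6])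
  then show ?thesis unfolding c_def y_def .
qed

lemma contracting_positive_axis:
  fixes f :: "'x::metric_space \<Rightarrow> 'x"
  assumes "contracting f" and geo: "\<And>x y :: 'x. \<exists>T. geodesic_segment T x y"
  shows "\<exists>K \<gamma> \<tau>. coarse_axis K \<gamma> \<and> 0 < \<tau> \<and> (\<forall>t. f (\<gamma> t) = \<gamma> (t + \<tau>))"
proof -
  obtain \<gamma> C where ax: "axis_of \<gamma> f" and C: "C > 0" "contracting_line C \<gamma>"
    using assms(1) unfolding contracting_def by (elim conjE exE)
  obtain \<tau> where g: "geodesic_line \<gamma>" and \<tau>: "\<tau> \<noteq> 0" "\<And>t. f (\<gamma> t) = \<gamma> (t + \<tau>)"
    using ax unfolding axis_of_def by (elim conjE exE) simp
  show ?thesis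
  proof (cases "0 < \<tau>")
    case True
    show ?thesis
      by (rule exI[of _ "22 * C"], rule exI[of _ \<gamma>], rule exI[of _ \<tau>])
        (use contracting_coarse_axis[OF g C(2,1) geo] True \<tau>(2) in auto)
  next
    case False
    define \<gamma>' where "\<gamma>' t = \<gamma> (- t)" for t
    have "range \<gamma>' = range \<gamma>"
      unfolding \<gamma>'_def by (metis (no_types, lifting) image_comp image_cong o_apply surj_uminus)
    then have 1: "contracting_line C \<gamma>'" using C(2) unfolding contracting_line_def by simp
    have 2: "geodesic_line \<gamma>'" using g unfolding geodesic_line_def \<gamma>'_def by auto
    have 3: "f (\<gamma>' t) = \<gamma>' (t + - \<tau>)" for t unfolding \<gamma>'_def \<tau>(2) by simp
    have "0 < - \<tau>" using False \<tau>(1) by simp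
    then show ?thesis
      by (intro exI[of _ "22 * C"] exI[of _ \<gamma>'] exI[of _ "- \<tau>"] conjI allI
          contracting_coarse_axis[OF 2 1 C(1) geo] 3)
  qed
qed

lemma (in group) conjugate_nat_pow:
  assumes "x \<in> carrier G" "y \<in> carrier G"
  shows "(x \<otimes> y \<otimes> inv x) [^] (n::nat) = x \<otimes> y [^] n \<otimes> inv x"
proof (induction n)
  case (Suc n)
  have "(x \<otimes> y \<otimes> inv x) [^] Suc n = x \<otimes> y [^] n \<otimes> inv x \<otimes> (x \<otimes> y \<otimes> inv x)"
    using Suc.IH by simp
  also have "\<dots> = x \<otimes> y [^] n \<otimes> (inv x \<otimes> x) \<otimes> y \<otimes> inv x"
    using assms by (simp only: m_assoc m_closed inv_closed nat_pow_closed)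
  also have "\<dots> = x \<otimes> y [^] Suc n \<otimes> inv x" using assms by (simp add: m_assoc)
  finally show ?case .
qed (use assms in simp)

section \<open>Construction of a Schottky set from two independent contracting elements\<close>

context isometric_group_action begin

text \<open>The letters are the conjugates \<open>h\<^sup>Q\<^sup>k g\<^sup>N h\<^sup>-\<^sup>Q\<^sup>k\<close>, whose axes are translates of the axis of \<open>g\<close>
  with pairwise bounded projections; \<open>N\<close> is chosen after all other constants.\<close>

lemma schottky_set_exists:
  assumes geo: "\<And>x y :: 'x. \<exists>T. geodesic_segment T x y"
    and g: "g \<in> carrier G" "contracting (\<phi> g)" and h: "h \<in> carrier G" "contracting (\<phi> h)"
    and ind: "independent_elements G \<phi> x0 g h" and m: "0 < (m::nat)"
  shows "\<exists>S p q K D R T. schottky_set G \<phi> x0 S p q K D R T \<and> (\<forall>a\<in>S. \<exists>b\<in>carrier G. a = b [^] m)"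
proof -
  obtain K \<gamma> \<tau> where \<gamma>: "coarse_axis K \<gamma>" and \<tau>: "0 < \<tau>" and g\<gamma>': "\<forall>t. \<phi> g (\<gamma> t) = \<gamma> (t + \<tau>)"
    using contracting_positive_axis[OF g(2) geo] by (elim exE conjE) (rule that)
  obtain K' \<eta> \<sigma> where \<eta>: "coarse_axis K' \<eta>" and \<sigma>: "0 < \<sigma>" and h\<eta>': "\<forall>t. \<phi> h (\<eta> t) = \<eta> (t + \<sigma>)"
    using contracting_positive_axis[OF h(2) geo] by (elim exE conjE) (rule that)
  note g\<gamma> = g\<gamma>'[THEN spec] and h\<eta> = h\<eta>'[THEN spec]
  note K = coarse_axisD(2)[OF \<gamma>] and \<gamma>g = coarse_axisD(1)[OF \<gamma>] and K' = coarse_axisD(2)[OF \<eta>]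
  \<comment> \<open>The roles of \<open>g\<close> and \<open>h\<close> are exchanged, since what is
    needed is the shadow of \<open>\<gamma>\<close> on the axis of \<open>h\<close>.\<close>
  have fin: "finite {(n, m). dist (\<phi> (h [^] (n::int)) x0) (\<phi> (g [^] (m::int)) x0) \<le> r}" for r
  proof -
    have "{(n, m). dist (\<phi> (h [^] (n::int)) x0) (\<phi> (g [^] (m::int)) x0) \<le> r} =
        prod.swap ` {(m, n). dist (\<phi> (g [^] (m::int)) x0) (\<phi> (h [^] (n::int)) x0) \<le> r}"
      by (auto simp: dist_commute image_iff)
    then show ?thesis using independent_orbits_finite[OF ind] by simp
  qed
  obtain B where B: "\<And>t. \<bar>line_coord \<eta> (\<gamma> t)\<bar> \<le> B"
    using independent_axis_coord_bounded[of h g K' \<eta> \<sigma> \<gamma> \<tau>, OF h(1) g(1) \<eta> \<sigma> h\<eta> \<gamma>g \<tau> g\<gamma> fin] by blast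
  \<comment> \<open>Translation by \<open>Q\<close> steps along \<open>\<eta>\<close> moves
    \<open>\<gamma>\<close> clear of its own shadow there. Any two of the lines
    \<open>\<phi> (c k) \<circ> \<gamma>\<close> then differ by such a translation, so a single
    bound \<open>B'\<close> serves all pairs.\<close>
  obtain Q :: nat where Q: "2 * B + 2 * K' < real Q * \<sigma>"
    using reals_Archimedean3[OF \<sigma>] by blast
  define B' where "B' = K' + 2 * dist (\<gamma> 0) (\<eta> 0) + 3 * B"
  define c where "c k = h [^] (int Q * int k)" for k :: nat
  have c: "c k \<in> carrier G" for k unfolding c_def using h by simp
  define P where "P k x = line_coord \<gamma> (\<phi> (inv (c k)) x)" for k x
  define L where "L k x = line_dist \<gamma> (\<phi> (inv (c k)) x)" for k x
  have cross: "\<bar>P j (\<phi> (c k) (\<gamma> t))\<bar> \<le> B'" if "j \<noteq> k" for j k t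
  proof -
    define i where "i = int Q * (int k - int j)"
    have "inv (c j) = h [^] (- (int Q * int j))"
      unfolding c_def using int_pow_neg[OF h(1), of "int Q * int j"] by simp
    moreover have "h [^] (- (int Q * int j)) \<otimes> c k = h [^] i"
      unfolding c_def i_def using int_pow_mult[OF h(1), of "- (int Q * int j)" "int Q * int k"]
      by (simp add: algebra_simps)
    ultimately have e: "\<phi> (inv (c j)) (\<phi> (c k) (\<gamma> t)) = \<phi> (h [^] i) (\<gamma> t)"
      using act_mult[of "inv (c j)" "c k" "\<gamma> t"] c by (metis inv_closed)
    show ?thesis unfolding P_def e B'_def
    proof (rule translated_line_coord_bounded[OF \<eta> \<gamma>g B])
      show "\<phi> (h [^] i) (\<eta> t) = \<eta> (t + of_int i * \<sigma>)" for t
        by (rule act_int_pow_line[of h \<eta> \<sigma>, OF h(1) h\<eta>])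
      have "1 \<le> \<bar>int k - int j\<bar>" using that by auto
      then have "real Q * 1 \<le> real Q * \<bar>of_int (int k - int j)\<bar>" by (intro mult_left_mono) auto
      then have "real Q \<le> \<bar>of_int i\<bar>" unfolding i_def by (simp add: abs_mult)
      then have "real Q * \<sigma> \<le> \<bar>of_int i * \<sigma>\<bar>" using \<sigma> by (simp add: abs_mult)
      then show "2 * B + 2 * K' < \<bar>of_int i * \<sigma>\<bar>" using Q by simp
    qed (use h(1) in auto)
  qed
  have B': "0 \<le> B'" using cross[of 0 1 0] by simp
  define D where "D = (\<Sum>k<64. dist (\<phi> (inv (c k)) x0) (\<gamma> 0))"
  have D: "dist (\<phi> (inv (c k)) x0) (\<gamma> 0) \<le> D" if "k < 64" for k
    unfolding D_def using that by (intro member_le_sum) auto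
  have D0: "0 \<le> D" unfolding D_def by (intro sum_nonneg) auto
  \<comment> \<open>Images of \<open>x0\<close> under a foreign letter project within B' + D + K;
    the surplus over \<open>B'\<close> also provides the gap of more than K + 1 used in
    \<open>one_far\<close>.\<close>
  define R where "R = B' + D + 2 * K + 1"
  obtain N' :: nat where N': "4 * R + 5 * K + 2 * D + 1 < real N' * \<tau>"
    using reals_Archimedean3[OF \<tau>] by blast
  \<comment> \<open>The factor \<open>N'\<close> provides translation length; the factor
    \<open>m\<close> makes every letter an m-th power, as the hitting times require.\<close>
  define N where "N = N' * m"
  define T where "T = real N * \<tau>"
  have "real N' * 1 \<le> real N' * real m" using m by (intro mult_left_mono) auto
  then have "real N' * \<tau> \<le> T" unfolding T_def N_def using \<tau> by (simp add: mult_right_mono del: mult_le_cancel_left1)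
  then have T: "4 * R + 5 * K + 2 * D + 1 < T" using N' by simp
  have T0: "0 \<le> T" unfolding T_def using \<tau> by simp
  have gN: "g [^] N \<in> carrier G" using g by simp
  have gN\<gamma>: "\<phi> (g [^] N) (\<gamma> t) = \<gamma> (t + T)" for t
    unfolding T_def by (rule act_nat_pow_line[of g \<gamma> \<tau>, OF g(1) g\<gamma>])
  have gN\<gamma>': "\<phi> (inv (g [^] N)) (\<gamma> t) = \<gamma> (t + - T)" for t
    using gN\<gamma>[of "t - T"] act_inv_cancel(1)[OF gN, of "\<gamma> (t - T)"] by simp
  define \<alpha> where "\<alpha> k = c k \<otimes> g [^] N \<otimes> inv (c k)" for k
  have \<alpha>: "\<alpha> k \<in> carrier G" for k unfolding \<alpha>_def using c gN by simp
  have P_act: "P k (\<phi> (c k) y) = line_coord \<gamma> y" for k y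
    unfolding P_def using c by simp
  have act: "\<phi> (\<alpha> k) x = \<phi> (c k) (\<phi> (g [^] N) (\<phi> (inv (c k)) x))" for k x
    unfolding \<alpha>_def using c gN by (simp add: act_mult)
  have act': "\<phi> (inv (\<alpha> k)) x = \<phi> (c k) (\<phi> (inv (g [^] N)) (\<phi> (inv (c k)) x))" for k x
    unfolding \<alpha>_def using c gN by (simp add: act_mult inv_mult_group)
  have shift: "P k x + T - K \<le> P k (\<phi> (\<alpha> k) x)" for k x
    using coarse_axis_translate[of K \<gamma> "\<phi> (g [^] N)" T "\<phi> (inv (c k)) x", OF \<gamma> _ gN\<gamma>] gN
    unfolding act P_act unfolding P_def by auto
  have shift': "P k (\<phi> (inv (\<alpha> k)) x) \<le> P k x - T + K" for k x
    using coarse_axis_translate[of K \<gamma> "\<phi> (inv (g [^] N))" "- T" "\<phi> (inv (c k)) x", OF \<gamma> _ gN\<gamma>'] gN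
    unfolding act' P_act unfolding P_def by auto
  have lip: "\<bar>P k x - P k y\<bar> \<le> dist x y + K" for k x y
    using coarse_axis_lipschitz[OF \<gamma>, of "\<phi> (inv (c k)) x" "\<phi> (inv (c k)) y"] c unfolding P_def by simp
  have base: "\<bar>P k x0\<bar> \<le> D + K" if "k < 64" for k
    using coarse_axis_near[OF \<gamma> D[OF that]] unfolding P_def by simp
  have other: "\<bar>P j (\<phi> (c k) (\<phi> f (\<phi> (inv (c k)) x0)))\<bar> \<le> B' + D + K"
    if "j \<noteq> k" "k < 64" "f \<in> carrier G" "\<phi> f (\<gamma> 0) = \<gamma> t" for j k f t
  proof -
    have "dist (\<phi> (c k) (\<phi> f (\<phi> (inv (c k)) x0))) (\<phi> (c k) (\<gamma> t)) \<le> D"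
      unfolding that(4)[symmetric] using c that(3) D[OF that(2)] by simp
    then show ?thesis
      using lip[of j "\<phi> (c k) (\<phi> f (\<phi> (inv (c k)) x0))" "\<phi> (c k) (\<gamma> t)"] cross[OF that(1), of t]
      by linarith
  qed
  have away: "\<bar>P j (\<phi> (\<alpha> k) x0)\<bar> \<le> R" "\<bar>P j (\<phi> (inv (\<alpha> k)) x0)\<bar> \<le> R" if "j \<noteq> k" "k < 64" for j k
    using other[OF that gN gN\<gamma>] other[OF that _ gN\<gamma>'] gN K unfolding act act' R_def by auto
  have inj: "inj_on \<alpha> {..<64}"
  proof (rule inj_onI, rule ccontr)
    fix j k assume jk: "j \<in> {..<64::nat}" "k \<in> {..<64}" "\<alpha> j = \<alpha> k" "j \<noteq> k"
    then have "P j (\<phi> (\<alpha> j) x0) \<le> R" using away(1)[of j k] by simp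
    moreover have "- (D + K) + T - K \<le> P j (\<phi> (\<alpha> j) x0)" using shift[of j x0] base[of j] jk by auto
    ultimately show False using T B' D0 K unfolding R_def by argo
  qed
  define S where "S = \<alpha> ` {..<64}"
  define \<iota> where "\<iota> = inv_into {..<64} \<alpha>"
  have \<iota>: "\<iota> (\<alpha> k) = k" if "k < 64" for k unfolding \<iota>_def using inj that by simp
  have P_dist: "L k x + \<bar>P k x - P k y\<bar> + L k y - K \<le> dist x y" if "K < \<bar>P k x - P k y\<bar>" for k x y
    using coarse_axisD(3)[OF \<gamma>, of "\<phi> (inv (c k)) x" "\<phi> (inv (c k)) y"] that c
    unfolding P_def L_def by simp
  \<comment> \<open>A far projection to axis \<open>k\<close> forces the way from \<open>x\<close>
    to its nearest point on axis \<open>j\<close> to follow axis \<open>k\<close> for a while, so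
    axis \<open>k\<close> is strictly nearer. Two far projections would make each axis nearer than
    the other.\<close>
  have one_far: False if "j \<noteq> k" "R < \<bar>P j x\<bar>" "R < \<bar>P k x\<bar>" for j k x
  proof -
    have *: "L k x < L j x" if "j \<noteq> k" "R < \<bar>P k x\<bar>" for j k
    proof -
      define y where "y = \<phi> (c j) (\<gamma> (P j x))"
      have "\<bar>P k y\<bar> \<le> B'" unfolding y_def by (rule cross) (use that in auto)
      then have gap: "K + 1 < \<bar>P k x - P k y\<bar>" using that(2) D0 K unfolding R_def by linarith
      have "L k x + \<bar>P k x - P k y\<bar> + L k y - K \<le> dist x y" by (rule P_dist) (use gap in simp)
      moreover have "dist x y = L j x"
        unfolding y_def L_def line_dist_def P_def using c by (simp add: act_dist_inv)
      moreover have "0 \<le> L k y" unfolding L_def by (rule line_dist_nonneg)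
      ultimately show ?thesis using gap by linarith
    qed
    show False using *[of j k] *[of k j] that by auto
  qed
  have "schottky_set G \<phi> x0 S (\<lambda>a. P (\<iota> a)) (\<lambda>a. L (\<iota> a)) K D R T"
  proof (unfold_locales)
    show "S \<subseteq> carrier G" unfolding S_def using \<alpha> by auto
    show "card S = 64" unfolding S_def using card_image[OF inj] by simp
    show "0 \<le> R" unfolding R_def using B' D0 K by simp
    fix a x y assume "a \<in> S"
    then obtain k where k: "k < 64" "a = \<alpha> k" unfolding S_def by auto
    show "0 \<le> L (\<iota> a) x" unfolding L_def by (rule line_dist_nonneg)
    show "K < \<bar>P (\<iota> a) x - P (\<iota> a) y\<bar> \<Longrightarrow>
        L (\<iota> a) x + \<bar>P (\<iota> a) x - P (\<iota> a) y\<bar> + L (\<iota> a) y - K \<le> dist x y" by (rule P_dist)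
    have "dist x x0 = dist (\<phi> (inv (c k)) x) (\<phi> (inv (c k)) x0)" using c by simp
    also have "\<dots> \<le> L k x + dist (\<gamma> (P k x)) (\<gamma> 0) + dist (\<phi> (inv (c k)) x0) (\<gamma> 0)"
      unfolding L_def P_def line_dist_def by metric
    also have "\<dots> \<le> L k x + \<bar>P k x\<bar> + D"
      using D[OF k(1)] \<gamma>g unfolding geodesic_line_def by simp
    finally show "dist x x0 \<le> L (\<iota> a) x + \<bar>P (\<iota> a) x\<bar> + D" using k \<iota> by simp
    show "\<bar>P (\<iota> a) x0\<bar> \<le> R" using base[OF k(1)] k \<iota> B' D0 K unfolding R_def by simp
    show "P (\<iota> a) x + T - K \<le> P (\<iota> a) (\<phi> a x)" using shift[of k x] k \<iota> by simp
    fix b assume "b \<in> S"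
    then obtain j where j: "j < 64" "b = \<alpha> j" unfolding S_def by auto
    \<comment> \<open>On its own axis the inverse letter moves \<open>x0\<close> by about
      \<open>T\<close> in the negative direction, which is compatible with an upper bound
      only.\<close>
    have "P j (\<phi> (inv (\<alpha> k)) x0) \<le> R"
    proof (cases "j = k")
      case True
      then show ?thesis using shift'[of k x0] base[OF k(1)] T0 B' D0 K unfolding R_def by auto
    next
      case False
      then show ?thesis using away(2)[of j k] k by auto
    qed
    then show "P (\<iota> b) (\<phi> (inv a) x0) \<le> R" using k j \<iota> by simp
  next
    fix x
    have "a = b" if "a \<in> S" "b \<in> S" "R < \<bar>P (\<iota> a) x\<bar>" "R < \<bar>P (\<iota> b) x\<bar>" for a b
      using that one_far \<iota> unfolding S_def by (metis (no_types, lifting) imageE lessThan_iff)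
    moreover have "finite {a \<in> S. R < \<bar>P (\<iota> a) x\<bar>}" unfolding S_def by simp
    ultimately show "card {a \<in> S. R < \<bar>P (\<iota> a) x\<bar>} \<le> 1"
      unfolding One_nat_def by (subst card_le_Suc0_iff_eq) auto
  qed (use D0 K T in auto)
  moreover have "\<exists>b\<in>carrier G. a = b [^] m" if a: "a \<in> S" for a
  proof -
    obtain k where k: "a = \<alpha> k" using a unfolding S_def by auto
    have "a = (c k \<otimes> g [^] N' \<otimes> inv (c k)) [^] m"
      unfolding k \<alpha>_def N_def using c g by (simp add: conjugate_nat_pow nat_pow_pow)
    then show ?thesis by (rule bexI) (use c g in simp)
  qed
  ultimately show ?thesis by blast
qed

end

section \<open>Random walks on countable groups\<close>

definition drop_seq :: "nat \<Rightarrow> (nat \<Rightarrow> 'c) \<Rightarrow> nat \<Rightarrow> 'c" where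
  "drop_seq k \<omega> i = \<omega> (i + k)"

lemma drop_seq_drop_seq: "drop_seq j (drop_seq k \<omega>) = drop_seq (j + k) \<omega>"
  by (simp add: drop_seq_def fun_eq_iff add_ac)

lemma drop_seq_0 [simp]: "drop_seq 0 \<omega> = \<omega>"
  by (simp add: drop_seq_def fun_eq_iff)

locale random_walk = group G + prob_space \<mu>
  for G :: "('a, 'b) monoid_scheme" (structure) and \<mu> :: "'a measure" +
  assumes countable_carrier: "countable (carrier G)"
    and sets_\<mu>: "sets \<mu> = Pow (carrier G)"
begin

lemma space_\<mu>: "space \<mu> = carrier G"
  using sets_eq_imp_space_eq[of \<mu> "count_space (carrier G)"] sets_\<mu> by simp

lemma measurable_from_\<mu>: "measurable \<mu> N = measurable (count_space (carrier G)) N"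
  by (rule measurable_cong_sets) (simp_all add: sets_\<mu>)

abbreviation "W \<equiv> walk_space \<mu>"
abbreviation "Z \<equiv> walk G"

sublocale seq: sequence_space \<mu>
  by unfold_locales

lemma W_eq: "W = (\<Pi>\<^sub>M i\<in>(UNIV :: nat set). \<mu>)"
  by (simp add: walk_space_def)

sublocale W: prob_space W
  unfolding W_eq by (rule seq.P.prob_space_axioms)

lemma space_W: "\<omega> \<in> space W \<longleftrightarrow> (\<forall>i. \<omega> i \<in> carrier G)"
  unfolding W_eq by (auto simp: space_PiM space_\<mu> PiE_iff)

lemma walk_closed: "\<omega> \<in> space W \<Longrightarrow> Z n \<omega> \<in> carrier G"
  by (induction n) (auto simp: space_W)

lemma measurable_increment: "(\<lambda>\<omega>. \<omega> i) \<in> W \<rightarrow>\<^sub>M \<mu>"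
  unfolding W_eq by simp

lemma measurable_walk: "Z n \<in> W \<rightarrow>\<^sub>M count_space (carrier G)"
proof (induction n)
  case 0
  then show ?case by (auto intro!: measurable_const simp: fun_eq_iff cong: measurable_cong)
next
  case (Suc n)
  have "(\<lambda>\<omega>. g \<otimes> \<omega> n) \<in> W \<rightarrow>\<^sub>M count_space (carrier G)" if "g \<in> carrier G" for g
  proof (rule measurable_compose[OF measurable_increment])
    show "(\<lambda>x. g \<otimes> x) \<in> \<mu> \<rightarrow>\<^sub>M count_space (carrier G)"
      unfolding measurable_from_\<mu> using that by auto
  qed
  from measurable_compose_countable'[OF this Suc.IH countable_carrier] show ?case by simp
qed

lemma borel_measurable_walk: "(\<lambda>\<omega>. F (Z n \<omega>)) \<in> W \<rightarrow>\<^sub>M N" if "F \<in> carrier G \<rightarrow> space N"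
  by (rule measurable_compose[OF measurable_walk]) (use that in auto)

lemma drop_seq_space: "\<omega> \<in> space W \<Longrightarrow> drop_seq k \<omega> \<in> space W"
  by (auto simp: space_W drop_seq_def)

lemma measurable_drop_seq: "drop_seq k \<in> W \<rightarrow>\<^sub>M W"
  unfolding W_eq drop_seq_def[abs_def] by (rule measurable_PiM_single') (auto simp: space_PiM)

lemma drop_seq_comb_seq: "drop_seq k (comb_seq k \<omega> \<omega>') = \<omega>'"
  by (simp add: drop_seq_def fun_eq_iff comb_seq_add)

lemma distr_comb_seq: "distr (W \<Otimes>\<^sub>M W) W (\<lambda>(\<omega>, \<omega>'). comb_seq i \<omega> \<omega>') = W"
  unfolding W_eq by (rule seq.PiM_comb_seq)

lemma measurable_comb: "(\<lambda>(\<omega>, \<omega>'). comb_seq i \<omega> \<omega>') \<in> W \<Otimes>\<^sub>M W \<rightarrow>\<^sub>M W"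
  unfolding W_eq by (rule measurable_comb_seq)

lemma distr_pair_snd: "distr (W \<Otimes>\<^sub>M W) W snd = W"
proof (rule measure_eqI)
  fix A assume A: "A \<in> sets (distr (W \<Otimes>\<^sub>M W) W snd)"
  then have "emeasure (distr (W \<Otimes>\<^sub>M W) W snd) A = emeasure (W \<Otimes>\<^sub>M W) (space W \<times> A)"
    by (auto simp: emeasure_distr space_pair_measure dest: sets.sets_into_space intro!: arg_cong2[where f = emeasure])
  then show "emeasure (distr (W \<Otimes>\<^sub>M W) W snd) A = emeasure W A"
    using A by (simp add: W.emeasure_pair_measure_Times W.emeasure_space_1)
qed simp

lemma distr_drop_seq: "distr W W (drop_seq k) = W"
proof -
  have "distr W W (drop_seq k) = distr (distr (W \<Otimes>\<^sub>M W) W (\<lambda>(\<omega>, \<omega>'). comb_seq k \<omega> \<omega>')) W (drop_seq k)"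
    by (simp add: distr_comb_seq)
  also have "\<dots> = distr (W \<Otimes>\<^sub>M W) W (drop_seq k \<circ> (\<lambda>(\<omega>, \<omega>'). comb_seq k \<omega> \<omega>'))"
    by (rule distr_distr[OF measurable_drop_seq measurable_comb])
  also have "drop_seq k \<circ> (\<lambda>(\<omega>, \<omega>'). comb_seq k \<omega> \<omega>') = snd"
    by (auto simp: fun_eq_iff drop_seq_comb_seq)
  finally show ?thesis by (simp add: distr_pair_snd)
qed

lemma walk_add: "\<omega> \<in> space W \<Longrightarrow> Z (n + m) \<omega> = Z n \<omega> \<otimes> Z m (drop_seq n \<omega>)"
proof (induction m)
  case 0
  then show ?case using walk_closed[of \<omega> n] by simp
next
  case (Suc m)
  have "Z m (drop_seq n \<omega>) \<in> carrier G" "\<omega> (m + n) \<in> carrier G"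
    using Suc.prems walk_closed drop_seq_space by (auto simp: space_W)
  moreover have "drop_seq n \<omega> m = \<omega> (n + m)" by (simp add: drop_seq_def add.commute)
  ultimately show ?case using Suc walk_closed[of \<omega> n] by (simp add: m_assoc add.commute)
qed

lemma walk_comb_seq: "Z n (comb_seq n \<omega> \<omega>') = Z n \<omega>"
proof -
  have "k \<le> n \<Longrightarrow> Z k (comb_seq n \<omega> \<omega>') = Z k \<omega>" for k
    by (induction k) (auto simp: comb_seq_less)
  then show ?thesis by simp
qed

lemma walk_one: "\<omega> \<in> space W \<Longrightarrow> Z 1 \<omega> = \<omega> 0"
  by (simp add: space_W)

lemma integrable_walk:
  fixes F :: "'a \<Rightarrow> real"
  assumes "\<And>x. x \<in> carrier G \<Longrightarrow> \<bar>F x\<bar> \<le> B"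
  shows "integrable W (\<lambda>\<omega>. F (Z n \<omega>))"
  by (rule W.integrable_const_bound[of _ B]) (auto intro!: AE_I2 assms walk_closed borel_measurable_walk)

text \<open>The Markov property in integrated form: a trajectory is glued from its first
  \<open>n\<close> increments and an independent copy for the rest, and Fubini separates the
  two.\<close>

lemma integral_walk_add:
  fixes F :: "'a \<Rightarrow> real"
  assumes F: "\<And>x. x \<in> carrier G \<Longrightarrow> \<bar>F x\<bar> \<le> B"
  shows "(\<integral>\<omega>. F (Z (n + m) \<omega>) \<partial>W) = (\<integral>\<omega>. \<integral>\<omega>'. F (Z n \<omega> \<otimes> Z m \<omega>') \<partial>W \<partial>W)"
proof -
  let ?c = "\<lambda>(\<omega>, \<omega>'). comb_seq n \<omega> \<omega>'"
  interpret P: pair_prob_space W W by unfold_locales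
  have Fm: "(\<lambda>\<omega>. F (Z (n + m) \<omega>)) \<in> borel_measurable W"
    by (rule borel_measurable_walk) simp
  have Fi: "integrable (W \<Otimes>\<^sub>M W) (\<lambda>z. F (Z (n + m) (?c z)))"
    by (rule integrable_distr[OF measurable_comb])
      (simp only: distr_comb_seq, rule integrable_walk[of F B], rule F)
  have "(\<integral>\<omega>. F (Z (n + m) \<omega>) \<partial>W) = (\<integral>\<omega>. F (Z (n + m) \<omega>) \<partial>distr (W \<Otimes>\<^sub>M W) W ?c)"
    by (simp add: distr_comb_seq)
  also have "\<dots> = (\<integral>z. F (Z (n + m) (?c z)) \<partial>(W \<Otimes>\<^sub>M W))"
    by (rule integral_distr[OF measurable_comb Fm])
  also have "\<dots> = (\<integral>\<omega>. \<integral>\<omega>'. F (Z (n + m) (?c (\<omega>, \<omega>'))) \<partial>W \<partial>W)"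
    by (rule P.integral_fst'[OF Fi, symmetric])
  also have "\<dots> = (\<integral>\<omega>. \<integral>\<omega>'. F (Z n \<omega> \<otimes> Z m \<omega>') \<partial>W \<partial>W)"
  proof (intro Bochner_Integration.integral_cong refl)
    fix \<omega> \<omega>' assume o: "\<omega> \<in> space W" "\<omega>' \<in> space W"
    then have "comb_seq n \<omega> \<omega>' \<in> space W" by (auto simp: space_W comb_seq_def)
    then show "F (Z (n + m) (?c (\<omega>, \<omega>'))) = F (Z n \<omega> \<otimes> Z m \<omega>')"
      by (simp add: walk_add walk_comb_seq drop_seq_comb_seq)
  qed
  finally show ?thesis .
qed

text \<open>The probability that the walk is at \<open>x\<close> at time \<open>n\<close>, written
  as an integral so that \<open>integral_walk_add\<close> applies to it.\<close>

definition hit :: "nat \<Rightarrow> 'a \<Rightarrow> real" where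
  "hit n x = (\<integral>\<omega>. indicat_real {x} (Z n \<omega>) \<partial>W)"

lemma hit_nonneg: "0 \<le> hit n x"
  unfolding hit_def by simp

lemma hit_le_1: "hit n x \<le> 1"
proof -
  have "hit n x \<le> (\<integral>\<omega>. 1 \<partial>W)" unfolding hit_def
    by (intro integral_mono integrable_walk[of _ 1]) (auto simp: indicator_def)
  then show ?thesis by (simp add: W.prob_space)
qed

lemma hit_add:
  assumes "a \<in> carrier G" "b \<in> carrier G"
  shows "hit n a * hit m b \<le> hit (n + m) (a \<otimes> b)"
proof -
  have "hit n a * hit m b = (\<integral>\<omega>. \<integral>\<omega>'. indicat_real {a} (Z n \<omega>) * indicat_real {b} (Z m \<omega>') \<partial>W \<partial>W)"
    unfolding hit_def by simp
  also have "\<dots> \<le> (\<integral>\<omega>. \<integral>\<omega>'. indicat_real {a \<otimes> b} (Z n \<omega> \<otimes> Z m \<omega>') \<partial>W \<partial>W)"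
  proof (rule integral_mono)
    show "integrable W (\<lambda>\<omega>. \<integral>\<omega>'. indicat_real {a} (Z n \<omega>) * indicat_real {b} (Z m \<omega>') \<partial>W)"
      by (rule integrable_walk[of "\<lambda>x. \<integral>\<omega>'. indicat_real {a} x * indicat_real {b} (Z m \<omega>') \<partial>W" 1])
        (use hit_nonneg[of m b] hit_le_1[of m b] in \<open>auto simp: hit_def indicator_def abs_mult\<close>)
    show "integrable W (\<lambda>\<omega>. \<integral>\<omega>'. indicat_real {a \<otimes> b} (Z n \<omega> \<otimes> Z m \<omega>') \<partial>W)"
    proof (rule integrable_walk[of "\<lambda>x. \<integral>\<omega>'. indicat_real {a \<otimes> b} (x \<otimes> Z m \<omega>') \<partial>W" 1])
      fix x assume "x \<in> carrier G"
      have "(\<integral>\<omega>'. indicat_real {a \<otimes> b} (x \<otimes> Z m \<omega>') \<partial>W) \<le> (\<integral>\<omega>'. 1 \<partial>W)"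
        by (intro integral_mono integrable_walk[of "\<lambda>y. indicat_real {a \<otimes> b} (x \<otimes> y)" 1]) (auto simp: indicator_def)
      then show "\<bar>\<integral>\<omega>'. indicat_real {a \<otimes> b} (x \<otimes> Z m \<omega>') \<partial>W\<bar> \<le> 1" by (simp add: W.prob_space)
    qed
    fix \<omega> assume "\<omega> \<in> space W"
    show "(\<integral>\<omega>'. indicat_real {a} (Z n \<omega>) * indicat_real {b} (Z m \<omega>') \<partial>W)
        \<le> (\<integral>\<omega>'. indicat_real {a \<otimes> b} (Z n \<omega> \<otimes> Z m \<omega>') \<partial>W)"
      by (intro integral_mono
          integrable_walk[of "\<lambda>y. indicat_real {a} (Z n \<omega>) * indicat_real {b} y" 1]
          integrable_walk[of "\<lambda>y. indicat_real {a \<otimes> b} (Z n \<omega> \<otimes> y)" 1])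
        (auto simp: indicator_def)
  qed
  also have "\<dots> = hit (n + m) (a \<otimes> b)"
    unfolding hit_def by (rule integral_walk_add[of _ 1, symmetric]) (auto simp: indicator_def)
  finally show ?thesis .
qed

lemma hit_add_pos:
  assumes "a \<in> carrier G" "b \<in> carrier G" "0 < hit n a" "0 < hit m b"
  shows "0 < hit (n + m) (a \<otimes> b)"
  using hit_add[OF assms(1,2), of n m] mult_pos_pos[OF assms(3,4)] by linarith

lemma hit_one: "x \<in> carrier G \<Longrightarrow> hit 1 x = measure \<mu> {x}"
proof -
  assume x: "x \<in> carrier G"
  have "hit 1 x = (\<integral>\<omega>. indicat_real {x} (\<omega> 0) \<partial>W)"
    unfolding hit_def by (intro Bochner_Integration.integral_cong refl) (simp add: walk_one del: One_nat_def)
  also have "\<dots> = (\<integral>y. indicat_real {x} y \<partial>distr W \<mu> (\<lambda>\<omega>. \<omega> 0))"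
    by (rule integral_distr[OF measurable_increment, symmetric]) (simp add: measurable_from_\<mu>)
  also have "distr W \<mu> (\<lambda>\<omega>. \<omega> 0) = \<mu>"
    unfolding W_eq using seq.PiM_component[of 0] by simp
  also have "(\<integral>y. indicat_real {x} y \<partial>\<mu>) = measure \<mu> {x}"
    using x by (simp add: space_\<mu>)
  finally show ?thesis .
qed

lemma hit_pos_exists:
  assumes adm: "admissible G \<mu>" and x: "x \<in> carrier G"
  shows "\<exists>n\<ge>1. 0 < hit n x"
proof -
  define S where "S = {g \<in> carrier G. emeasure \<mu> {g} > 0}"
  have "x \<in> semigroup_generated G S" using adm x unfolding admissible_def S_def by simp
  then have "x \<in> carrier G \<and> (\<exists>n\<ge>1. 0 < hit n x)"
  proof induction
    case (incl s)
    then have "s \<in> carrier G" "0 < hit 1 s"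
      using hit_one[of s] unfolding S_def by (auto simp: emeasure_eq_measure ennreal_zero_less_one)
    then show ?case by blast
  next
    case (mult a b)
    then show ?case using hit_add_pos by (meson m_closed trans_le_add1)
  qed
  then show ?thesis by blast
qed

lemma hit_nat_pow:
  assumes "a \<in> carrier G" "0 < hit n a" shows "0 < hit (n * k) (a [^] k)"
proof (induction k)
  case 0
  have "hit 0 \<one> = 1" unfolding hit_def by (simp add: W.prob_space)
  then show ?case by simp
next
  case (Suc k)
  then have "0 < hit (n * k + n) (a [^] k \<otimes> a)" using assms by (intro hit_add_pos) auto
  then show ?case by (simp add: add.commute)
qed

text \<open>The walk may be periodic; \<open>m\<close>-th powers are all hit at multiples of a period \<open>m\<close> of \<open>\<one>\<close>,
  so that the hitting times can be made equal.\<close>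

lemma common_hitting_time:
  assumes adm: "admissible G \<mu>"
  shows "\<exists>m\<ge>1. \<forall>A. finite A \<longrightarrow> (\<forall>a\<in>A. \<exists>b\<in>carrier G. a = b [^] (m::nat)) \<longrightarrow>
      (\<exists>K\<ge>1. \<forall>a\<in>A. 0 < hit K a)"
proof -
  obtain m where m: "m \<ge> 1" "0 < hit m \<one>" using hit_pos_exists[OF adm one_closed] by blast
  have "\<exists>K\<ge>1. \<forall>a\<in>A. 0 < hit K a" if A: "finite A" "\<forall>a\<in>A. \<exists>b\<in>carrier G. a = b [^] m" for A
  proof -
    have "\<exists>n. 0 < hit (n * m) a" if a: "a \<in> A" for a
    proof -
      obtain b where b: "b \<in> carrier G" "a = b [^] m" using A(2) a by blast
      obtain n where "0 < hit n b" using hit_pos_exists[OF adm b(1)] by blast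
      from hit_nat_pow[OF b(1) this] show ?thesis unfolding b(2) by blast
    qed
    then obtain n where n: "\<And>a. a \<in> A \<Longrightarrow> 0 < hit (n a * m) a" by metis
    define N where "N = Suc (\<Sum>a\<in>A. n a)"
    have "0 < hit (N * m) a" if a: "a \<in> A" for a
    proof -
      have ac: "a \<in> carrier G" using A(2) a by auto
      have le: "n a \<le> N" unfolding N_def using member_le_sum[OF a, of n] A(1) by simp
      \<comment> \<open>Loops at the identity fill up the difference to the common time; their
        length is a multiple of the period \<open>m\<close>.\<close>
      have "0 < hit (m * (N - n a)) \<one>" using hit_nat_pow[OF one_closed m(2), of "N - n a"] by simp
      from hit_add_pos[OF ac one_closed n[OF a] this] have "0 < hit (n a * m + m * (N - n a)) a"
        using ac by simp
      moreover have "n a * m + m * (N - n a) = N * m"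
        using le by (metis add_mult_distrib le_add_diff_inverse mult.commute)
      ultimately show ?thesis by simp
    qed
    moreover have "1 \<le> N * m" unfolding N_def using m(1) by simp
    ultimately show ?thesis by blast
  qed
  then show ?thesis using m(1) by blast
qed

end

section \<open>Interleaved averages under translation and integration\<close>

context schottky_set begin

lemma interleaved_avg_snoc:
  "interleaved_avg (ws @ [w]) f g = interleaved_avg ws (\<lambda>x. (\<Sum>a\<in>S. \<Sum>b\<in>S. f (x \<otimes> a \<otimes> b \<otimes> w)) / 64\<^sup>2) g"
  by (induction ws arbitrary: g) simp_all

lemma interleaved_avg_cong:
  assumes "\<And>x. x \<in> carrier G \<Longrightarrow> f x = f' x"
  shows "set ws \<subseteq> carrier G \<Longrightarrow> g \<in> carrier G \<Longrightarrow> interleaved_avg ws f g = interleaved_avg ws f' g"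
proof (induction ws arbitrary: g)
  case (Cons w ws)
  then show ?case
    by (auto intro!: sum.cong simp: S_closed)
qed (simp add: assms)

lemma interleaved_avg_sum:
  "interleaved_avg ws (\<lambda>x. \<Sum>i\<in>I. h i x) g = (\<Sum>i\<in>I. interleaved_avg ws (h i) g)"
proof (induction ws arbitrary: g)
  case (Cons w ws)
  show ?case by (simp only: interleaved_avg.simps Cons.IH sum.swap[of _ S I] sum_divide_distrib)
qed simp

lemma interleaved_avg_divide:
  "interleaved_avg ws (\<lambda>x. h x / c) g = interleaved_avg ws h g / c"
  by (induction ws arbitrary: g) (simp_all flip: sum_divide_distrib)

text \<open>The factor \<open>y\<close> is absorbed into the last word, or into \<open>g\<close> if
  there is none. A bound that sees only the number of words is thus stable under right
  translation.\<close>

lemma interleaved_avg_translate: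
  assumes c: "\<And>ws g. set ws \<subseteq> carrier G \<Longrightarrow> g \<in> carrier G \<Longrightarrow> interleaved_avg ws f g \<le> c (length ws)"
    and ws: "set ws \<subseteq> carrier G" and g: "g \<in> carrier G" and y: "y \<in> carrier G"
  shows "interleaved_avg ws (\<lambda>x. f (x \<otimes> y)) g \<le> c (length ws)"
proof (cases ws rule: rev_cases)
  case Nil
  then show ?thesis using c[of "[]" "g \<otimes> y"] g y by simp
next
  case (snoc vs v)
  have vs: "set vs \<subseteq> carrier G" and v: "v \<in> carrier G" using ws snoc by auto
  have "interleaved_avg ws (\<lambda>x. f (x \<otimes> y)) g =
      interleaved_avg vs (\<lambda>x. (\<Sum>a\<in>S. \<Sum>b\<in>S. f (x \<otimes> a \<otimes> b \<otimes> (v \<otimes> y))) / 64\<^sup>2) g"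
    unfolding snoc interleaved_avg_snoc
    by (rule interleaved_avg_cong[OF _ vs g], intro arg_cong2[where f = "(/)"] sum.cong refl arg_cong[where f = f])
      (simp add: m_assoc S_closed v y)
  also have "\<dots> = interleaved_avg (vs @ [v \<otimes> y]) f g" by (rule interleaved_avg_snoc[symmetric])
  also have "\<dots> \<le> c (length (vs @ [v \<otimes> y]))" using vs v y g by (intro c) auto
  finally show ?thesis by (simp add: snoc)
qed

lemma interleaved_avg_integral:
  fixes h :: "'a \<Rightarrow> 'c \<Rightarrow> real"
  assumes h: "\<And>x. x \<in> carrier G \<Longrightarrow> integrable M (h x)"
  shows "set ws \<subseteq> carrier G \<Longrightarrow> g \<in> carrier G \<Longrightarrow>
    integrable M (\<lambda>\<omega>. interleaved_avg ws (\<lambda>x. h x \<omega>) g) \<and>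
    interleaved_avg ws (\<lambda>x. \<integral>\<omega>. h x \<omega> \<partial>M) g = (\<integral>\<omega>. interleaved_avg ws (\<lambda>x. h x \<omega>) g \<partial>M)"
proof (induction ws arbitrary: g)
  case (Cons w ws)
  have IH: "integrable M (\<lambda>\<omega>. interleaved_avg ws (\<lambda>x. h x \<omega>) (g \<otimes> a \<otimes> b \<otimes> w))"
    "interleaved_avg ws (\<lambda>x. \<integral>\<omega>. h x \<omega> \<partial>M) (g \<otimes> a \<otimes> b \<otimes> w) =
      (\<integral>\<omega>. interleaved_avg ws (\<lambda>x. h x \<omega>) (g \<otimes> a \<otimes> b \<otimes> w) \<partial>M)"
    if "a \<in> S" "b \<in> S" for a b
    using Cons.IH[of "g \<otimes> a \<otimes> b \<otimes> w"] Cons.prems that S_closed by auto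
  show ?case using IH by (auto intro!: integrable_divide Bochner_Integration.integrable_sum sum.cong)
qed (use h in auto)

end

section \<open>Exponential decay and positivity of the drift\<close>

locale random_walk_action = random_walk G \<mu> + isometric_group_action G \<phi>
  for G :: "('a, 'b) monoid_scheme" (structure) and \<mu> :: "'a measure"
    and \<phi> :: "'a \<Rightarrow> 'x::metric_space \<Rightarrow> 'x" +
  fixes x0 :: 'x
begin

text \<open>With \<open>U n x\<close> the mean of \<open>f\<close> after \<open>n\<close> further
  steps from \<open>x\<close>, every block of \<open>L\<close> steps improves the bound by a factor
  \<open>r\<close>: a block that produces a given product \<open>a \<otimes> b\<close> has
  probability at least \<delta>, and averaged over all pairs such a block gains 1/2.\<close>

lemma displacement_decay:
  assumes sch: "schottky_set G \<phi> x0 S p q K D R T"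
    and hit: "\<And>a b. a \<in> S \<Longrightarrow> b \<in> S \<Longrightarrow> 0 < hit L (a \<otimes> b)"
  shows "\<exists>r. 0 < r \<and> r < 1 \<and> (\<forall>N. (\<integral>\<omega>. (1/4) powr dist x0 (\<phi> (Z N \<omega>) x0) \<partial>W) \<le> r ^ (N div L))"
proof -
  interpret sch: schottky_set G \<phi> x0 S p q K D R T by (rule sch)
  define f :: "'a \<Rightarrow> real" where "f z = (1/4) powr dist x0 (\<phi> z x0)" for z
  have f: "\<bar>f z\<bar> \<le> 1" for z unfolding f_def by (simp add: powr_le1)
  define U where "U n x = (\<integral>\<omega>. f (x \<otimes> Z n \<omega>) \<partial>W)" for n x
  have fi: "integrable W (\<lambda>\<omega>. f (x \<otimes> Z n \<omega>))" for n x
    by (rule integrable_walk[of "\<lambda>y. f (x \<otimes> y)" 1]) (rule f)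
  have U1: "\<bar>U n x\<bar> \<le> 1" for n x
  proof -
    have "\<bar>U n x\<bar> \<le> (\<integral>\<omega>. \<bar>f (x \<otimes> Z n \<omega>)\<bar> \<partial>W)" unfolding U_def by (rule integral_abs_bound)
    also have "\<dots> \<le> 1" by (rule W.integral_le_const) (use fi f in auto)
    finally show ?thesis .
  qed
  have Ui: "integrable W (\<lambda>\<omega>. U n (x \<otimes> Z m \<omega>))" for n m x
    by (rule integrable_walk[of "\<lambda>y. U n (x \<otimes> y)" 1]) (rule U1)
  have U_add: "U (m + n) x = (\<integral>\<omega>. U n (x \<otimes> Z m \<omega>) \<partial>W)" if x: "x \<in> carrier G" for m n x
  proof -
    have "U (m + n) x = (\<integral>\<omega>. \<integral>\<omega>'. f (x \<otimes> (Z m \<omega> \<otimes> Z n \<omega>')) \<partial>W \<partial>W)"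
      unfolding U_def by (rule integral_walk_add[of "\<lambda>y. f (x \<otimes> y)" 1]) (rule f)
    also have "\<dots> = (\<integral>\<omega>. U n (x \<otimes> Z m \<omega>) \<partial>W)"
      unfolding U_def
      by (intro Bochner_Integration.integral_cong refl arg_cong[where f = f])
        (simp add: m_assoc x walk_closed)
    finally show ?thesis .
  qed
  define \<delta> where "\<delta> = Min ((\<lambda>(a, b). hit L (a \<otimes> b)) ` (S \<times> S))"
  have ne: "S \<noteq> {}" using sch.card_S by auto
  have fin: "finite ((\<lambda>(a, b). hit L (a \<otimes> b)) ` (S \<times> S))" "(\<lambda>(a, b). hit L (a \<otimes> b)) ` (S \<times> S) \<noteq> {}"
    using sch.finite_S ne by auto
  have \<delta>: "\<delta> \<le> hit L (a \<otimes> b)" if "a \<in> S" "b \<in> S" for a b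
    unfolding \<delta>_def using that fin by (intro Min_le) auto
  have \<delta>0: "0 < \<delta>" unfolding \<delta>_def using fin hit by (subst Min_gr_iff) auto
  obtain s where "s \<in> S" using ne by blast
  then have \<delta>1: "\<delta> \<le> 1" using \<delta>[of s s] hit_le_1[of L "s \<otimes> s"] by simp
  define r where "r = 1 - \<delta> / 2"
  have r: "0 < r" "r < 1" unfolding r_def using \<delta>0 \<delta>1 by auto
  \<comment> \<open>The list \<open>ws\<close> keeps the blocks already replaced by Schottky
    letters. Only the empty list matters in the end, but the induction step lengthens it.\<close>
  have main: "sch.interleaved_avg ws (U (n * L + i)) g \<le> (1/2) ^ length ws * r ^ n"
    if "set ws \<subseteq> carrier G" "g \<in> carrier G" for ws g n i
    using that
  proof (induction n arbitrary: ws g)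
    case 0
    have "sch.interleaved_avg ws (U i) g = (\<integral>\<omega>. sch.interleaved_avg ws (\<lambda>x. f (x \<otimes> Z i \<omega>)) g \<partial>W)"
      unfolding U_def by (rule sch.interleaved_avg_integral[THEN conjunct2]) (use fi 0 in auto)
    also have "\<dots> \<le> (1/2) ^ length ws"
    proof (rule W.integral_le_const)
      show "integrable W (\<lambda>\<omega>. sch.interleaved_avg ws (\<lambda>x. f (x \<otimes> Z i \<omega>)) g)"
        by (rule sch.interleaved_avg_integral[THEN conjunct1]) (use fi 0 in auto)
      show "AE \<omega> in W. sch.interleaved_avg ws (\<lambda>x. f (x \<otimes> Z i \<omega>)) g \<le> (1/2) ^ length ws"
        by (intro AE_I2 sch.interleaved_avg_translate[where f = f and c = "\<lambda>k. (1/2) ^ k"])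
          (use sch.interleaved_avg_decay 0 walk_closed in \<open>auto simp: f_def[abs_def]\<close>)
    qed
    finally show ?case by simp
  next
    case (Suc n)
    define u where "u = U (n * L + i)"
    define B where "B = (1/2) ^ length ws * r ^ n"
    define v where "v y = sch.interleaved_avg ws (\<lambda>x. u (x \<otimes> y)) g" for y
    have vB: "v y \<le> B" if "y \<in> carrier G" for y
      unfolding v_def B_def u_def
      by (rule sch.interleaved_avg_translate[where c = "\<lambda>k. (1/2) ^ k * r ^ n"]) (use Suc that in auto)
    have vi: "integrable W (\<lambda>\<omega>. v (Z L \<omega>))"
      unfolding v_def u_def by (rule sch.interleaved_avg_integral[THEN conjunct1]) (use Ui Suc.prems in auto)
    have "sch.interleaved_avg ws (U (Suc n * L + i)) g =
        sch.interleaved_avg ws (\<lambda>x. \<integral>\<omega>. u (x \<otimes> Z L \<omega>) \<partial>W) g"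
      using U_add[of _ L "n * L + i"] unfolding u_def
      by (intro sch.interleaved_avg_cong Suc.prems) (simp add: add.assoc)
    also have "\<dots> = (\<integral>\<omega>. v (Z L \<omega>) \<partial>W)"
      unfolding v_def u_def by (rule sch.interleaved_avg_integral[THEN conjunct2]) (use Ui Suc.prems in auto)
    finally have Ev: "sch.interleaved_avg ws (U (Suc n * L + i)) g = (\<integral>\<omega>. v (Z L \<omega>) \<partial>W)" .
    \<comment> \<open>The defect \<open>B - v\<close> is nonnegative on the group, so its mean
      dominates the contribution of the single atom \<open>a \<otimes> b\<close>. Averaging over the
      pairs afterwards gives the factor \<open>1 - \<delta> / 2\<close>, which is
      \<open>r\<close>.\<close>
    have pair: "\<delta> * (B - v (a \<otimes> b)) \<le> B - (\<integral>\<omega>. v (Z L \<omega>) \<partial>W)" if ab: "a \<in> S" "b \<in> S" for a b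
    proof -
      have abc: "a \<otimes> b \<in> carrier G" using ab sch.S_closed by simp
      have "\<delta> * (B - v (a \<otimes> b)) \<le> hit L (a \<otimes> b) * (B - v (a \<otimes> b))"
        using \<delta>[OF ab] vB[OF abc] by (intro mult_right_mono) auto
      also have "\<dots> = (\<integral>\<omega>. indicat_real {a \<otimes> b} (Z L \<omega>) * (B - v (a \<otimes> b)) \<partial>W)"
        unfolding hit_def by simp
      also have "\<dots> \<le> (\<integral>\<omega>. B - v (Z L \<omega>) \<partial>W)"
      proof (rule integral_mono)
        show "integrable W (\<lambda>\<omega>. indicat_real {a \<otimes> b} (Z L \<omega>) * (B - v (a \<otimes> b)))"
          by (intro integrable_mult_left integrable_walk[of _ 1]) (auto simp: indicator_def)
        show "indicat_real {a \<otimes> b} (Z L \<omega>) * (B - v (a \<otimes> b)) \<le> B - v (Z L \<omega>)" if "\<omega> \<in> space W" for \<omega>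
          using vB[OF walk_closed[OF that, of L]] by (auto simp: indicator_def)
      qed (use vi in auto)
      also have "\<dots> = B - (\<integral>\<omega>. v (Z L \<omega>) \<partial>W)" using vi by (simp add: W.prob_space)
      finally show ?thesis .
    qed
    \<comment> \<open>The letters \<open>a\<close>, \<open>b\<close> form one more block, with the
      trivial word behind it; words that follow later are absorbed there by
      \<open>interleaved_avg_translate\<close>.\<close>
    have "(\<Sum>a\<in>S. \<Sum>b\<in>S. v (a \<otimes> b)) / 64\<^sup>2 = sch.interleaved_avg (ws @ [\<one>]) u g"
    proof -
      have eq: "v (a \<otimes> b) = sch.interleaved_avg ws (\<lambda>x. u (x \<otimes> a \<otimes> b \<otimes> \<one>)) g" if "a \<in> S" "b \<in> S" for a b
        unfolding v_def
        by (rule sch.interleaved_avg_cong[OF _ Suc.prems]) (use that in \<open>simp add: m_assoc sch.S_closed\<close>)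
      show ?thesis using eq
        by (simp add: sch.interleaved_avg_snoc sch.interleaved_avg_divide sch.interleaved_avg_sum)
    qed
    also have "\<dots> \<le> (1/2) ^ length (ws @ [\<one>]) * r ^ n"
      unfolding u_def by (rule Suc.IH) (use Suc.prems in auto)
    finally have avg: "(\<Sum>a\<in>S. \<Sum>b\<in>S. v (a \<otimes> b)) \<le> 64\<^sup>2 * (B / 2)" unfolding B_def by (simp add: field_simps)
    have "(\<Sum>a\<in>S. \<Sum>b\<in>S. \<delta> * (B - v (a \<otimes> b))) \<le> (\<Sum>a\<in>S. \<Sum>b\<in>S. B - (\<integral>\<omega>. v (Z L \<omega>) \<partial>W))"
      by (intro sum_mono pair)
    then have "\<delta> * (64\<^sup>2 * B - (\<Sum>a\<in>S. \<Sum>b\<in>S. v (a \<otimes> b))) \<le> 64\<^sup>2 * (B - (\<integral>\<omega>. v (Z L \<omega>) \<partial>W))"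
      by (simp add: sum_subtractf sch.card_S flip: sum_distrib_left)
    moreover have "\<delta> * (64\<^sup>2 * (B / 2)) \<le> \<delta> * (64\<^sup>2 * B - (\<Sum>a\<in>S. \<Sum>b\<in>S. v (a \<otimes> b)))"
      using avg \<delta>0 by (intro mult_left_mono) auto
    ultimately have "(\<integral>\<omega>. v (Z L \<omega>) \<partial>W) \<le> B * r" unfolding r_def by (simp add: algebra_simps)
    then show ?case unfolding Ev B_def by (simp add: mult_ac)
  qed
  have "(\<integral>\<omega>. f (Z N \<omega>) \<partial>W) \<le> r ^ (N div L)" for N
  proof -
    have "(\<integral>\<omega>. f (Z N \<omega>) \<partial>W) = U N \<one>"
      unfolding U_def by (intro Bochner_Integration.integral_cong refl) (simp add: walk_closed)
    also have "\<dots> = sch.interleaved_avg [] (U ((N div L) * L + N mod L)) \<one>" by simp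
    also have "\<dots> \<le> (1/2) ^ length ([] :: 'a list) * r ^ (N div L)" by (rule main) auto
    finally show ?thesis by simp
  qed
  then show ?thesis using r unfolding f_def by blast
qed

text \<open>The pointwise inequality \<open>D \<le> d + D * 4 powr (D - d)\<close> is integrated:
  where \<open>d\<close> is below \<open>D\<close>, the last term alone exceeds \<open>D\<close>.
  For \<open>D\<close> a small multiple of the number of blocks, the decay makes the integral of
  that term at most D / 2.\<close>

lemma drift_pos:
  assumes r: "0 < r" "r < 1" and L: "1 \<le> L"
    and decay: "\<And>N. (\<integral>\<omega>. (1/4) powr dist x0 (\<phi> (Z N \<omega>) x0) \<partial>W) \<le> r ^ (N div L)"
  shows "0 < drift G \<phi> x0 \<mu>"
proof -
  \<comment> \<open>Since \<open>s\<close> lies strictly between \<open>r\<close> and 1 and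
    \<open>4 powr c = s / r\<close>, multiplying the decay \<open>r ^ n\<close> by
    \<open>4 powr (n * c)\<close> still leaves the decay \<open>s ^ n\<close>.\<close>
  define s where "s = (1 + r) / 2"
  define c where "c = log 4 (s / r)"
  have s: "0 < s" "s < 1" "1 < s / r" unfolding s_def using r by (auto simp: field_simps)
  have c: "0 < c" "4 powr c = s / r" unfolding c_def using s r by auto
  have "(\<lambda>n. s ^ n) \<longlonglongrightarrow> 0" using s by (intro LIMSEQ_realpow_zero) auto
  then have "eventually (\<lambda>n. s ^ n < 1 / 2) sequentially" by (rule order_tendstoD) simp
  then obtain n1 where n1: "\<And>n. n \<ge> n1 \<Longrightarrow> s ^ n < 1 / 2" unfolding eventually_sequentially by blast
  have main: "ennreal (c / (4 * L)) \<le> (\<integral>\<^sup>+ \<omega>. ennreal (dist (\<phi> (Z N \<omega>) x0) x0) \<partial>W) / of_nat N"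
    if N: "L * (n1 + 1) \<le> N" for N
  proof -
    define n where "n = N div L"
    define X where "X = (\<integral>\<^sup>+ \<omega>. ennreal (dist (\<phi> (Z N \<omega>) x0) x0) \<partial>W)"
    define E where "E \<omega> = (1/4) powr dist x0 (\<phi> (Z N \<omega>) x0)" for \<omega>
    have "n1 + 1 \<le> n" unfolding n_def using N L by (simp add: less_eq_div_iff_mult_less_eq mult.commute)
    then have n: "n1 \<le> n" "1 \<le> n" by auto
    have "N < L * (n + 1)" unfolding n_def using L dividend_less_times_div[of L N] by simp
    also have "\<dots> \<le> L * (2 * n)" using n by (intro mult_left_mono) auto
    finally have "real N \<le> real (L * (2 * n))" by (intro of_nat_mono) simp
    then have Nn: "real N \<le> 2 * (real L * real n)" by simp
    define D where "D = n * c"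
    have D: "0 < D" unfolding D_def using n c by simp
    have DC: "4 powr D = (s / r) ^ n"
      unfolding D_def using c(2) s r by (simp add: powr_powr[symmetric] mult.commute[of "real n"] powr_realpow)
    have E0: "0 \<le> E \<omega>" for \<omega> unfolding E_def by simp
    have Em: "E \<in> borel_measurable W" unfolding E_def by (rule borel_measurable_walk) simp
    have Ei: "integrable W E"
      unfolding E_def by (rule integrable_walk[of "\<lambda>z. (1/4) powr dist x0 (\<phi> z x0)" 1]) (simp add: powr_le1)
    have dm: "(\<lambda>\<omega>. ennreal (dist (\<phi> (Z N \<omega>) x0) x0)) \<in> borel_measurable W"
      by (rule borel_measurable_walk) simp
    have "ennreal D \<le> (\<integral>\<^sup>+ \<omega>. ennreal (dist (\<phi> (Z N \<omega>) x0) x0) + ennreal (D * 4 powr D * E \<omega>) \<partial>W)"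
    proof -
      have "ennreal D \<le> ennreal (dist (\<phi> (Z N \<omega>) x0) x0) + ennreal (D * 4 powr D * E \<omega>)" for \<omega>
      proof -
        define d where "d = dist (\<phi> (Z N \<omega>) x0) x0"
        have d: "0 \<le> d" unfolding d_def by simp
        have E: "4 powr D * E \<omega> = 4 powr (D - d)"
          unfolding E_def d_def[symmetric] dist_commute[of x0]
          by (simp add: powr_diff powr_divide)
        have "D \<le> d + D * (4 powr D * E \<omega>)"
        proof (cases "D \<le> d")
          case False
          then have "1 \<le> 4 powr (D - d)" by (intro ge_one_powr_ge_zero) auto
          then have "D * 1 \<le> D * 4 powr (D - d)" using D by (intro mult_left_mono) auto
          then show ?thesis using d unfolding E by simp
        qed (use D E in \<open>auto intro: add_increasing2\<close>)
        then have "ennreal D \<le> ennreal (d + D * 4 powr D * E \<omega>)" by (intro ennreal_leI) (simp add: mult.assoc)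
        also have "\<dots> = ennreal d + ennreal (D * 4 powr D * E \<omega>)"
          using d D by (intro ennreal_plus) (auto simp: E_def)
        finally show ?thesis unfolding d_def .
      qed
      then have "(\<integral>\<^sup>+ \<omega>. ennreal D \<partial>W) \<le> (\<integral>\<^sup>+ \<omega>. ennreal (dist (\<phi> (Z N \<omega>) x0) x0) + ennreal (D * 4 powr D * E \<omega>) \<partial>W)"
        by (intro nn_integral_mono)
      then show ?thesis by (simp add: W.emeasure_space_1)
    qed
    also have "\<dots> = X + (\<integral>\<^sup>+ \<omega>. ennreal (D * 4 powr D * E \<omega>) \<partial>W)"
      unfolding X_def using Em dm by (intro nn_integral_add) auto
    also have "(\<integral>\<^sup>+ \<omega>. ennreal (D * 4 powr D * E \<omega>) \<partial>W) = ennreal (\<integral>\<omega>. D * 4 powr D * E \<omega> \<partial>W)"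
      using Ei D E0 by (intro nn_integral_eq_integral) auto
    also have "(\<integral>\<omega>. D * 4 powr D * E \<omega> \<partial>W) \<le> D / 2"
    proof -
      have "(\<integral>\<omega>. D * 4 powr D * E \<omega> \<partial>W) = D * (4 powr D * (\<integral>\<omega>. E \<omega> \<partial>W))" by (simp add: mult.assoc)
      also have "\<dots> \<le> D * (4 powr D * r ^ n)"
        using decay[of N] D unfolding E_def n_def by (intro mult_left_mono) auto
      also have "4 powr D * r ^ n = s ^ n" unfolding DC using r by (simp add: power_divide)
      also have "D * s ^ n \<le> D * (1 / 2)" using n1[OF n(1)] D by (intro mult_left_mono) auto
      finally show ?thesis by simp
    qed
    finally have "ennreal D \<le> X + ennreal (D / 2)" by (simp add: ennreal_leI add_left_mono)
    moreover have "ennreal D = ennreal (D / 2) + ennreal (D / 2)" using D by (simp flip: ennreal_plus)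
    ultimately have X: "ennreal (D / 2) \<le> X" by (simp add: add.commute[of X] ennreal_add_left_cancel_le)
    have N0: "0 < real N"
    proof -
      have "0 < L * (n1 + 1)" using L by simp
      then show ?thesis using N by linarith
    qed
    have "c / (4 * L) \<le> D / 2 / N"
    proof -
      have "c * real N \<le> c * (2 * (real L * real n))" using Nn c by (intro mult_left_mono) auto
      then show ?thesis unfolding D_def using N0 L by (simp add: field_simps)
    qed
    then have "ennreal (c / (4 * L)) \<le> ennreal (D / 2 / N)" by (rule ennreal_leI)
    also have "\<dots> = ennreal (D / 2) / of_nat N"
      unfolding ennreal_of_nat_eq_real_of_nat using N0 D by (intro divide_ennreal[symmetric]) auto
    also have "\<dots> \<le> X / of_nat N" using X by (rule divide_right_mono_ennreal)
    finally show ?thesis unfolding X_def .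
  qed
  have "0 < ennreal (c / (4 * L))" using c L by simp
  also have "\<dots> \<le> drift G \<phi> x0 \<mu>"
    unfolding drift_def by (rule Liminf_bounded) (use main in \<open>auto simp: eventually_sequentially\<close>)
  finally show ?thesis .
qed

end

section \<open>Covering arguments for measure preserving maps\<close>

locale measure_preserving_map = prob_space M for M +
  fixes T :: "'a \<Rightarrow> 'a"
  assumes T_measurable: "T \<in> M \<rightarrow>\<^sub>M M" and distr_T: "distr M M T = M"
begin

lemma funpow_measurable: "T ^^ i \<in> M \<rightarrow>\<^sub>M M"
proof (induction i)
  case (Suc i)
  show ?case unfolding funpow.simps by (rule measurable_comp[OF Suc.IH T_measurable])
qed (simp add: id_def)

lemma funpow_space: "x \<in> space M \<Longrightarrow> (T ^^ i) x \<in> space M"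
  using measurable_space[OF funpow_measurable] .

lemma distr_funpow: "distr M M (T ^^ i) = M"
proof (induction i)
  case 0
  then show ?case by (simp add: id_def distr_id)
next
  case (Suc i)
  have "distr M M (T \<circ> T ^^ i) = distr (distr M M (T ^^ i)) M T"
    by (rule distr_distr[OF T_measurable funpow_measurable, symmetric])
  then show ?case by (simp only: funpow.simps Suc.IH distr_T)
qed

lemma integrable_funpow:
  fixes f :: "'a \<Rightarrow> real"
  assumes "integrable M f" shows "integrable M (\<lambda>x. f ((T ^^ i) x))"
  by (rule integrable_distr[OF funpow_measurable]) (simp only: distr_funpow assms)

lemma integral_funpow:
  fixes f :: "'a \<Rightarrow> real"
  assumes "integrable M f" shows "(\<integral>x. f ((T ^^ i) x) \<partial>M) = (\<integral>x. f x \<partial>M)"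
  using integral_distr[OF funpow_measurable, of f i] assms by (simp add: distr_funpow)

text \<open>The sets of points without a suitable \<open>k\<close> up to \<open>N\<close> decrease
  to a null set, and \<open>\<bar>f\<bar>\<close> dominates. This makes a finite horizon
  \<open>N\<close> possible in the covering arguments.\<close>

lemma integral_uncovered_tendsto_0:
  fixes f :: "'a \<Rightarrow> real"
  assumes f: "integrable M f" and P: "\<And>k. Measurable.pred M (P k)"
    and AE: "AE x in M. \<exists>k\<ge>1. P k x"
  shows "(\<lambda>N. \<integral>x. indicat_real {x \<in> space M. \<forall>k\<in>{1..N}. \<not> P k x} x * f x \<partial>M) \<longlonglongrightarrow> 0"
proof -
  have "(\<lambda>N. \<integral>x. indicat_real {x \<in> space M. \<forall>k\<in>{1..N}. \<not> P k x} x * f x \<partial>M) \<longlonglongrightarrow> (\<integral>x. 0 \<partial>M)"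
  proof (rule integral_dominated_convergence[where w = "\<lambda>x. \<bar>f x\<bar>"])
    have [measurable]: "Measurable.pred M (P k)" for k by (rule P)
    have [measurable]: "f \<in> borel_measurable M" using f by simp
    show "(\<lambda>x. indicat_real {x \<in> space M. \<forall>k\<in>{1..N}. \<not> P k x} x * f x) \<in> borel_measurable M" for N
      by measurable
    show "AE x in M. (\<lambda>N. indicat_real {x \<in> space M. \<forall>k\<in>{1..N}. \<not> P k x} x * f x) \<longlonglongrightarrow> 0"
      using AE
    proof eventually_elim
      case (elim x)
      then obtain k where k: "1 \<le> k" "P k x" by blast
      have "eventually (\<lambda>N. indicat_real {x \<in> space M. \<forall>k\<in>{1..N}. \<not> P k x} x * f x = 0) sequentially"
        using eventually_ge_at_top[of k] by eventually_elim (use k in \<open>auto simp: indicator_def\<close>)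
      then show ?case by (rule tendsto_eventually)
    qed
  qed (use f in \<open>auto simp: indicator_def\<close>)
  then show ?thesis by simp
qed

text \<open>Katznelson and Weiss: from a point where some \<open>a k < c k\<close> with \<open>k \<le> N\<close> holds, jump \<open>k\<close> steps ahead;
  otherwise pay \<open>a 1\<close> for a single step. The unlucky points contribute little.\<close>

lemma subadditive_integral_le:
  fixes a :: "nat \<Rightarrow> 'a \<Rightarrow> real"
  assumes int: "\<And>n. integrable M (a n)"
    and nn: "\<And>n x. 0 \<le> a n x" and a0: "\<And>x. x \<in> space M \<Longrightarrow> a 0 x = 0"
    and sub: "\<And>n m x. x \<in> space M \<Longrightarrow> a (n + m) x \<le> a n x + a m ((T ^^ n) x)"
    and AE: "AE x in M. \<exists>k\<ge>1. a k x < c * real k" and c: "0 \<le> c" and \<epsilon>: "0 < \<epsilon>"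
  shows "eventually (\<lambda>n. (\<integral>x. a n x \<partial>M) \<le> (c + \<epsilon>) * real n) sequentially"
proof -
  have [measurable]: "a n \<in> borel_measurable M" for n using int by simp
  define B where "B N = {x \<in> space M. \<forall>k\<in>{1..N}. \<not> a k x < c * real k}" for N
  have [measurable]: "B N \<in> sets M" for N unfolding B_def by measurable
  have "(\<lambda>N. \<integral>x. indicat_real (B N) x * a 1 x \<partial>M) \<longlonglongrightarrow> 0"
    unfolding B_def by (rule integral_uncovered_tendsto_0[OF int _ AE]) measurable
  then have "eventually (\<lambda>N. (\<integral>x. indicat_real (B N) x * a 1 x \<partial>M) < \<epsilon> / 2) sequentially"
    by (rule order_tendstoD) (use \<epsilon> in simp)
  then obtain N where N: "(\<integral>x. indicat_real (B N) x * a 1 x \<partial>M) < \<epsilon> / 2"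
    unfolding eventually_sequentially by blast
  define b where "b x = indicat_real (B N) x * a 1 x" for x
  have b0: "0 \<le> b x" for x unfolding b_def using nn by simp
  have bi: "integrable M b" unfolding b_def
    by (rule Bochner_Integration.integrable_bound[OF int[of 1]]) (auto simp: indicator_def)
  \<comment> \<open>The last sum pays for the final steps, at most \<open>N\<close> in number, where
    a jump might overshoot \<open>n\<close>.\<close>
  have pw: "a n x \<le> c * n + (\<Sum>i=0..<n. b ((T ^^ i) x)) + (\<Sum>i=n-N..<n. a 1 ((T ^^ i) x))"
    if "x \<in> space M" for n x
    using that
  proof (induction n arbitrary: x rule: less_induct)
    case (less n)
    have jump: "a n x \<le> a k x + c * (real n - real k) + (\<Sum>i=k..<n. b ((T ^^ i) x)) + (\<Sum>i=n-N..<n. a 1 ((T ^^ i) x))"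
      if k: "1 \<le> k" "k \<le> n" "k \<le> N" "N < n" for k
    proof -
      have "a n x \<le> a k x + a (n - k) ((T ^^ k) x)" using sub[OF less.prems, of k "n - k"] k by simp
      also have "a (n - k) ((T ^^ k) x) \<le> c * real (n - k) + (\<Sum>i=0..<n-k. b ((T ^^ i) ((T ^^ k) x)))
          + (\<Sum>i=n-k-N..<n-k. a 1 ((T ^^ i) ((T ^^ k) x)))"
        by (rule less.IH) (use k less.prems funpow_space in auto)
      also have "(\<Sum>i=0..<n-k. b ((T ^^ i) ((T ^^ k) x))) = (\<Sum>i=k..<n. b ((T ^^ i) x))"
        using sum.shift_bounds_nat_ivl[of "\<lambda>i. b ((T ^^ i) x)" 0 k "n - k"] k by (simp add: funpow_add)
      also have "(\<Sum>i=n-k-N..<n-k. a 1 ((T ^^ i) ((T ^^ k) x))) = (\<Sum>i=n-k-N+k..<n. a 1 ((T ^^ i) x))"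
        using sum.shift_bounds_nat_ivl[of "\<lambda>i. a 1 ((T ^^ i) x)" "n - k - N" k "n - k"] k
        by (simp add: funpow_add)
      \<comment> \<open>With truncated subtraction, \<open>n - k - N + k\<close> is at least
        \<open>n - N\<close>, so the tail after the jump is part of the tail for
        \<open>n\<close>.\<close>
      also have "\<dots> \<le> (\<Sum>i=n-N..<n. a 1 ((T ^^ i) x))"
        by (rule sum_mono2) (use nn in auto)
      finally show ?thesis using k by (simp add: of_nat_diff)
    qed
    show ?case
    proof (cases "n \<le> N")
      case True
      have "a n x \<le> (\<Sum>i=0..<n. a 1 ((T ^^ i) x))"
      proof (induction n)
        case (Suc n)
        then show ?case using sub[OF less.prems, of n 1] by simp
      qed (simp add: a0 less.prems)
      moreover have "0 \<le> (\<Sum>i=0..<n. b ((T ^^ i) x))" by (intro sum_nonneg b0)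
      moreover have "0 \<le> c * n" using c by simp
      ultimately show ?thesis using True by simp
    next
      case False
      then have n: "N < n" by simp
      show ?thesis
      proof (cases "x \<in> B N")
        case True
        show ?thesis
        \<comment> \<open>A jump of length 1 needs \<open>1 \<le> N\<close>. For
          \<open>N = 0\<close> the set \<open>B 0\<close> is the whole space and every step is paid
          for by \<open>b\<close>.\<close>
        proof (cases "N = 0")
          case True
          have "a n x \<le> (\<Sum>i=0..<n. a 1 ((T ^^ i) x))"
          proof (induction n)
            case (Suc n)
            then show ?case using sub[OF less.prems, of n 1] by simp
          qed (simp add: a0 less.prems)
          also have "\<dots> = (\<Sum>i=0..<n. b ((T ^^ i) x))"
            unfolding b_def B_def using True less.prems funpow_space by (intro sum.cong) auto
          finally show ?thesis using True c by (simp add: add_increasing)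
        next
          case N0: False
          have "a 1 x = b x" unfolding b_def using True by simp
          moreover have "(\<Sum>i=0..<n. b ((T ^^ i) x)) = b x + (\<Sum>i=1..<n. b ((T ^^ i) x))"
            using sum.atLeast_Suc_lessThan[of 0 n "\<lambda>i. b ((T ^^ i) x)"] n by simp
          ultimately show ?thesis using jump[of 1] n N0 c by (simp add: algebra_simps)
        qed
      next
        case False
        then obtain k where k: "k \<in> {1..N}" "a k x < c * real k"
          unfolding B_def using less.prems by auto
        have "(\<Sum>i=k..<n. b ((T ^^ i) x)) \<le> (\<Sum>i=0..<n. b ((T ^^ i) x))"
          by (rule sum_mono2) (use b0 in auto)
        then show ?thesis using jump[of k] k n by (simp add: algebra_simps)
      qed
    qed
  qed
  define E where "E = (\<integral>x. a 1 x \<partial>M)"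
  have E: "0 \<le> E" unfolding E_def using nn by (intro integral_nonneg_AE) auto
  have le: "(\<integral>x. a n x \<partial>M) \<le> c * n + n * (\<epsilon> / 2) + N * E" for n
  proof -
    have "(\<integral>x. a n x \<partial>M) \<le>
        (\<integral>x. c * n + (\<Sum>i=0..<n. b ((T ^^ i) x)) + (\<Sum>i=n-N..<n. a 1 ((T ^^ i) x)) \<partial>M)"
      using pw by (intro integral_mono int)
        (auto intro!: Bochner_Integration.integrable_add Bochner_Integration.integrable_sum integrable_funpow bi int)
    also have "\<dots> = c * n + (\<Sum>i=0..<n. \<integral>x. b x \<partial>M) + (\<Sum>i=n-N..<n. E)"
      unfolding E_def
      by (simp add: Bochner_Integration.integral_add Bochner_Integration.integral_sum integrable_funpow
          integral_funpow bi int prob_space)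
    also have "(\<Sum>i=0..<n. \<integral>x. b x \<partial>M) \<le> (\<Sum>i=0..<n. \<epsilon> / 2)"
      using N unfolding b_def[symmetric] by (intro sum_mono) auto
    also have "(\<Sum>i=n-N..<n. E) \<le> real N * E"
      using E by (simp add: mult_right_mono)
    finally show ?thesis by simp
  qed
  obtain n0 :: nat where n0: "N * E < n0 * (\<epsilon> / 2)" using reals_Archimedean3[of "\<epsilon> / 2"] \<epsilon> by auto
  show ?thesis unfolding eventually_sequentially
  proof (intro exI allI impI)
    fix n assume n: "n0 \<le> n"
    then have "n0 * (\<epsilon> / 2) \<le> n * (\<epsilon> / 2)" using \<epsilon> by (intro mult_right_mono) auto
    then show "(\<integral>x. a n x \<partial>M) \<le> (c + \<epsilon>) * real n" using le[of n] n0 by (simp add: algebra_simps)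
  qed
qed

text \<open>The mirror image of the preceding covering: jump \<open>k\<close> steps where the sum of
  length \<open>k\<close> reaches \<open>c * k\<close>, and elsewhere credit \<open>c\<close> for a
  single step through \<open>b\<close>. The term \<open>c * N\<close> covers the incomplete end.
  This supplies the upper half of a law of large numbers.\<close>

lemma birkhoff_sum_integral_ge:
  fixes X :: "'a \<Rightarrow> real"
  assumes int: "integrable M X" and nn: "\<And>x. 0 \<le> X x" and c: "0 \<le> c"
    and AE: "AE x in M. \<exists>k\<ge>1. c * real k \<le> (\<Sum>i=0..<k. X ((T ^^ i) x))"
  shows "c \<le> (\<integral>x. X x \<partial>M)"
proof -
  have [measurable]: "X \<in> borel_measurable M" using int by simp
  have [measurable]: "(\<lambda>x. X ((T ^^ i) x)) \<in> borel_measurable M" for i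
    using measurable_compose[OF funpow_measurable, of X borel i] by simp
  define B where "B N = {x \<in> space M. \<forall>k\<in>{1..N}. \<not> c * real k \<le> (\<Sum>i=0..<k. X ((T ^^ i) x))}" for N
  have [measurable]: "B N \<in> sets M" for N unfolding B_def by measurable
  have lim: "(\<lambda>N. \<integral>x. indicat_real (B N) x * c \<partial>M) \<longlonglongrightarrow> 0"
    unfolding B_def by (rule integral_uncovered_tendsto_0[OF _ _ AE]) (simp, measurable)
  have main: "c \<le> (\<integral>x. X x \<partial>M) + (\<integral>x. indicat_real (B N) x * c \<partial>M)" for N
  proof -
    define b where "b x = indicat_real (B N) x * c" for x
    have b0: "0 \<le> b x" for x unfolding b_def using c by simp
    have bi: "integrable M b" unfolding b_def
      by (rule integrable_const_bound[of _ c]) (use c in \<open>auto simp: indicator_def\<close>)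
    have pw: "c * n \<le> (\<Sum>i=0..<n. X ((T ^^ i) x)) + (\<Sum>i=0..<n. b ((T ^^ i) x)) + c * N"
      if "x \<in> space M" for n x
      using that
    proof (induction n arbitrary: x rule: less_induct)
      case (less n)
      have jump: "c * (real n - real k) \<le> (\<Sum>i=k..<n. X ((T ^^ i) x)) + (\<Sum>i=k..<n. b ((T ^^ i) x)) + c * N"
        if k: "1 \<le> k" "k \<le> n" for k
      proof -
        have s: "(\<Sum>i=0..<n-k. f ((T ^^ i) ((T ^^ k) x))) = (\<Sum>i=k..<n. f ((T ^^ i) x))" for f :: "'a \<Rightarrow> real"
          using sum.shift_bounds_nat_ivl[of "\<lambda>i. f ((T ^^ i) x)" 0 k "n - k"] k by (simp add: funpow_add)
        show ?thesis
          using less.IH[of "n - k" "(T ^^ k) x"] k less.prems funpow_space unfolding s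
          by (simp add: of_nat_diff)
      qed
      have split: "(\<Sum>i=0..<n. f ((T ^^ i) x)) = (\<Sum>i=0..<k. f ((T ^^ i) x)) + (\<Sum>i=k..<n. f ((T ^^ i) x))"
        if "k \<le> n" for k and f :: "'a \<Rightarrow> real"
        by (rule sum.atLeastLessThan_concat[symmetric]) (use that in auto)
      have nonneg: "0 \<le> (\<Sum>i=0..<k. b ((T ^^ i) x))" "0 \<le> (\<Sum>i=0..<k. X ((T ^^ i) x))" for k
        by (intro sum_nonneg b0 nn)+
      show ?case
      proof (cases "n \<le> N")
        case True
        then have "c * n \<le> c * N" using c by (intro mult_left_mono) auto
        then show ?thesis using nonneg[of n] by linarith
      next
        case n: False
        show ?thesis
        proof (cases "x \<in> B N")
          case True
          have "b x = c" unfolding b_def using True by simp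
          then have "c \<le> (\<Sum>i=0..<1. b ((T ^^ i) x))" by simp
          then show ?thesis using jump[of 1] split[of 1 b] split[of 1 X] nonneg(2)[of 1] n
            by (simp add: algebra_simps)
        next
          case False
          then obtain k where k: "k \<in> {1..N}" "c * real k \<le> (\<Sum>i=0..<k. X ((T ^^ i) x))"
            unfolding B_def using less.prems by auto
          have kn: "1 \<le> k" "k \<le> n" using k n by auto
          show ?thesis using jump[OF kn] split[OF kn(2), of b] split[OF kn(2), of X] nonneg(1)[of k] k(2)
            by (simp add: algebra_simps)
        qed
      qed
    qed
    \<comment> \<open>The end term does not grow with \<open>n\<close>, so a positive
      \<open>e\<close> would be contradicted by large \<open>n\<close>.\<close>
    define e where "e = c - ((\<integral>x. X x \<partial>M) + (\<integral>x. b x \<partial>M))"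
    have le: "real n * e \<le> c * N" for n :: nat
    proof -
      have "(\<integral>x. c * n \<partial>M) \<le> (\<integral>x. (\<Sum>i=0..<n. X ((T ^^ i) x)) + (\<Sum>i=0..<n. b ((T ^^ i) x)) + c * N \<partial>M)"
        using pw by (intro integral_mono)
          (auto intro!: Bochner_Integration.integrable_add Bochner_Integration.integrable_sum integrable_funpow bi int)
      also have "\<dots> = n * (\<integral>x. X x \<partial>M) + n * (\<integral>x. b x \<partial>M) + c * N"
        by (simp add: Bochner_Integration.integral_add Bochner_Integration.integral_sum integrable_funpow
            integral_funpow bi int prob_space)
      finally show ?thesis unfolding e_def by (simp add: prob_space algebra_simps)
    qed
    have "e \<le> 0"
    proof (rule ccontr)
      assume "\<not> e \<le> 0"
      then obtain n :: nat where "c * N < n * e" using reals_Archimedean3[of e] by auto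
      then show False using le[of n] by simp
    qed
    then show ?thesis unfolding e_def b_def by simp
  qed
  have "(\<lambda>N. (\<integral>x. X x \<partial>M) + (\<integral>x. indicat_real (B N) x * c \<partial>M)) \<longlonglongrightarrow> (\<integral>x. X x \<partial>M) + 0"
    by (intro tendsto_add tendsto_const lim)
  then show ?thesis by (intro LIMSEQ_le_const[where X = "\<lambda>N. (\<integral>x. X x \<partial>M) + (\<integral>x. indicat_real (B N) x * c \<partial>M)"])
      (use main in auto)
qed

end

section \<open>Almost sure convergence\<close>

text \<open>This says \<open>limsup x j / j > c\<close>, in a form that makes invariance under shifts elementary.\<close>

definition linearly_exceeds :: "real \<Rightarrow> (nat \<Rightarrow> real) \<Rightarrow> bool" where
  "linearly_exceeds c x \<longleftrightarrow> (\<exists>n::nat. \<forall>N. \<exists>j\<ge>N. (c + 1 / (real n + 1)) * real j \<le> x j)"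

lemma linearly_exceedsI:
  assumes "c < c'" "\<And>N. \<exists>j\<ge>N. c' * real j \<le> x j" shows "linearly_exceeds c x"
proof -
  obtain n :: nat where "inverse (real (Suc n)) < c' - c" using reals_Archimedean[of "c' - c"] assms(1) by auto
  then have n: "c + 1 / (real n + 1) \<le> c'" by (simp add: inverse_eq_divide add.commute)
  have "\<exists>j\<ge>N. (c + 1 / (real n + 1)) * real j \<le> x j" for N
    using assms(2)[of N] mult_right_mono[OF n] by (meson of_nat_0_le_iff order_trans)
  then show ?thesis unfolding linearly_exceeds_def by blast
qed

text \<open>The perturbation and the shift of the index change the comparison by a bounded amount,
  which half of the linear surplus \<delta> j absorbs for large \<open>j\<close>.\<close>

lemma linearly_exceeds_shift:
  assumes D: "\<And>j. \<bar>x (Suc j) - y j\<bar> \<le> D"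
  shows "linearly_exceeds c x \<longleftrightarrow> linearly_exceeds c y"
proof -
  have arith1: "u \<le> v" if "m \<le> i" "w = u + i / 2 + t" "w - D \<le> v" "2 * (D + \<bar>t\<bar>) < m"
    for u v w m i t :: real using that abs_ge_minus_self[of t] by argo
  have arith2: "u \<le> v" if "m \<le> i" "u = w - i / 2 + (t - d / 2)" "w - D \<le> v" "2 * (D + \<bar>t\<bar>) < m" "0 < d"
    for u v w m i t d :: real using that abs_ge_self[of t] by argo
  show ?thesis
  proof
    assume "linearly_exceeds c x"
    then obtain \<delta> where \<delta>: "0 < \<delta>" and *: "\<And>N. \<exists>j\<ge>N. (c + \<delta>) * real j \<le> x j"
      unfolding linearly_exceeds_def by (metis add_nonneg_pos of_nat_0_le_iff zero_less_one divide_pos_pos)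
    show "linearly_exceeds c y"
    proof (rule linearly_exceedsI[of c "c + \<delta> / 2"])
      fix N
      obtain M :: nat where M: "2 * (D + \<bar>c + \<delta>\<bar>) < M * \<delta>" using reals_Archimedean3[OF \<delta>] by blast
      obtain i where i: "Suc (max N M) \<le> i" "(c + \<delta>) * real i \<le> x i" using * by blast
      then obtain j where j: "i = Suc j" "N \<le> j" "M \<le> j" by (cases i) auto
      have "M * \<delta> \<le> j * \<delta>" using j \<delta> by (intro mult_right_mono) auto
      moreover have "(c + \<delta>) * real (Suc j) = (c + \<delta> / 2) * real j + j * \<delta> / 2 + (c + \<delta>)"
        by (simp add: algebra_simps)
      moreover have "(c + \<delta>) * real (Suc j) - D \<le> y j" using i(2) D[of j] unfolding j(1) by linarith
      ultimately have "(c + \<delta> / 2) * real j \<le> y j" using M by (rule arith1)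
      then show "\<exists>j\<ge>N. (c + \<delta> / 2) * real j \<le> y j" using j by blast
    qed (use \<delta> in simp)
  next
    assume "linearly_exceeds c y"
    then obtain \<delta> where \<delta>: "0 < \<delta>" and *: "\<And>N. \<exists>j\<ge>N. (c + \<delta>) * real j \<le> y j"
      unfolding linearly_exceeds_def by (metis add_nonneg_pos of_nat_0_le_iff zero_less_one divide_pos_pos)
    show "linearly_exceeds c x"
    proof (rule linearly_exceedsI[of c "c + \<delta> / 2"])
      fix N
      obtain M :: nat where M: "2 * (D + \<bar>c + \<delta>\<bar>) < M * \<delta>" using reals_Archimedean3[OF \<delta>] by blast
      obtain j where j: "max N M \<le> j" "(c + \<delta>) * real j \<le> y j" using * by blast
      have "M * \<delta> \<le> j * \<delta>" using j \<delta> by (intro mult_right_mono) auto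
      moreover have "(c + \<delta> / 2) * real (Suc j) = (c + \<delta>) * real j - j * \<delta> / 2 + (c + \<delta> - \<delta> / 2)"
        by (simp add: algebra_simps)
      moreover have "(c + \<delta>) * real j - D \<le> x (Suc j)" using j(2) D[of j] by linarith
      ultimately have 1: "(c + \<delta> / 2) * real (Suc j) \<le> x (Suc j)" using M \<delta> by (rule arith2)
      have "N \<le> Suc j" using j by simp
      then show "\<exists>j\<ge>N. (c + \<delta> / 2) * real j \<le> x j" using 1 by blast
    qed (use \<delta> in simp)
  qed
qed

lemma not_linearly_exceeds_eventually:
  assumes "\<not> linearly_exceeds c x" "c < c'"
  shows "eventually (\<lambda>j. x j < c' * real j) sequentially"
  using linearly_exceedsI[OF assms(2), of x] assms(1)
  unfolding eventually_sequentially by (metis not_le)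

lemma linearly_exceeds_point:
  assumes "linearly_exceeds c x" obtains j where "1 \<le> j" "c * real j < x j"
proof -
  obtain n j where j: "1 \<le> j" "(c + 1 / (real n + 1)) * real j \<le> x j"
    using assms unfolding linearly_exceeds_def by blast
  have "c * real j < (c + 1 / (real n + 1)) * real j" using j(1) by (intro mult_strict_right_mono) auto
  then show ?thesis using that[of j] j by linarith
qed

lemma measurable_linearly_exceeds:
  assumes [measurable]: "\<And>j. (\<lambda>\<omega>. x j \<omega>) \<in> borel_measurable M"
  shows "Measurable.pred M (\<lambda>\<omega>. linearly_exceeds c (\<lambda>j. x j \<omega>))"
  unfolding linearly_exceeds_def by measurable

section \<open>A zero-one law for shift-invariant events\<close>

context random_walk begin

lemma funpow_drop_seq: "drop_seq k ^^ n = drop_seq (n * k)"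
proof (induction n)
  case (Suc n)
  show ?case unfolding funpow.simps Suc.IH by (simp add: fun_eq_iff drop_seq_drop_seq)
qed (simp add: fun_eq_iff)

sublocale shift: measure_preserving_map W "drop_seq k" for k
  by unfold_locales (rule measurable_drop_seq distr_drop_seq)+

lemma indep_increments: "W.indep_vars (\<lambda>_. \<mu>) (\<lambda>i \<omega>. \<omega> i) (UNIV :: nat set)"
proof (subst W.indep_vars_iff_distr_eq_PiM)
  have "distr W (\<Pi>\<^sub>M i\<in>UNIV. \<mu>) (\<lambda>x. \<lambda>i\<in>UNIV. x i) = W"
    unfolding W_eq by (simp add: restrict_UNIV distr_id[unfolded id_def])
  moreover have "distr W \<mu> (\<lambda>\<omega>. \<omega> i) = \<mu>" for i
    unfolding W_eq using seq.PiM_component[of i] by simp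
  ultimately show "distr W (\<Pi>\<^sub>M i\<in>UNIV. \<mu>) (\<lambda>x. \<lambda>i\<in>UNIV. x i) = (\<Pi>\<^sub>M i\<in>UNIV. distr W \<mu> (\<lambda>\<omega>. \<omega> i))"
    by (simp add: W_eq)
qed (use measurable_increment in auto)

lemma shift_invariant_zero_one:
  assumes A: "A \<in> sets W" and k: "1 \<le> k"
    and inv: "\<And>\<omega>. \<omega> \<in> space W \<Longrightarrow> drop_seq k \<omega> \<in> A \<longleftrightarrow> \<omega> \<in> A"
  shows "W.prob A = 0 \<or> W.prob A = 1"
proof -
  define F where "F i = {(\<lambda>\<omega>. \<omega> i) -` B \<inter> space W | B. B \<in> sets \<mu>}" for i :: nat
  have F: "F i = sets (vimage_algebra (space W) (\<lambda>\<omega>. \<omega> i) \<mu>)" for i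
    unfolding F_def by (subst sets_vimage_algebra2) (auto simp: space_W space_\<mu>)
  show ?thesis
  proof (rule W.kolmogorov_0_1_law[of F])
    show "sigma_algebra (space W) (F i)" for i
      unfolding F using sets.sigma_algebra_axioms[of "vimage_algebra (space W) (\<lambda>\<omega>. \<omega> i) \<mu>"] by simp
    show "W.indep_sets F UNIV"
      using indep_increments unfolding W.indep_vars_def2 F_def by simp
    show "A \<in> W.tail_events F"
      unfolding W.tail_events_def
    proof (rule INT_I)
      fix n :: nat
      define \<Sigma> where "\<Sigma> = sigma (space W) (\<Union> (F ` {n..}))"
      have sub: "\<Union> (F ` {n..}) \<subseteq> Pow (space W)" unfolding F_def by auto
      have space: "space \<Sigma> = space W" unfolding \<Sigma>_def using sub by (rule space_measure_of)
      have sets: "sets \<Sigma> = sigma_sets (space W) (\<Union> (F ` {n..}))"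
        unfolding \<Sigma>_def using sub by (rule sets_measure_of)
      have "drop_seq (n * k) \<in> \<Sigma> \<rightarrow>\<^sub>M W"
        unfolding W_eq
      proof (rule measurable_PiM_single')
        fix i :: nat
        show "(\<lambda>\<omega>. drop_seq (n * k) \<omega> i) \<in> \<Sigma> \<rightarrow>\<^sub>M \<mu>"
        proof (rule measurableI)
          fix B assume "B \<in> sets \<mu>"
          moreover have "n \<le> i + n * k" using k by (simp add: trans_le_add2)
          ultimately have "(\<lambda>\<omega>. \<omega> (i + n * k)) -` B \<inter> space W \<in> \<Union> (F ` {n..})"
            unfolding F_def by blast
          then show "(\<lambda>\<omega>. drop_seq (n * k) \<omega> i) -` B \<inter> space \<Sigma> \<in> sets \<Sigma>"
            unfolding sets space drop_seq_def by (rule sigma_sets.Basic)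
        qed (auto simp: space space_W space_\<mu> drop_seq_def)
      qed (auto simp: space space_W space_\<mu> drop_seq_def)
      from measurable_sets[OF this A] have "drop_seq (n * k) -` A \<inter> space W \<in> sets \<Sigma>" unfolding space .
      moreover have "drop_seq (n * k) -` A \<inter> space W = A"
      proof -
        have "\<omega> \<in> space W \<Longrightarrow> drop_seq (n * k) \<omega> \<in> A \<longleftrightarrow> \<omega> \<in> A" for \<omega>
        proof (induction n)
          case (Suc n)
          have "drop_seq (Suc n * k) \<omega> = drop_seq k (drop_seq (n * k) \<omega>)" by (simp add: drop_seq_drop_seq)
          then show ?case using Suc inv[OF drop_seq_space[OF Suc.prems], of "n * k"] by simp
        qed simp
        then show ?thesis using sets.sets_into_space[OF A] by auto
      qed
      ultimately show "A \<in> sigma_sets (space W) (\<Union> (F ` {n..}))" unfolding sets by simp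
    qed
  qed
qed

end

section \<open>Upper and lower linear growth of the displacement\<close>

context random_walk_action begin

definition displacement :: "nat \<Rightarrow> (nat \<Rightarrow> 'a) \<Rightarrow> real" where
  "displacement n \<omega> = dist (\<phi> (Z n \<omega>) x0) x0"

lemma displacement_measurable: "displacement n \<in> borel_measurable W"
  unfolding displacement_def[abs_def] by (rule borel_measurable_walk) simp

lemma displacement_nonneg: "0 \<le> displacement n \<omega>"
  by (simp add: displacement_def)

lemma displacement_add:
  assumes "\<omega> \<in> space W"
  shows "displacement (n + m) \<omega> \<le> displacement n \<omega> + displacement m (drop_seq n \<omega>)"
    and "displacement m (drop_seq n \<omega>) \<le> displacement n \<omega> + displacement (n + m) \<omega>"
proof -
  have c: "Z n \<omega> \<in> carrier G" "Z m (drop_seq n \<omega>) \<in> carrier G"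
    using assms walk_closed drop_seq_space by auto
  have "displacement m (drop_seq n \<omega>) = dist (\<phi> (Z (n + m) \<omega>) x0) (\<phi> (Z n \<omega>) x0)"
    unfolding displacement_def walk_add[OF assms] using c by (simp add: act_mult)
  then show "displacement (n + m) \<omega> \<le> displacement n \<omega> + displacement m (drop_seq n \<omega>)"
    "displacement m (drop_seq n \<omega>) \<le> displacement n \<omega> + displacement (n + m) \<omega>"
    unfolding displacement_def
    using dist_triangle[of "\<phi> (Z (n + m) \<omega>) x0" x0 "\<phi> (Z n \<omega>) x0"]
      dist_triangle2[of "\<phi> (Z (n + m) \<omega>) x0" "\<phi> (Z n \<omega>) x0" x0] by (auto simp: dist_commute)
qed

lemma integrable_displacement:
  assumes "finite_first_moment \<phi> x0 \<mu>" shows "integrable W (displacement n)"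
proof -
  have "(\<integral>\<^sup>+ \<omega>. ennreal (displacement 1 \<omega>) \<partial>W) = (\<integral>\<^sup>+ \<omega>. ennreal (dist (\<phi> (\<omega> 0) x0) x0) \<partial>W)"
    unfolding displacement_def
    by (intro nn_integral_cong) (simp add: walk_one del: One_nat_def)
  also have "\<dots> = (\<integral>\<^sup>+ g. ennreal (dist (\<phi> g x0) x0) \<partial>distr W \<mu> (\<lambda>\<omega>. \<omega> 0))"
    by (rule nn_integral_distr[symmetric, OF measurable_increment]) (simp add: measurable_from_\<mu>)
  also have "distr W \<mu> (\<lambda>\<omega>. \<omega> 0) = \<mu>"
    unfolding W_eq using seq.PiM_component[of 0] by simp
  finally have 1: "integrable W (displacement 1)"
    using assms displacement_measurable unfolding finite_first_moment_def
    by (intro integrableI_bounded) (auto simp: displacement_nonneg)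
  show ?thesis
  proof (induction n)
    case 0
    then show ?case by (simp add: displacement_def[abs_def])
  next
    case (Suc n)
    have "integrable W (\<lambda>\<omega>. displacement n \<omega> + displacement 1 (drop_seq n \<omega>))"
      using shift.integrable_funpow[OF 1, of 1 n] Suc.IH by auto
    then show ?case
      by (rule Bochner_Integration.integrable_bound)
        (use displacement_add(1)[of _ n 1] displacement_measurable displacement_nonneg in auto)
  qed
qed

text \<open>The event that the lower limit of \<open>displacement j / j\<close> is below
  \<open>c\<close>, written as an upper limit of the negatives, has probability 0 or 1. Probability
  1 would feed the covering argument and push the means below the drift.\<close>

lemma displacement_eventually_ge:
  assumes fm: "finite_first_moment \<phi> x0 \<mu>"
    and c: "ennreal c < drift G \<phi> x0 \<mu>" "c' < c"
  shows "AE \<omega> in W. eventually (\<lambda>n. c' * real n < displacement n \<omega>) sequentially"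
proof (cases "0 \<le> c")
  case False
  have "eventually (\<lambda>n. c' * real n < displacement n \<omega>) sequentially" for \<omega>
    using eventually_gt_at_top[of 0]
    by eventually_elim (use False c(2) displacement_nonneg in \<open>metis less_le_not_le linorder_not_le
        mult_neg_pos of_nat_0_less_iff order.strict_trans2 order.strict_trans\<close>)
  then show ?thesis by simp
next
  case True
  define A where "A = {\<omega> \<in> space W. linearly_exceeds (- c) (\<lambda>j. - displacement j \<omega>)}"
  have [measurable]: "displacement j \<in> borel_measurable W" for j by (rule displacement_measurable)
  have A: "A \<in> sets W" unfolding A_def
    by (rule predE, rule measurable_linearly_exceeds) measurable
  have "drop_seq 1 \<omega> \<in> A \<longleftrightarrow> \<omega> \<in> A" if \<omega>: "\<omega> \<in> space W" for \<omega>
  proof -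
    have "linearly_exceeds (- c) (\<lambda>j. - displacement j \<omega>)
        \<longleftrightarrow> linearly_exceeds (- c) (\<lambda>j. - displacement j (drop_seq 1 \<omega>))"
    proof (rule linearly_exceeds_shift)
      show "\<bar>- displacement (Suc j) \<omega> - - displacement j (drop_seq 1 \<omega>)\<bar> \<le> displacement 1 \<omega>" for j
        using displacement_add[OF \<omega>, where n = 1 and m = j] by auto
    qed
    then show ?thesis unfolding A_def using \<omega> drop_seq_space[OF \<omega>] by simp
  qed
  from shift_invariant_zero_one[OF A _ this] have "W.prob A = 0 \<or> W.prob A = 1" by simp
  moreover have "W.prob A \<noteq> 1"
  proof
    assume "W.prob A = 1"
    then have "AE \<omega> in W. \<omega> \<in> A" using W.AE_prob_1 by blast
    then have AE: "AE \<omega> in W. \<exists>k\<ge>1. displacement k \<omega> < c * real k"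
    proof eventually_elim
      case (elim \<omega>)
      then show ?case unfolding A_def
        by (auto elim!: linearly_exceeds_point)
    qed
    \<comment> \<open>A real value strictly between \<open>c\<close> and the drift; the difference
      \<open>e - c\<close> is the tolerance granted to the covering argument.\<close>
    obtain e where e: "0 \<le> e" "c < e" "ennreal e < drift G \<phi> x0 \<mu>"
    proof -
      obtain z where "ennreal c < z" "z < drift G \<phi> x0 \<mu>" using dense[OF c(1)] by blast
      then show ?thesis using that[of "enn2real z"] True
        by (metis enn2real_nonneg ennreal_enn2real ennreal_less_iff order.strict_trans2 top_greatest)
    qed
    have "eventually (\<lambda>n. (\<integral>\<omega>. displacement n \<omega> \<partial>W) \<le> (c + (e - c)) * real n) sequentially"
    proof (rule shift.subadditive_integral_le[where k = 1, OF integrable_displacement[OF fm] displacement_nonneg _ _ AE True])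
      show "displacement 0 \<omega> = 0" for \<omega> by (simp add: displacement_def)
      show "displacement (n + m) \<omega> \<le> displacement n \<omega> + displacement m ((drop_seq 1 ^^ n) \<omega>)"
        if "\<omega> \<in> space W" for n m \<omega>
        using displacement_add(1)[OF that] by (simp add: funpow_drop_seq)
    qed (use e in auto)
    then have "eventually (\<lambda>n. (\<integral>\<^sup>+ \<omega>. ennreal (dist (\<phi> (Z n \<omega>) x0) x0) \<partial>W) / of_nat n \<le> ennreal e) sequentially"
      using eventually_gt_at_top[of 0]
    proof eventually_elim
      case (elim n)
      have "(\<integral>\<^sup>+ \<omega>. ennreal (dist (\<phi> (Z n \<omega>) x0) x0) \<partial>W) = ennreal (\<integral>\<omega>. displacement n \<omega> \<partial>W)"
        unfolding displacement_def[symmetric]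
        by (rule nn_integral_eq_integral) (auto simp: integrable_displacement[OF fm] displacement_nonneg)
      also have "\<dots> / of_nat n = ennreal ((\<integral>\<omega>. displacement n \<omega> \<partial>W) / real n)"
        unfolding ennreal_of_nat_eq_real_of_nat
        by (rule divide_ennreal) (use elim in \<open>auto intro!: integral_nonneg_AE simp: displacement_nonneg\<close>)
      also have "\<dots> \<le> ennreal e" using elim by (intro ennreal_leI) (simp add: field_simps)
      finally show ?case .
    qed
    then have "drift G \<phi> x0 \<mu> \<le> limsup (\<lambda>n. ennreal e)"
      unfolding drift_def
      by (intro order.trans[OF Liminf_le_Limsup Limsup_mono]) auto
    then show False using e(3) by (simp add: Limsup_const)
  qed
  ultimately have "AE \<omega> in W. \<omega> \<notin> A"
    using A by (simp add: W.prob_eq_0)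
  then show ?thesis
    using AE_space
  proof eventually_elim
    case (elim \<omega>)
    then have "\<not> linearly_exceeds (- c) (\<lambda>j. - displacement j \<omega>)" unfolding A_def by simp
    from not_linearly_exceeds_eventually[OF this, of "- c'"] c(2) show ?case by simp
  qed
qed

text \<open>The time is split as n = r + j k with the remainder at the start. For a fixed trajectory
  the remainder then contributes one of only \<open>k\<close> numbers, whereas at the end it would
  vary with \<open>n\<close>. The blocks that follow obey the upper half of the law of large
  numbers.\<close>

lemma displacement_eventually_le:
  assumes fm: "finite_first_moment \<phi> x0 \<mu>"
    and k: "1 \<le> k" "(\<integral>\<omega>. displacement k \<omega> \<partial>W) < c * real k"
  shows "AE \<omega> in W. eventually (\<lambda>n. displacement n \<omega> < c * real n) sequentially"
proof -
  define X where "X = displacement k"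
  define b where "b j \<omega> = (\<Sum>i=0..<j. X (drop_seq (i * k) \<omega>))" for j \<omega>
  have [measurable]: "displacement j \<in> borel_measurable W" for j by (rule displacement_measurable)
  have [measurable]: "drop_seq j \<in> W \<rightarrow>\<^sub>M W" for j by (rule measurable_drop_seq)
  have [measurable]: "b j \<in> borel_measurable W" for j
    unfolding b_def[abs_def] X_def by measurable
  have Xi: "integrable W X" unfolding X_def by (rule integrable_displacement[OF fm])
  have X0: "0 \<le> X \<omega>" for \<omega> unfolding X_def by (rule displacement_nonneg)
  define e where "e = (\<integral>\<omega>. X \<omega> \<partial>W)"
  have e0: "0 \<le> e" unfolding e_def using X0 by (intro integral_nonneg_AE) auto
  \<comment> \<open>Three gaps are used up: \<open>e < e1\<close> contradicts the covering bound,
    \<open>e1 < e2\<close> turns the upper limit into an eventual bound, and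
    \<open>e2 < c * k\<close> absorbs the remainder.\<close>
  obtain e1 where e1: "e < e1" "e1 < c * real k" using dense k(2) unfolding e_def X_def by blast
  obtain e2 where e2: "e1 < e2" "e2 < c * real k" using dense e1(2) by blast
  define A where "A = {\<omega> \<in> space W. linearly_exceeds e1 (\<lambda>j. b j \<omega>)}"
  have A: "A \<in> sets W" unfolding A_def
    by (rule predE, rule measurable_linearly_exceeds) measurable
  have "drop_seq k \<omega> \<in> A \<longleftrightarrow> \<omega> \<in> A" if \<omega>: "\<omega> \<in> space W" for \<omega>
  proof -
    have "b (Suc j) \<omega> = X \<omega> + b j (drop_seq k \<omega>)" for j
      unfolding b_def by (subst sum.atLeast0_lessThan_Suc_shift) (simp add: drop_seq_drop_seq add.commute)
    then have "linearly_exceeds e1 (\<lambda>j. b j \<omega>) \<longleftrightarrow> linearly_exceeds e1 (\<lambda>j. b j (drop_seq k \<omega>))"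
      by (intro linearly_exceeds_shift[of _ _ "X \<omega>"]) (simp add: X0)
    then show ?thesis unfolding A_def using \<omega> drop_seq_space[OF \<omega>] by simp
  qed
  from shift_invariant_zero_one[OF A k(1) this] have "W.prob A = 0 \<or> W.prob A = 1" .
  moreover have "W.prob A \<noteq> 1"
  proof
    assume "W.prob A = 1"
    then have "AE \<omega> in W. \<omega> \<in> A" using W.AE_prob_1 by blast
    then have "AE \<omega> in W. \<exists>j\<ge>1. e1 * real j \<le> (\<Sum>i=0..<j. X ((drop_seq k ^^ i) \<omega>))"
    proof eventually_elim
      case (elim \<omega>)
      then obtain j where "1 \<le> j" "e1 * real j < b j \<omega>" unfolding A_def
        by (auto elim!: linearly_exceeds_point)
      then show ?case unfolding b_def funpow_drop_seq by (intro exI[of _ j]) auto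
    qed
    from shift.birkhoff_sum_integral_ge[OF Xi X0 _ this] have "e1 \<le> e" unfolding e_def using e1 e0 e_def by simp
    then show False using e1 by simp
  qed
  ultimately have nA: "AE \<omega> in W. \<omega> \<notin> A"
    using A by (simp add: W.prob_eq_0)
  \<comment> \<open>The blocks start at time \<open>r\<close>, so the exceptional event must be
    avoided after each of these shifts, all of which preserve the law.\<close>
  have "AE \<omega> in W. drop_seq r \<omega> \<notin> A" for r
  proof -
    have "AE \<omega> in distr W W (drop_seq r). \<omega> \<notin> A" unfolding distr_drop_seq by (rule nA)
    then show ?thesis by (rule AE_distrD[OF measurable_drop_seq])
  qed
  then have "AE \<omega> in W. \<forall>r. drop_seq r \<omega> \<notin> A" by (simp add: AE_all_countable)
  then show ?thesis
    using AE_space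
  proof eventually_elim
    case (elim \<omega>)
    note \<omega> = elim(2)
    have ev: "eventually (\<lambda>j. b j (drop_seq r \<omega>) < e2 * real j) sequentially" for r
    proof (rule not_linearly_exceeds_eventually[OF _ e2(1)])
      show "\<not> linearly_exceeds e1 (\<lambda>j. b j (drop_seq r \<omega>))"
        using elim drop_seq_space[OF \<omega>] unfolding A_def by simp
    qed
    have "eventually (\<lambda>j. \<forall>r\<in>{..<k}. b j (drop_seq r \<omega>) < e2 * real j) sequentially"
      by (rule eventually_ball_finite) (use ev in auto)
    then obtain J where J: "\<And>j r. J \<le> j \<Longrightarrow> r < k \<Longrightarrow> b j (drop_seq r \<omega>) < e2 * real j"
      unfolding eventually_sequentially by auto
    define C where "C = (\<Sum>r<k. displacement r \<omega>)"
    have sub: "displacement (r + j * k) \<omega> \<le> displacement r \<omega> + b j (drop_seq r \<omega>)" for r j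
    proof (induction j)
      case (Suc j)
      have "displacement (r + Suc j * k) \<omega> \<le> displacement (r + j * k) \<omega> + X (drop_seq (r + j * k) \<omega>)"
        using displacement_add(1)[OF \<omega>, of "r + j * k" k] unfolding X_def by (simp add: add_ac)
      moreover have "b (Suc j) (drop_seq r \<omega>) = b j (drop_seq r \<omega>) + X (drop_seq (r + j * k) \<omega>)"
        unfolding b_def by (simp add: drop_seq_drop_seq add.commute)
      ultimately show ?case using Suc.IH by simp
    qed (simp add: b_def)
    have e2': "0 \<le> e2" using e0 e1 e2 by simp
    have ck: "0 < c - e2 / k" using e2(2) k(1) by (simp add: field_simps)
    obtain n0 :: nat where n0: "C < n0 * (c - e2 / k)" using reals_Archimedean3[OF ck] by blast
    show ?case unfolding eventually_sequentially
    proof (intro exI allI impI)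
      fix n assume n: "max n0 (J * k) \<le> n"
      define j where "j = n div k"
      define r where "r = n mod k"
      have nj: "n = r + j * k" unfolding j_def r_def by simp
      have r: "r < k" unfolding r_def using k(1) by simp
      have "J \<le> j" unfolding j_def using n k(1) by (simp add: less_eq_div_iff_mult_less_eq)
      then have "b j (drop_seq r \<omega>) \<le> e2 * real j" using J r by (meson less_imp_le)
      also have "\<dots> \<le> e2 / k * n"
      proof -
        have "real j * real k \<le> real n" unfolding nj by simp
        then have "e2 * (real j * real k) \<le> e2 * real n" using e2' by (rule mult_left_mono)
        then show ?thesis using k(1) by (simp add: field_simps)
      qed
      finally have "displacement n \<omega> \<le> displacement r \<omega> + e2 / k * n" using sub[of r j] unfolding nj by simp
      also have "displacement r \<omega> \<le> C"
        unfolding C_def using r displacement_nonneg by (intro member_le_sum) auto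
      also have "n0 * (c - e2 / k) \<le> n * (c - e2 / k)" using n ck by (intro mult_right_mono) auto
      then have "C < n * (c - e2 / k)" using n0 by simp
      finally show "displacement n \<omega> < c * real n" by (simp add: algebra_simps)
    qed
  qed
qed

text \<open>As a lower limit, the drift is approached from above by the mean for some single
  \<open>k\<close>, and one such \<open>k\<close> controls all large times. Together with the lower
  bound this confines the quotients, outside one null set, for all tolerances given by
  \<open>q\<close>.\<close>

lemma displacement_converges:
  assumes fm: "finite_first_moment \<phi> x0 \<mu>"
  shows "AE \<omega> in W. (\<lambda>n. ennreal (dist x0 (\<phi> (Z n \<omega>) x0) / real n)) \<longlonglongrightarrow> drift G \<phi> x0 \<mu>"
proof -
  define E where "E n = (\<integral>\<omega>. displacement n \<omega> \<partial>W)" for n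
  have E0: "0 \<le> E n" for n unfolding E_def by (intro integral_nonneg_AE) (auto simp: displacement_nonneg)
  have nnE: "(\<integral>\<^sup>+ \<omega>. ennreal (dist (\<phi> (Z n \<omega>) x0) x0) \<partial>W) / of_nat n = ennreal (E n / n)" if "0 < n" for n
  proof -
    have "(\<integral>\<^sup>+ \<omega>. ennreal (dist (\<phi> (Z n \<omega>) x0) x0) \<partial>W) = ennreal (E n)"
      unfolding displacement_def[symmetric] E_def
      by (rule nn_integral_eq_integral) (auto simp: integrable_displacement[OF fm] displacement_nonneg)
    then show ?thesis
      unfolding ennreal_of_nat_eq_real_of_nat using that E0 by (simp add: divide_ennreal)
  qed
  have En: "E n \<le> n * E 1" for n
  proof (induction n)
    case 0
    then show ?case by (simp add: E_def displacement_def)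
  next
    case (Suc n)
    have "E (Suc n) \<le> (\<integral>\<omega>. displacement n \<omega> + displacement 1 ((drop_seq 1 ^^ n) \<omega>) \<partial>W)"
      unfolding E_def
      by (intro integral_mono integrable_displacement[OF fm] Bochner_Integration.integrable_add
          shift.integrable_funpow)
        (use displacement_add(1)[of _ n 1] in \<open>simp add: funpow_drop_seq\<close>)
    also have "\<dots> = E n + E 1"
      unfolding E_def
      by (simp add: Bochner_Integration.integral_add shift.integrable_funpow shift.integral_funpow
          integrable_displacement[OF fm] del: One_nat_def)
    finally show ?case using Suc.IH by (simp add: algebra_simps)
  qed
  have "eventually (\<lambda>n. (\<integral>\<^sup>+ \<omega>. ennreal (dist (\<phi> (Z n \<omega>) x0) x0) \<partial>W) / of_nat n \<le> ennreal (E 1)) sequentially"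
    using eventually_gt_at_top[of 0]
    by eventually_elim (use En in \<open>simp add: nnE ennreal_leI divide_le_eq mult.commute\<close>)
  then have "drift G \<phi> x0 \<mu> \<le> limsup (\<lambda>n. ennreal (E 1))"
    unfolding drift_def by (intro order.trans[OF Liminf_le_Limsup Limsup_mono]) auto
  then have fin: "drift G \<phi> x0 \<mu> < \<top>" by (simp add: Limsup_const le_less_trans)
  define l where "l = enn2real (drift G \<phi> x0 \<mu>)"
  have l: "drift G \<phi> x0 \<mu> = ennreal l" "0 \<le> l" unfolding l_def using fin by auto
  have lower: "AE \<omega> in W. eventually (\<lambda>n. (l - 2 / (real q + 1)) * n < displacement n \<omega>) sequentially" for q :: nat
  proof (cases "0 < l")
    case True
    show ?thesis
    proof (rule displacement_eventually_ge[OF fm, of "l - 1 / (real q + 1)"])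
      show "ennreal (l - 1 / (real q + 1)) < drift G \<phi> x0 \<mu>"
        unfolding l(1) using True by (intro ennreal_lessI) auto
    qed (simp add: field_simps)
  next
    \<comment> \<open>For \<open>l = 0\<close> no value of \<open>ennreal\<close> lies strictly
      below the drift, so the bound comes from nonnegativity instead.\<close>
    case False
    have "eventually (\<lambda>n. (l - 2 / (real q + 1)) * n < displacement n \<omega>) sequentially" for \<omega>
      using eventually_gt_at_top[of 0]
    proof eventually_elim
      case (elim n)
      have "(l - 2 / (real q + 1)) * n < 0" using False l(2) elim by (intro mult_neg_pos) auto
      then show ?case using displacement_nonneg[of n \<omega>] by linarith
    qed
    then show ?thesis by simp
  qed
  have upper: "AE \<omega> in W. eventually (\<lambda>n. displacement n \<omega> < (l + 1 / (real q + 1)) * n) sequentially" for q :: nat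
  proof -
    have "drift G \<phi> x0 \<mu> < ennreal (l + 1 / (real q + 1))"
      unfolding l(1) using l(2) by (intro ennreal_lessI) (auto simp: add_nonneg_pos)
    then have "\<exists>k\<ge>1. (\<integral>\<^sup>+ \<omega>. ennreal (dist (\<phi> (Z k \<omega>) x0) x0) \<partial>W) / of_nat k < ennreal (l + 1 / (real q + 1))"
    proof (rule contrapos_pp)
      assume *: "\<not> (\<exists>k\<ge>1. (\<integral>\<^sup>+ \<omega>. ennreal (dist (\<phi> (Z k \<omega>) x0) x0) \<partial>W) / of_nat k < ennreal (l + 1 / (real q + 1)))"
      have "ennreal (l + 1 / (real q + 1)) \<le> drift G \<phi> x0 \<mu>"
        unfolding drift_def
        by (rule Liminf_bounded) (use * in \<open>auto simp: eventually_sequentially not_less intro!: exI[of _ 1]\<close>)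
      then show "\<not> drift G \<phi> x0 \<mu> < ennreal (l + 1 / (real q + 1))" by simp
    qed
    then obtain k where k: "1 \<le> k" "ennreal (E k / k) < ennreal (l + 1 / (real q + 1))"
      using nnE by force
    then have "E k / k < l + 1 / (real q + 1)" using E0[of k] by (subst (asm) ennreal_less_iff) auto
    then have "E k < (l + 1 / (real q + 1)) * k" using k(1) by (simp add: divide_less_eq)
    then show ?thesis using displacement_eventually_le[OF fm k(1)] unfolding E_def by simp
  qed
  have "AE \<omega> in W. \<forall>q::nat. eventually (\<lambda>n. (l - 2 / (real q + 1)) * n < displacement n \<omega>) sequentially
      \<and> eventually (\<lambda>n. displacement n \<omega> < (l + 1 / (real q + 1)) * n) sequentially"
    unfolding AE_all_countable using lower upper by (auto intro: AE_conjI)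
  then show ?thesis
  proof eventually_elim
    case (elim \<omega>)
    have "(\<lambda>n. displacement n \<omega> / real n) \<longlonglongrightarrow> l"
    proof (rule tendstoI)
      fix \<epsilon> :: real assume "0 < \<epsilon>"
      then obtain q :: nat where "inverse (real (Suc q)) < \<epsilon> / 2" using reals_Archimedean[of "\<epsilon> / 2"] by auto
      then have q: "2 / (real q + 1) < \<epsilon>" by (simp add: inverse_eq_divide field_simps)
      have q1: "1 / (real q + 1) \<le> 2 / (real q + 1)" by (simp add: field_simps)
      have "eventually (\<lambda>n. (l - 2 / (real q + 1)) * n < displacement n \<omega>) sequentially"
        "eventually (\<lambda>n. displacement n \<omega> < (l + 1 / (real q + 1)) * n) sequentially"
        using elim by auto
      then show "eventually (\<lambda>n. dist (displacement n \<omega> / real n) l < \<epsilon>) sequentially"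
        using eventually_gt_at_top[of 0]
      proof eventually_elim
        case (elim n)
        then have "l - 2 / (real q + 1) < displacement n \<omega> / real n" "displacement n \<omega> / real n < l + 1 / (real q + 1)"
          by (simp_all add: less_divide_eq divide_less_eq)
        then show ?case using q q1 unfolding dist_real_def by linarith
      qed
    qed
    then have "(\<lambda>n. ennreal (displacement n \<omega> / real n)) \<longlonglongrightarrow> ennreal l" by (rule tendsto_ennrealI)
    then show ?case unfolding l(1) displacement_def by (simp add: dist_commute)
  qed
qed

end

theorem mainTheorem2:
  fixes G :: "('g, 'b) monoid_scheme"
    and \<mu> :: "'g measure"
    and \<phi> :: "'g \<Rightarrow> 'x::polish_space \<Rightarrow> 'x"
    and x0 :: 'x
  assumes "group G" and "countable (carrier G)"
    and "prob_space \<mu>" and "sets \<mu> = Pow (carrier G)" and "admissible G \<mu>"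
    and "CAT0 TYPE('x)"
    and "isometric_action G \<phi>"
    and "\<exists>g\<in>carrier G. \<exists>h\<in>carrier G.
           contracting (\<phi> g) \<and> contracting (\<phi> h) \<and> independent_elements G \<phi> x0 g h"
  shows "drift G \<phi> x0 \<mu> > 0
    \<and> (finite_first_moment \<phi> x0 \<mu> \<longrightarrow>
        (AE \<omega> in walk_space \<mu>.
          (\<lambda>n. ennreal (dist x0 (\<phi> (walk G n \<omega>) x0) / real n)) \<longlonglongrightarrow> drift G \<phi> x0 \<mu>))"
proof -
  interpret G: group G by fact
  interpret prob_space \<mu> by fact
  interpret random_walk_action G \<mu> \<phi> x0
    using assms(2,4,7) by unfold_locales auto
  have geo: "\<exists>T. geodesic_segment T x y" for x y :: 'x
    using assms(6) unfolding CAT0_def by blast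
  \<comment> \<open>The period \<open>m\<close> depends on the walk alone and is fixed before the
    letters, which can then be built as m-th powers and hit at one common time.\<close>
  obtain m where m: "1 \<le> m" and hits: "\<And>A. finite A \<Longrightarrow> (\<forall>a\<in>A. \<exists>b\<in>carrier G. a = b [^]\<^bsub>G\<^esub> (m::nat)) \<Longrightarrow>
      \<exists>K\<ge>1. \<forall>a\<in>A. 0 < hit K a"
    using common_hitting_time[OF assms(5)] by blast
  obtain g h where gh: "g \<in> carrier G" "contracting (\<phi> g)" "h \<in> carrier G" "contracting (\<phi> h)"
    "independent_elements G \<phi> x0 g h"
    using assms(8) by blast
  have "0 < m" using m by simp
  from schottky_set_exists[OF geo gh this] obtain S p q K D R T
    where sch: "schottky_set G \<phi> x0 S p q K D R T" and pow: "\<forall>a\<in>S. \<exists>b\<in>carrier G. a = b [^]\<^bsub>G\<^esub> m"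
    by blast
  interpret sch: schottky_set G \<phi> x0 S p q K D R T by (rule sch)
  obtain L where L: "1 \<le> L" "\<And>a. a \<in> S \<Longrightarrow> 0 < hit L a"
    using hits[OF sch.finite_S pow] by blast
  have "0 < hit (L + L) (a \<otimes>\<^bsub>G\<^esub> b)" if "a \<in> S" "b \<in> S" for a b
    using that L(2) sch.S_closed by (intro hit_add_pos)
  from displacement_decay[OF sch this] obtain r where r: "0 < r" "r < 1"
    "\<And>N. (\<integral>\<omega>. (1/4) powr dist x0 (\<phi> (walk G N \<omega>) x0) \<partial>walk_space \<mu>) \<le> r ^ (N div (L + L))"
    by blast
  have "0 < drift G \<phi> x0 \<mu>"
    by (rule drift_pos[OF r(1,2) _ r(3)]) (use L(1) in simp)
  then show ?thesis using displacement_converges by blast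
qed

end
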